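(* Let $n\ge2$ and $\lambda$ a partition with at most $n$ rows, and consider the Gelfand–Tsetlin lattice $GT(\lambda)$ as a supporting graph of the irreducible representation of $\mathfrak{sl}_n$ with highest weight $\lambda$. For any assignment of edge labels to $GT(\lambda)$ satisfying the crossing and diamond conditions, all edge products are uniquely determined (by the vertex values $m_i(s)$); consequently $GT(\lambda)$ has the solitary property. Moreover, $GT(\lambda)$ is edge-minimal.
   Context: $GT(\lambda)$: the poset whose vertices are semistandard Young tableaux of shape $\lambda$ with entries in $[n]$, with an edge $S\stackrel{k}{\rightarrow}T$ (color $k\in\{1,\dots,n-1\}$, $S\lessdot T$) whenever $T$ is obtained from $S$ by changing a single entry $k+1$ into $k$. General setup for an edge-colored (colors $I$) finite ranked poset $P$ whose edges $s\to t$ carry two complex labels $c_{t,s},d_{s,t}$, not both $0$: $V[P]$ has basis $\{v_s\}$; $X_iv_s=\sum_{t:\,s\stackrel{i}{\to}t}c_{t,s}v_t$, $Y_iv_t=\sum_{s:\,s\stackrel{i}{\to}t}d_{s,t}v_s$, $H_iv_s=m_i(s)v_s$, where $m_i(s)=2\rho_i(s)-l_i(s)$, with $l_i(s)$ the rank of the $i$-component (connected component of the subgraph of $i$-colored edges) containing $s$ and $\rho_i(s)$ the rank of $s$ in it. Edge product: $\pi_{s,t}=c_{t,s}d_{s,t}$. Crossing condition: $\sum_{r:\,r\stackrel{i}{\to}s}\pi_{r,s}-\sum_{t:\,s\stackrel{i}{\to}t}\pi_{s,t}=m_i(s)$ for all $s,i$. Diamond condition: for all $s,t$ of the same rank and colors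 $i,j$, $\sum_{u:\,s\stackrel{j}{\to}u,\ t\stackrel{i}{\to}u}c_{u,s}d_{t,u}=\sum_{r:\,r\stackrel{i}{\to}s,\ r\stackrel{j}{\to}t}d_{r,s}c_{t,r}$. Structure condition: $\sum_i m_i(s)\omega_i+\alpha_i=\sum_i m_i(t)\omega_i$ whenever $s\stackrel{i}{\to}t$. These actions (with $X_k=E_{k,k+1}$, $Y_k=E_{k+1,k}$, $H_k=E_{kk}-E_{k+1,k+1}$ for $\mathfrak{sl}_n$) define a representation iff the three conditions hold; then $\{v_s\}$ is a weight basis, $P$ a supporting graph, and $P$ with labels a representation diagram. A supporting graph is edge-minimal if no proper subgraph is the supporting graph of a weight basis of the same representation. Two weight bases are diagonally equivalent if related by a diagonal transition matrix; a supporting graph is solitary if the only weight bases with that supporting graph are those diagonally equivalent to a given one. *)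

theory Defs
  imports Complex_Main "Jordan_Normal_Form.Matrix"
begin

section \<open>Edge-coloured ranked posets and edge labels\<close>

text \<open>
  A poset is given by its vertex set \<open>P\<close> and, for each colour \<open>i\<close>, the set \<open>E i\<close> of covering pairs
  \<open>(s, t)\<close>, meaning \<open>s \<rightarrow> t\<close> with colour \<open>i\<close>. The partial order is the reflexive-transitive closure
  of all edges; a rank function that increases by exactly one along every edge makes this closure
  antisymmetric and makes every edge a covering relation.
\<close>

definition is_rank_function :: "'a set \<Rightarrow> ('a \<times> 'a) set \<Rightarrow> ('a \<Rightarrow> nat) \<Rightarrow> bool" where
  "is_rank_function C R f \<longleftrightarrow>
     (\<forall>s\<in>C. \<forall>t\<in>C. (s, t) \<in> R \<longrightarrow> f t = Suc (f s)) \<and> (\<exists>s\<in>C. f s = 0)"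

text \<open>On a connected ranked poset the normalised rank function is unique, so that the following two
  descriptions are proper.\<close>

definition rank_in :: "'a set \<Rightarrow> ('a \<times> 'a) set \<Rightarrow> 'a \<Rightarrow> nat" where
  "rank_in C R s = (THE r. \<exists>f. is_rank_function C R f \<and> r = f s)"

definition poset_rank :: "'a set \<Rightarrow> ('a \<times> 'a) set \<Rightarrow> nat" where
  "poset_rank C R = (THE l. \<exists>f. is_rank_function C R f \<and> l = Max (f ` C))"

definition colored_ranked_poset :: "nat set \<Rightarrow> 'a set \<Rightarrow> (nat \<Rightarrow> ('a \<times> 'a) set) \<Rightarrow> bool" where
  "colored_ranked_poset I P E \<longleftrightarrow>
     finite P \<and>
     (\<forall>i\<in>I. E i \<subseteq> P \<times> P) \<and>
     (\<forall>i. i \<notin> I \<longrightarrow> E i = {}) \<and>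
     (\<forall>i\<in>I. \<forall>j\<in>I. i \<noteq> j \<longrightarrow> E i \<inter> E j = {}) \<and>
     (\<exists>f. is_rank_function P (\<Union>i\<in>I. E i) f)"

definition component :: "(nat \<Rightarrow> ('a \<times> 'a) set) \<Rightarrow> nat \<Rightarrow> 'a \<Rightarrow> 'a set" where
  "component E i s = {t. (s, t) \<in> (E i \<union> (E i)\<inverse>)\<^sup>*}"

definition vertex_value :: "(nat \<Rightarrow> ('a \<times> 'a) set) \<Rightarrow> nat \<Rightarrow> 'a \<Rightarrow> int" where
  "vertex_value E i s =
     2 * int (rank_in (component E i s) (E i) s) - int (poset_rank (component E i s) (E i))"

text \<open>An edge from \<open>s\<close> to \<open>t\<close> carries the two labels \<open>c t s\<close> and \<open>d s t\<close>.\<close>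

definition edge_labels ::
  "nat set \<Rightarrow> (nat \<Rightarrow> ('a \<times> 'a) set) \<Rightarrow> ('a \<Rightarrow> 'a \<Rightarrow> complex) \<Rightarrow> ('a \<Rightarrow> 'a \<Rightarrow> complex) \<Rightarrow> bool" where
  "edge_labels I E c d \<longleftrightarrow> (\<forall>i\<in>I. \<forall>s t. (s, t) \<in> E i \<longrightarrow> c t s \<noteq> 0 \<or> d s t \<noteq> 0)"

definition edge_product ::
  "('a \<Rightarrow> 'a \<Rightarrow> complex) \<Rightarrow> ('a \<Rightarrow> 'a \<Rightarrow> complex) \<Rightarrow> 'a \<Rightarrow> 'a \<Rightarrow> complex" where
  "edge_product c d s t = c t s * d s t"

definition crossing_condition ::
  "nat set \<Rightarrow> 'a set \<Rightarrow> (nat \<Rightarrow> ('a \<times> 'a) set) \<Rightarrow>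
   ('a \<Rightarrow> 'a \<Rightarrow> complex) \<Rightarrow> ('a \<Rightarrow> 'a \<Rightarrow> complex) \<Rightarrow> bool" where
  "crossing_condition I P E c d \<longleftrightarrow>
     (\<forall>i\<in>I. \<forall>s\<in>P.
        (\<Sum>r | (r, s) \<in> E i. edge_product c d r s) - (\<Sum>t | (s, t) \<in> E i. edge_product c d s t)
          = of_int (vertex_value E i s))"

text \<open>The vertices \<open>s\<close> and \<open>t\<close> have to be distinct: for \<open>s = t\<close> and \<open>i = j\<close> the equation would
  contradict the crossing condition wherever \<open>vertex_value E i s \<noteq> 0\<close>.\<close>

definition diamond_condition ::
  "nat set \<Rightarrow> 'a set \<Rightarrow> (nat \<Rightarrow> ('a \<times> 'a) set) \<Rightarrow>
   ('a \<Rightarrow> 'a \<Rightarrow> complex) \<Rightarrow> ('a \<Rightarrow> 'a \<Rightarrow> complex) \<Rightarrow> bool" where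
  "diamond_condition I P E c d \<longleftrightarrow>
     (\<forall>i\<in>I. \<forall>j\<in>I. \<forall>s\<in>P. \<forall>t\<in>P.
        s \<noteq> t \<and> rank_in P (\<Union>k\<in>I. E k) s = rank_in P (\<Union>k\<in>I. E k) t \<longrightarrow>
        (\<Sum>u | (s, u) \<in> E j \<and> (t, u) \<in> E i. c u s * d t u) =
        (\<Sum>r | (r, s) \<in> E i \<and> (r, t) \<in> E j. d r s * c t r))"


section \<open>Representations of the special linear Lie algebra\<close>

definition sl :: "nat \<Rightarrow> complex mat set" where
  "sl n = {A \<in> carrier_mat n n. (\<Sum>i<n. A $$ (i, i)) = 0}"

text \<open>Indices \<open>i, j\<close> of matrix units, and the indices of the generators below, are counted from 1,
  whereas matrix entries are counted from 0.\<close>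

definition matrix_unit :: "nat \<Rightarrow> nat \<Rightarrow> nat \<Rightarrow> complex mat" where
  "matrix_unit n i j = mat n n (\<lambda>(a, b). if Suc a = i \<and> Suc b = j then 1 else 0)"

definition gen_X :: "nat \<Rightarrow> nat \<Rightarrow> complex mat" where
  "gen_X n k = matrix_unit n k (k + 1)"

definition gen_Y :: "nat \<Rightarrow> nat \<Rightarrow> complex mat" where
  "gen_Y n k = matrix_unit n (k + 1) k"

definition gen_H :: "nat \<Rightarrow> nat \<Rightarrow> complex mat" where
  "gen_H n k = matrix_unit n k k - matrix_unit n (k + 1) (k + 1)"

definition sl_representation ::
  "nat \<Rightarrow> (complex \<Rightarrow> 'v \<Rightarrow> 'v::ab_group_add) \<Rightarrow> (complex mat \<Rightarrow> 'v \<Rightarrow> 'v) \<Rightarrow> bool" where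
  "sl_representation n scale \<phi> \<longleftrightarrow>
     vector_space scale \<and>
     (\<forall>A\<in>sl n. Vector_Spaces.linear scale scale (\<phi> A)) \<and>
     (\<forall>A\<in>sl n. \<forall>B\<in>sl n. \<forall>v. \<phi> (A + B) v = \<phi> A v + \<phi> B v) \<and>
     (\<forall>a. \<forall>A\<in>sl n. \<forall>v. \<phi> (a \<cdot>\<^sub>m A) v = scale a (\<phi> A v)) \<and>
     (\<forall>A\<in>sl n. \<forall>B\<in>sl n. \<forall>v. \<phi> (A * B - B * A) v = \<phi> A (\<phi> B v) - \<phi> B (\<phi> A v))"

definition irreducible_sl_representation ::
  "nat \<Rightarrow> (complex \<Rightarrow> 'v \<Rightarrow> 'v::ab_group_add) \<Rightarrow> (complex mat \<Rightarrow> 'v \<Rightarrow> 'v) \<Rightarrow> bool" where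
  "irreducible_sl_representation n scale \<phi> \<longleftrightarrow>
     sl_representation n scale \<phi> \<and>
     (UNIV :: 'v set) \<noteq> {0} \<and>
     (\<forall>U. module.subspace scale U \<and> (\<forall>A\<in>sl n. \<phi> A ` U \<subseteq> U) \<longrightarrow> U = {0} \<or> U = UNIV)"

text \<open>A partition is a weakly decreasing function with \<open>lam i\<close> the length of row \<open>i\<close>, rows being
  counted from 0; so the weight \<open>lam\<close> takes the value \<open>lam (k - 1) - lam k\<close> on \<open>H\<^sub>k\<close>.\<close>

definition has_highest_weight ::
  "nat \<Rightarrow> (complex \<Rightarrow> 'v \<Rightarrow> 'v::ab_group_add) \<Rightarrow> (complex mat \<Rightarrow> 'v \<Rightarrow> 'v) \<Rightarrow> (nat \<Rightarrow> nat) \<Rightarrow> bool" where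
  "has_highest_weight n scale \<phi> lam \<longleftrightarrow>
     (\<exists>v. v \<noteq> 0 \<and>
        (\<forall>k\<in>{1..<n}. \<phi> (gen_X n k) v = 0 \<and>
           \<phi> (gen_H n k) v = scale (of_nat (lam (k - 1)) - of_nat (lam k)) v))"


section \<open>Weight bases and supporting graphs\<close>

definition indexed_basis ::
  "(complex \<Rightarrow> 'v \<Rightarrow> 'v::ab_group_add) \<Rightarrow> 'a set \<Rightarrow> ('a \<Rightarrow> 'v) \<Rightarrow> bool" where
  "indexed_basis scale P v \<longleftrightarrow>
     inj_on v P \<and> \<not> module.dependent scale (v ` P) \<and> module.span scale (v ` P) = UNIV"

definition representation_diagram ::
  "nat \<Rightarrow> (complex \<Rightarrow> 'v \<Rightarrow> 'v::ab_group_add) \<Rightarrow> (complex mat \<Rightarrow> 'v \<Rightarrow> 'v) \<Rightarrow>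
   'a set \<Rightarrow> (nat \<Rightarrow> ('a \<times> 'a) set) \<Rightarrow>
   ('a \<Rightarrow> 'a \<Rightarrow> complex) \<Rightarrow> ('a \<Rightarrow> 'a \<Rightarrow> complex) \<Rightarrow> ('a \<Rightarrow> 'v) \<Rightarrow> bool" where
  "representation_diagram n scale \<phi> P E c d v \<longleftrightarrow>
     colored_ranked_poset {1..<n} P E \<and>
     edge_labels {1..<n} E c d \<and>
     indexed_basis scale P v \<and>
     (\<forall>i\<in>{1..<n}. \<forall>s\<in>P.
        \<phi> (gen_X n i) (v s) = (\<Sum>t | (s, t) \<in> E i. scale (c t s) (v t)) \<and>
        \<phi> (gen_Y n i) (v s) = (\<Sum>r | (r, s) \<in> E i. scale (d r s) (v r)) \<and>
        \<phi> (gen_H n i) (v s) = scale (of_int (vertex_value E i s)) (v s))"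

definition weight_basis_supported_by ::
  "nat \<Rightarrow> (complex \<Rightarrow> 'v \<Rightarrow> 'v::ab_group_add) \<Rightarrow> (complex mat \<Rightarrow> 'v \<Rightarrow> 'v) \<Rightarrow>
   'a set \<Rightarrow> (nat \<Rightarrow> ('a \<times> 'a) set) \<Rightarrow> ('a \<Rightarrow> 'v) \<Rightarrow> bool" where
  "weight_basis_supported_by n scale \<phi> P E v \<longleftrightarrow>
     (\<exists>c d. representation_diagram n scale \<phi> P E c d v)"

definition supporting_graph ::
  "nat \<Rightarrow> (complex \<Rightarrow> 'v \<Rightarrow> 'v::ab_group_add) \<Rightarrow> (complex mat \<Rightarrow> 'v \<Rightarrow> 'v) \<Rightarrow>
   'a set \<Rightarrow> (nat \<Rightarrow> ('a \<times> 'a) set) \<Rightarrow> bool" where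
  "supporting_graph n scale \<phi> P E \<longleftrightarrow> (\<exists>v. weight_basis_supported_by n scale \<phi> P E v)"

definition diagonally_equivalent ::
  "(complex \<Rightarrow> 'v \<Rightarrow> 'v) \<Rightarrow> 'a set \<Rightarrow> ('a \<Rightarrow> 'v) \<Rightarrow> ('a \<Rightarrow> 'v) \<Rightarrow> bool" where
  "diagonally_equivalent scale P v w \<longleftrightarrow> (\<exists>a. \<forall>s\<in>P. a s \<noteq> 0 \<and> w s = scale (a s) (v s))"

definition solitary ::
  "nat \<Rightarrow> (complex \<Rightarrow> 'v \<Rightarrow> 'v::ab_group_add) \<Rightarrow> (complex mat \<Rightarrow> 'v \<Rightarrow> 'v) \<Rightarrow>
   'a set \<Rightarrow> (nat \<Rightarrow> ('a \<times> 'a) set) \<Rightarrow> bool" where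
  "solitary n scale \<phi> P E \<longleftrightarrow>
     supporting_graph n scale \<phi> P E \<and>
     (\<forall>v w. weight_basis_supported_by n scale \<phi> P E v \<and> weight_basis_supported_by n scale \<phi> P E w
        \<longrightarrow> diagonally_equivalent scale P v w)"

definition edge_minimal ::
  "nat \<Rightarrow> (complex \<Rightarrow> 'v \<Rightarrow> 'v::ab_group_add) \<Rightarrow> (complex mat \<Rightarrow> 'v \<Rightarrow> 'v) \<Rightarrow>
   'a set \<Rightarrow> (nat \<Rightarrow> ('a \<times> 'a) set) \<Rightarrow> bool" where
  "edge_minimal n scale \<phi> P E \<longleftrightarrow>
     supporting_graph n scale \<phi> P E \<and>
     \<not> (\<exists>P' E'. P' \<subseteq> P \<and> (\<forall>i. E' i \<subseteq> E i) \<and> (P', E') \<noteq> (P, E) \<and>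
          supporting_graph n scale \<phi> P' E')"


section \<open>The Gelfand--Tsetlin lattice\<close>

definition young_diagram :: "(nat \<Rightarrow> nat) \<Rightarrow> (nat \<times> nat) set" where
  "young_diagram lam = {(i, j). j < lam i}"

text \<open>Fillings are extended by 0 outside the diagram, so that equal tableaux are equal functions.\<close>

definition ssyt :: "nat \<Rightarrow> (nat \<Rightarrow> nat) \<Rightarrow> (nat \<times> nat \<Rightarrow> nat) set" where
  "ssyt n lam = {T.
     (\<forall>x\<in>young_diagram lam. T x \<in> {1..n}) \<and>
     (\<forall>x. x \<notin> young_diagram lam \<longrightarrow> T x = 0) \<and>
     (\<forall>i j. (i, Suc j) \<in> young_diagram lam \<longrightarrow> T (i, j) \<le> T (i, Suc j)) \<and>
     (\<forall>i j. (Suc i, j) \<in> young_diagram lam \<longrightarrow> T (i, j) < T (Suc i, j))}"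

definition gt_edges ::
  "nat \<Rightarrow> (nat \<Rightarrow> nat) \<Rightarrow> nat \<Rightarrow> ((nat \<times> nat \<Rightarrow> nat) \<times> (nat \<times> nat \<Rightarrow> nat)) set" where
  "gt_edges n lam k = {(S, T). k \<in> {1..<n} \<and> S \<in> ssyt n lam \<and> T \<in> ssyt n lam \<and>
     (\<exists>x\<in>young_diagram lam. S x = k + 1 \<and> T = S(x := k))}"

end

theory Submission
  imports Defs
begin

text \<open>
  A tableau is encoded by its pattern \<open>p k i\<close>, the number of entries at most \<open>k\<close> in row \<open>i\<close>; an edge
  of colour \<open>k\<close> raises one entry of row \<open>k\<close> by one. The classical Gelfand--Tsetlin formula gives
  positive edge products: the crossing condition says that the residues of a rational function add up
  to the difference of the sums of its poles and zeros.

  Any solution has these edge products. Proceeding by rank and then by colour, the product on an edge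
  \<open>s \<rightarrow> u\<close> follows from a diamond if \<open>u\<close> has a lower neighbour of smaller colour, and for given \<open>s\<close>
  and colour at most one \<open>u\<close> has none, so that the crossing condition settles the remaining edge.

  Square roots of the products as labels turn the functions on the lattice into a module in which
  only multiples of the top vertex are killed by all \<open>X\<^sub>k\<close>. Hence the submodule of its direct sum with
  the given representation that is generated by the pair of highest weight vectors is the graph of
  an isomorphism, and the lattice is a supporting graph. Two weight bases with this supporting graph
  have equal edge products, so their labels differ by a gauge factor, which is a coboundary by the
  diamond condition; Schur's lemma finishes the proof that the lattice is solitary. A supporting
  subgraph has the same vertices and weights, and its labels, extended by zero, solve the conditions
  on the lattice; since all edge products are nonzero, no edge is missing.
\<close>

section \<open>Tableaux and Gelfand--Tsetlin patterns\<close>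

text \<open>The representation is given abstractly, so nothing is known at first about its dimension
  or its weight multiplicities, and the lattice has to be tied to it by hand. On the functions on
  the lattice only the relations between \<open>X i\<close> and \<open>Y j\<close> and the weight
  shift along edges are verified; that these functions form an sl_n-module is a consequence of the
  isomorphism. The isomorphism appears as a relation, and its bijectivity rests on two opposite
  mechanisms: irreducibility on the side of the representation, and on the side of functions the
  fact that raising repeatedly always ends at the top vertex.

  Positivity of the edge products carries much of the weight. It permits division in every diamond,
  and it provides real square roots as labels, equal in both directions, so that \<open>X\<close>
  and \<open>Y\<close> become transposes of each other.

  The product formula has denominators that can vanish at entries which cannot be raised. The
  residue identity is therefore needed in a form that admits colliding poles.\<close>

definition gt_patterns :: "nat \<Rightarrow> (nat \<Rightarrow> nat) \<Rightarrow> (nat \<Rightarrow> nat \<Rightarrow> int) set" where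
  "gt_patterns n lam = {p. (\<forall>k i. p k i \<le> p (Suc k) i \<and> p (Suc k) (Suc i) \<le> p k i) \<and>
     (\<forall>k i. k \<le> i \<longrightarrow> p k i = 0) \<and> (\<forall>k i. n \<le> k \<longrightarrow> p k i = int (lam i))}"

definition row_count :: "(nat \<Rightarrow> nat) \<Rightarrow> (nat \<times> nat \<Rightarrow> nat) \<Rightarrow> nat \<Rightarrow> nat \<Rightarrow> int" where
  "row_count lam T k i = int (card {j. j < lam i \<and> T (i, j) \<le> k})"

definition increment :: "(nat \<Rightarrow> nat \<Rightarrow> int) \<Rightarrow> nat \<Rightarrow> nat \<Rightarrow> nat \<Rightarrow> nat \<Rightarrow> int" where
  "increment p k i = p(k := (p k)(i := p k i + 1))"

lemma increment_apply:
  "increment p k i k' i' = p k' i' + (if k' = k \<and> i' = i then 1 else 0)"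
  by (simp add: increment_def)

section \<open>Counts of small entries in the rows of a tableau\<close>

lemma lessThan_card_if_downset:
  fixes S :: "nat set"
  assumes "finite S" "\<And>a b. a \<in> S \<Longrightarrow> b < a \<Longrightarrow> b \<in> S"
  shows "S = {..<card S}"
proof (cases "S = {}")
  case False
  have "S = {..Max S}"
  proof
    show "S \<subseteq> {..Max S}" using assms(1) by auto
    show "{..Max S} \<subseteq> S"
      using assms(2)[OF Max_in[OF assms(1) False]] Max_in[OF assms(1) False]
      by (metis atMost_iff nat_less_le subsetI)
  qed
  then show ?thesis by (metis card_atMost lessThan_Suc_atMost)
qed simp

lemma ssyt_row_mono:
  assumes "T \<in> ssyt n lam" "j \<le> j'" "j' < lam i"
  shows "T (i, j) \<le> T (i, j')"
  using assms(2,3)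
proof (induction j' rule: dec_induct)
  case (step m)
  then have "T (i, m) \<le> T (i, Suc m)"
    using assms(1) by (auto simp: ssyt_def young_diagram_def)
  with step show ?case by simp
qed simp

text \<open>Rows increase weakly, so the entries at most \<open>k\<close> fill an initial segment of
  row \<open>i\<close>, and lying in it amounts to comparing the column with its length. The
  passages between tableaux and patterns rest on this equivalence.\<close>

lemma less_row_count_iff:
  assumes "T \<in> ssyt n lam"
  shows "int j < row_count lam T k i \<longleftrightarrow> j < lam i \<and> T (i, j) \<le> k"
proof -
  let ?S = "{j. j < lam i \<and> T (i, j) \<le> k}"
  have "?S = {..<card ?S}"
    by (rule lessThan_card_if_downset)
       (auto intro: order_trans[OF ssyt_row_mono[OF assms less_imp_le]])
  then have "j \<in> ?S \<longleftrightarrow> j < card ?S" by blast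
  then show ?thesis by (simp add: row_count_def)
qed

text \<open>Lets inequalities between counts be checked cell by cell through
  \<open>less_row_count_iff\<close>.\<close>

lemma int_le_iff_less:
  fixes a b :: int
  assumes "0 \<le> b"
  shows "a \<le> b \<longleftrightarrow> (\<forall>j. int j < a \<longrightarrow> int j < b)"
proof
  assume "\<forall>j. int j < a \<longrightarrow> int j < b"
  then have "\<not> int (nat b) < a" using assms by (metis nat_0_le less_irrefl)
  then show "a \<le> b" using assms by simp
qed auto

lemma row_count_nonneg [simp]: "0 \<le> row_count lam T k i"
  by (simp add: row_count_def)

text \<open>Columns increase strictly, starting from an entry at least 1. This is why row
  \<open>k\<close> of a pattern vanishes from index \<open>k\<close> on.\<close>

lemma ssyt_entry_gt_row:
  assumes "antimono lam" "T \<in> ssyt n lam" "j < lam i"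
  shows "i < T (i, j)"
  using assms(3)
proof (induction i)
  case 0
  then show ?case using assms(2) by (force simp: ssyt_def young_diagram_def)
next
  case (Suc i)
  have "j < lam i" using Suc.prems antimonoD[OF assms(1), of i "Suc i"] by simp
  then have "i < T (i, j)" using Suc.IH by simp
  moreover have "T (i, j) < T (Suc i, j)"
    using assms(2) Suc.prems by (auto simp: ssyt_def young_diagram_def)
  ultimately show ?case by simp
qed

text \<open>Column strictness gives the second interlacing inequality. Padding the triangle with
  zeros in each row and with copies of \<open>lam\<close> after row \<open>n\<close> lets both
  inequalities hold for all indices, without range conditions.\<close>

lemma row_count_in_gt_patterns:
  assumes lam: "antimono lam" and T: "T \<in> ssyt n lam"
  shows "row_count lam T \<in> gt_patterns n lam"
proof -
  have 1: "row_count lam T k i \<le> row_count lam T (Suc k) i" for k i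
    unfolding int_le_iff_less[OF row_count_nonneg] less_row_count_iff[OF T] by auto
  have 2: "row_count lam T (Suc k) (Suc i) \<le> row_count lam T k i" for k i
    unfolding int_le_iff_less[OF row_count_nonneg] less_row_count_iff[OF T]
  proof (intro allI impI)
    fix j assume j: "j < lam (Suc i) \<and> T (Suc i, j) \<le> Suc k"
    then have "T (i, j) < T (Suc i, j)" using T by (auto simp: ssyt_def young_diagram_def)
    with j show "j < lam i \<and> T (i, j) \<le> k" using antimonoD[OF lam, of i "Suc i"] by simp
  qed
  have "{j. j < lam i \<and> T (i, j) \<le> k} = {}" if "k \<le> i" for k i
    using ssyt_entry_gt_row[OF lam T] that by force
  then have 3: "row_count lam T k i = 0" if "k \<le> i" for k i
    using that by (simp add: row_count_def)
  have "{j. j < lam i \<and> T (i, j) \<le> k} = {..<lam i}" if "n \<le> k" for k i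
    using T that by (fastforce simp: ssyt_def young_diagram_def)
  then have 4: "row_count lam T k i = int (lam i)" if "n \<le> k" for k i
    using that by (simp add: row_count_def)
  show ?thesis unfolding gt_patterns_def using 1 2 3 4 by blast
qed

lemma nat_eq_if_le_iff: "(\<And>k. (a::nat) \<le> k \<longleftrightarrow> b \<le> k) \<Longrightarrow> a = b"
  by (meson dual_order.antisym order_refl)

lemma inj_on_row_count: "inj_on (row_count lam) (ssyt n lam)"
proof (rule inj_onI)
  fix S T assume S: "S \<in> ssyt n lam" and T: "T \<in> ssyt n lam"
    and eq: "row_count lam S = row_count lam T"
  have "S (i, j) = T (i, j)" for i j
  proof (cases "j < lam i")
    case True
    have "S (i, j) \<le> k \<longleftrightarrow> T (i, j) \<le> k" for k
      using less_row_count_iff[OF S, of j k i] less_row_count_iff[OF T, of j k i] eq True by simp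
    then show ?thesis by (rule nat_eq_if_le_iff)
  next
    case False
    then show ?thesis using S T by (simp add: ssyt_def young_diagram_def)
  qed
  then show "S = T" by auto
qed

lemma gt_patterns_mono_row:
  assumes "p \<in> gt_patterns n lam" "k \<le> k'"
  shows "p k i \<le> p k' i"
  using assms(2)
proof (induction k' rule: dec_induct)
  case (step m)
  have "p m i \<le> p (Suc m) i" using assms(1) by (simp add: gt_patterns_def)
  with step show ?case by simp
qed simp

lemma gt_patterns_nonneg:
  assumes "p \<in> gt_patterns n lam"
  shows "0 \<le> p k i"
  using gt_patterns_mono_row[OF assms, of 0 k i] assms by (simp add: gt_patterns_def)

lemma gt_patterns_le_last:
  assumes "p \<in> gt_patterns n lam"
  shows "p k i \<le> int (lam i)"
proof (cases "k \<le> n")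
  case True
  have "p n i = int (lam i)" using assms by (simp add: gt_patterns_def)
  then show ?thesis using gt_patterns_mono_row[OF assms True, of i] by simp
next
  case False
  then show ?thesis using assms by (simp add: gt_patterns_def)
qed

lemma gt_pattern_is_row_count:
  assumes p: "p \<in> gt_patterns n lam"
  obtains T where "T \<in> ssyt n lam" "row_count lam T = p"
proof -
  \<comment> \<open>A cell in column \<open>j\<close> gets the first level at which its row has more
    than \<open>j\<close> entries. Since row \<open>n\<close> of the pattern is \<open>lam\<close>,
    such a level exists inside the diagram.\<close>
  define T where "T = (\<lambda>(i, j). if j < lam i then LEAST k. int j < p k i else 0)"
  have pn: "p n i = int (lam i)" and p0: "p 0 i = 0" for i
    using p by (auto simp: gt_patterns_def)
  have T_le: "T (i, j) \<le> k \<longleftrightarrow> int j < p k i" if "j < lam i" for i j k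
  proof -
    have ex: "int j < p n i" using that pn by simp
    have least: "int j < p (LEAST k. int j < p k i) i" using ex by (rule LeastI)
    show ?thesis
    proof
      assume "T (i, j) \<le> k"
      then show "int j < p k i"
        using least gt_patterns_mono_row[OF p, of "T (i, j)" k i] that by (simp add: T_def)
    next
      assume "int j < p k i"
      then show "T (i, j) \<le> k" using that by (simp add: T_def Least_le)
    qed
  qed
  have "T \<in> ssyt n lam"
  proof -
    have "T x \<in> {1..n}" if "x \<in> young_diagram lam" for x
    proof -
      from that obtain i j where x: "x = (i, j)" and j: "j < lam i"
        by (auto simp: young_diagram_def)
      show ?thesis using T_le[OF j, of n] T_le[OF j, of 0] pn p0 j x by auto
    qed
    moreover have "T x = 0" if "x \<notin> young_diagram lam" for x
      using that by (auto simp: T_def young_diagram_def split: prod.splits)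
    moreover have "T (i, j) \<le> T (i, Suc j)" if "(i, Suc j) \<in> young_diagram lam" for i j
    proof -
      have j: "Suc j < lam i" using that by (simp add: young_diagram_def)
      show ?thesis
        using T_le[OF j, of "T (i, Suc j)"] T_le[of j i "T (i, Suc j)"] j by simp
    qed
    moreover have "T (i, j) < T (Suc i, j)" if "(Suc i, j) \<in> young_diagram lam" for i j
    proof -
      have j: "j < lam (Suc i)" using that by (simp add: young_diagram_def)
      let ?k = "T (Suc i, j)"
      have k: "int j < p ?k (Suc i)" using T_le[OF j] by blast
      then have "?k \<noteq> 0" using p0 by (metis not_less of_nat_0_le_iff)
      then obtain k where k': "?k = Suc k" using not0_implies_Suc by blast
      \<comment> \<open>A cell filled at level \<open>Suc k\<close> has, by interlacing, the cell
        above it filled at level \<open>k\<close> already; this is column strictness.\<close>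
      have "p (Suc k) (Suc i) \<le> p k i" using p by (simp add: gt_patterns_def)
      then have jk: "int j < p k i" using k k' by simp
      then have "j < lam i" using gt_patterns_le_last[OF p, of k i] by simp
      then show ?thesis using T_le[of j i k] jk k' by (simp add: less_Suc_eq_le)
    qed
    ultimately show ?thesis by (simp add: ssyt_def)
  qed
  moreover have "row_count lam T k i = p k i" for k i
  proof -
    have "j < lam i \<and> T (i, j) \<le> k \<longleftrightarrow> int j < p k i" for j
      using T_le[of j i k] gt_patterns_le_last[OF p, of k i] by auto
    then have "{j. j < lam i \<and> T (i, j) \<le> k} = {j. int j < p k i}" by simp
    also have "\<dots> = {..<nat (p k i)}" by (auto simp: gt_patterns_nonneg[OF p])
    finally show ?thesis using gt_patterns_nonneg[OF p] by (simp add: row_count_def)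
  qed
  ultimately show thesis using that[of T] by blast
qed

lemma bij_betw_row_count:
  assumes "antimono lam"
  shows "bij_betw (row_count lam) (ssyt n lam) (gt_patterns n lam)"
  unfolding bij_betw_def
proof
  show "row_count lam ` ssyt n lam = gt_patterns n lam"
    by (auto simp: row_count_in_gt_patterns[OF assms] elim!: gt_pattern_is_row_count)
qed (rule inj_on_row_count)

text \<open>Replacing \<open>k + 1\<close> by \<open>k\<close> changes a single count, that of the
  entries at most \<open>k\<close> in the row of the cell. Conversely, raising a count determines
  the cell: it is the first one not counted before.\<close>

lemma gt_edges_iff:
  assumes lam: "antimono lam"
  shows "(S, T) \<in> gt_edges n lam k \<longleftrightarrow> k \<in> {1..<n} \<and> S \<in> ssyt n lam \<and> T \<in> ssyt n lam \<and>
    (\<exists>i<k. row_count lam T = increment (row_count lam S) k i)"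
proof
  assume "(S, T) \<in> gt_edges n lam k"
  then obtain i j where k: "k \<in> {1..<n}" and S: "S \<in> ssyt n lam" and T: "T \<in> ssyt n lam"
    and j: "j < lam i" and Sx: "S (i, j) = k + 1" and ST: "T = S((i, j) := k)"
    by (auto simp: gt_edges_def young_diagram_def)
  have "i < k" using ssyt_entry_gt_row[OF lam T j] ST by simp
  moreover have "row_count lam T k' i' = increment (row_count lam S) k i k' i'" for k' i'
  proof (cases "k' = k \<and> i' = i")
    case True
    have "{j'. j' < lam i \<and> T (i, j') \<le> k} = insert j {j'. j' < lam i \<and> S (i, j') \<le> k}"
      using ST j by auto
    then show ?thesis using True Sx by (simp add: row_count_def increment_apply)
  next
    case False
    then have "{j'. j' < lam i' \<and> T (i', j') \<le> k'} = {j'. j' < lam i' \<and> S (i', j') \<le> k'}"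
      using ST Sx by auto
    then show ?thesis using False by (simp add: row_count_def increment_apply)
  qed
  ultimately show "k \<in> {1..<n} \<and> S \<in> ssyt n lam \<and> T \<in> ssyt n lam \<and>
    (\<exists>i<k. row_count lam T = increment (row_count lam S) k i)" using k S T by blast
next
  assume "k \<in> {1..<n} \<and> S \<in> ssyt n lam \<and> T \<in> ssyt n lam \<and>
    (\<exists>i<k. row_count lam T = increment (row_count lam S) k i)"
  then obtain i where k: "k \<in> {1..<n}" and S: "S \<in> ssyt n lam" and T: "T \<in> ssyt n lam"
    and eq: "row_count lam T = increment (row_count lam S) k i" by blast
  define j where "j = nat (row_count lam S k i)"
  have j: "int j = row_count lam S k i" by (simp add: j_def)
  have TS: "T (i', j') \<le> k' \<longleftrightarrow> S (i', j') \<le> k'"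
    if "j' < lam i'" "\<not> (k' = k \<and> i' = i \<and> j' = j)" for i' j' k'
  proof -
    have "int j' < row_count lam T k' i' \<longleftrightarrow> int j' < row_count lam S k' i'"
      using that j unfolding eq increment_apply by auto
    then show ?thesis using that(1) by (simp add: less_row_count_iff[OF S] less_row_count_iff[OF T])
  qed
  have "int j < row_count lam T k i" using j unfolding eq increment_apply by simp
  then have jl: "j < lam i" and Tk: "T (i, j) \<le> k" by (simp_all add: less_row_count_iff[OF T])
  have Sk: "\<not> S (i, j) \<le> k" using less_row_count_iff[OF S, of j k i] j jl by simp
  \<comment> \<open>The counts at levels \<open>k + 1\<close> and \<open>k - 1\<close> are
    untouched, which pins the two entries to \<open>k + 1\<close> and \<open>k\<close>. Here
    \<open>k\<close> is positive, so \<open>k - 1\<close> really is another level.\<close>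
  have "S (i, j) \<le> k + 1" using TS[OF jl, of "k + 1"] Tk by simp
  then have Sk1: "S (i, j) = k + 1" using Sk by simp
  have "\<not> T (i, j) \<le> k - 1" using TS[OF jl, of "k - 1"] Sk k
    by (metis One_nat_def Suc_pred atLeastLessThan_iff le_SucI less_eq_Suc_le n_not_Suc_n)
  then have Tk': "T (i, j) = k" using Tk by simp
  have "T = S((i, j) := k)"
  proof
    fix x :: "nat \<times> nat"
    obtain i' j' where x: "x = (i', j')" by (cases x)
    show "T x = (S((i, j) := k)) x"
    proof (cases "j' < lam i' \<and> x \<noteq> (i, j)")
      case True
      then have "T (i', j') = S (i', j')" using TS x by (intro nat_eq_if_le_iff) auto
      then show ?thesis using True x by auto
    next
      case False
      show ?thesis
      proof (cases "x = (i, j)")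
        case True
        then show ?thesis using Tk' by simp
      next
        case neq: False
        then have "x \<notin> young_diagram lam" using False x by (simp add: young_diagram_def)
        then show ?thesis using S T neq x by (auto simp: ssyt_def)
      qed
    qed
  qed
  then show "(S, T) \<in> gt_edges n lam k"
    using k S T jl Sk1 by (auto simp: gt_edges_def young_diagram_def)
qed

lemma finite_ssyt:
  assumes lam: "antimono lam" and "lam n = 0"
  shows "finite (ssyt n lam)"
proof -
  have zero: "lam i = 0" if "n \<le> i" for i using antimonoD[OF lam that] assms(2) by simp
  have "young_diagram lam \<subseteq> {..<n} \<times> {..<lam 0}"
  proof
    fix x assume "x \<in> young_diagram lam"
    then obtain i j where x: "x = (i, j)" "j < lam i" by (auto simp: young_diagram_def)
    then show "x \<in> {..<n} \<times> {..<lam 0}"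
      using zero[of i] antimonoD[OF lam, of 0 i] by (cases "n \<le> i") auto
  qed
  then have fin: "finite (young_diagram lam)" by (rule finite_subset) simp
  have "ssyt n lam \<subseteq> {f. \<forall>x. (x \<in> young_diagram lam \<longrightarrow> f x \<in> {1..n}) \<and> (x \<notin> young_diagram lam \<longrightarrow> f x = 0)}"
    by (auto simp: ssyt_def)
  then show ?thesis using finite_set_of_finite_funs[OF fin, of "{1..n}" 0] finite_subset by blast
qed

section \<open>Residues of a product quotient\<close>

text \<open>The product quotient tends to 1 at infinity, so it is 1 plus its principal parts. Over
  an arbitrary field this becomes an induction that adds one factor and uses the hypothesis twice,
  at \<open>z\<close> and at the new pole \<open>q a\<close>.\<close>

lemma partial_fractions_prod_quotient:
  fixes p q :: "'i \<Rightarrow> 'f::field"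
  assumes "finite J" "inj_on q J" "z \<notin> q ` J"
  shows "(\<Sum>j\<in>J. (\<Prod>m\<in>J. q j - p m) / (\<Prod>m\<in>J - {j}. q j - q m) / (z - q j)) =
    (\<Prod>m\<in>J. (z - p m) / (z - q m)) - 1"
  using assms
proof (induction J arbitrary: z rule: finite_induct)
  case (insert a J)
  define R where "R = (\<lambda>j. (\<Prod>m\<in>J. q j - p m) / (\<Prod>m\<in>J - {j}. q j - q m))"
  define F where "F = (\<lambda>z. \<Prod>m\<in>J. (z - p m) / (z - q m))"
  have za: "z \<noteq> q a" and zJ: "z \<notin> q ` J" and aJ: "q a \<notin> q ` J" and inj: "inj_on q J"
    using insert.prems insert.hyps by (auto simp: inj_on_def)
  have Fz: "F z = 1 + (\<Sum>j\<in>J. R j / (z - q j))" and Fa: "F (q a) = 1 + (\<Sum>j\<in>J. R j / (q a - q j))"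
    using insert.IH[OF inj zJ] insert.IH[OF inj aJ] by (simp_all add: F_def R_def)
  have Rj: "(\<Prod>m\<in>insert a J. q j - p m) / (\<Prod>m\<in>insert a J - {j}. q j - q m) =
      R j * ((q j - p a) / (q j - q a))" if "j \<in> J" for j
  proof -
    have "insert a J - {j} = insert a (J - {j})" using that insert.hyps by auto
    then show ?thesis using insert.hyps by (simp add: R_def mult.commute)
  qed
  have Ra: "(\<Prod>m\<in>insert a J. q a - p m) / (\<Prod>m\<in>insert a J - {a}. q a - q m) = (q a - p a) * F (q a)"
    using insert.hyps by (simp add: F_def prod_dividef)
  \<comment> \<open>The partial fraction decomposition of
    \<open>(z - p a) / ((z - q j) * (z - q a))\<close>, times \<open>R j\<close>.\<close>
  have termwise: "R j * ((q j - p a) / (q j - q a)) / (z - q j) + (q a - p a) * (R j / (q a - q j)) / (z - q a)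
      = R j / (z - q j) * ((z - p a) / (z - q a))" if "j \<in> J" for j
  proof -
    have "q j \<noteq> q a" "z \<noteq> q j" using that aJ zJ by (metis imageI)+
    then have "(q j - p a) / (q j - q a) / (z - q j) + (q a - p a) * (1 / (q a - q j)) / (z - q a)
      = 1 / (z - q j) * ((z - p a) / (z - q a))"
      using za by (simp add: divide_simps) (simp add: algebra_simps)
    then have "R j * ((q j - p a) / (q j - q a) / (z - q j) + (q a - p a) * (1 / (q a - q j)) / (z - q a))
      = R j * (1 / (z - q j) * ((z - p a) / (z - q a)))" by simp
    then show ?thesis by (simp add: distrib_left mult.commute[of "q a - p a"])
  qed
  have "(\<Sum>j\<in>insert a J. (\<Prod>m\<in>insert a J. q j - p m) / (\<Prod>m\<in>insert a J - {j}. q j - q m) / (z - q j))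
      = (q a - p a) * F (q a) / (z - q a) + (\<Sum>j\<in>J. R j * ((q j - p a) / (q j - q a)) / (z - q j))"
    unfolding sum.insert[OF insert.hyps] Ra using Rj by simp
  also have "\<dots> = (q a - p a) / (z - q a) +
      (\<Sum>j\<in>J. R j * ((q j - p a) / (q j - q a)) / (z - q j) + (q a - p a) * (R j / (q a - q j)) / (z - q a))"
    by (simp add: Fa sum.distrib sum_distrib_left sum_divide_distrib distrib_left add_divide_distrib)
  also have "\<dots> = (q a - p a) / (z - q a) + (\<Sum>j\<in>J. R j / (z - q j)) * ((z - p a) / (z - q a))"
    unfolding sum_distrib_right by (intro arg_cong2[where f = "(+)"] refl sum.cong termwise)
  also have "\<dots> = F z * ((z - p a) / (z - q a)) - 1"
  proof -
    have "(q a - p a) / (z - q a) = (z - p a) / (z - q a) - 1" using za by (simp add: divide_simps)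
    then show ?thesis by (simp add: Fz distrib_right add_divide_distrib)
  qed
  also have "\<dots> = (\<Prod>m\<in>insert a J. (z - p m) / (z - q m)) - 1"
    using insert.hyps by (simp add: F_def)
  finally show ?case .
qed simp

text \<open>Both sides are the coefficient of \<open>1 / z\<close> in the expansion of the product
  quotient at infinity. In the induction, the new residue contains the old quotient evaluated at the
  new pole, and its partial fractions cancel the corrections to the old residues.\<close>

lemma sum_residues_prod_quotient_inj:
  fixes p q :: "'i \<Rightarrow> 'f::field"
  assumes "finite J" "inj_on q J"
  shows "(\<Sum>j\<in>J. (\<Prod>m\<in>J. q j - p m) / (\<Prod>m\<in>J - {j}. q j - q m)) = (\<Sum>j\<in>J. q j - p j)"
  using assms
proof (induction J rule: finite_induct)
  case (insert a J)
  define R where "R = (\<lambda>j. (\<Prod>m\<in>J. q j - p m) / (\<Prod>m\<in>J - {j}. q j - q m))"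
  have aJ: "q a \<notin> q ` J" and inj: "inj_on q J"
    using insert.prems insert.hyps by (auto simp: inj_on_def)
  have Rj: "(\<Prod>m\<in>insert a J. q j - p m) / (\<Prod>m\<in>insert a J - {j}. q j - q m) =
      R j - (q a - p a) * (R j / (q a - q j))" if "j \<in> J" for j
  proof -
    have "insert a J - {j} = insert a (J - {j})" using that insert.hyps by auto
    then have "(\<Prod>m\<in>insert a J. q j - p m) / (\<Prod>m\<in>insert a J - {j}. q j - q m) =
      R j * ((q j - p a) / (q j - q a))" using insert.hyps by (simp add: R_def mult.commute)
    also have "(q j - p a) / (q j - q a) = 1 - (q a - p a) / (q a - q j)"
    proof -
      have "q j \<noteq> q a" using that aJ by (metis imageI)
      then show ?thesis by (simp add: divide_simps) (simp add: algebra_simps)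
    qed
    finally show ?thesis by (simp add: algebra_simps)
  qed
  have Ra: "(\<Prod>m\<in>insert a J. q a - p m) / (\<Prod>m\<in>insert a J - {a}. q a - q m) =
      (q a - p a) * (1 + (\<Sum>j\<in>J. R j / (q a - q j)))"
    using insert.hyps partial_fractions_prod_quotient[OF insert.hyps(1) inj aJ, of p]
    by (simp add: R_def prod_dividef)
  have "(\<Sum>j\<in>insert a J. (\<Prod>m\<in>insert a J. q j - p m) / (\<Prod>m\<in>insert a J - {j}. q j - q m))
      = (q a - p a) * (1 + (\<Sum>j\<in>J. R j / (q a - q j))) + (\<Sum>j\<in>J. R j - (q a - p a) * (R j / (q a - q j)))"
    unfolding sum.insert[OF insert.hyps] Ra using Rj by simp
  also have "\<dots> = (q a - p a) + (\<Sum>j\<in>J. R j)"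
    by (simp add: sum_subtractf sum_distrib_left distrib_left)
  finally show ?case using insert.IH[OF inj] insert.hyps by (simp add: R_def)
qed simp

text \<open>Indices with \<open>p j = q j\<close> contribute nothing to either side, their
  numerators being zero, and without them the poles are distinct. This covers patterns whose
  coordinates collide.\<close>

lemma sum_residues_prod_quotient:
  fixes p q :: "'i \<Rightarrow> 'f::field"
  assumes J: "finite J"
    and coll: "\<And>j j'. j \<in> J \<Longrightarrow> j' \<in> J \<Longrightarrow> j \<noteq> j' \<Longrightarrow> q j = q j' \<Longrightarrow> p j = q j"
  shows "(\<Sum>j\<in>J. (\<Prod>m\<in>J. q j - p m) / (\<Prod>m\<in>J - {j}. q j - q m)) = (\<Sum>j\<in>J. q j - p j)"
proof -
  define K where "K = {j \<in> J. p j \<noteq> q j}"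
  have K: "K \<subseteq> J" "finite K" using J by (auto simp: K_def)
  have inj: "inj_on q K" by (rule inj_onI) (use coll K_def in blast)
  have "(\<Prod>m\<in>J. q j - p m) / (\<Prod>m\<in>J - {j}. q j - q m) =
      (\<Prod>m\<in>K. q j - p m) / (\<Prod>m\<in>K - {j}. q j - q m)" if "j \<in> K" for j
  proof -
    have "p m = q m" if "m \<in> J - K" for m using that by (auto simp: K_def)
    then have eq: "(\<Prod>m\<in>J - K. q j - p m) = (\<Prod>m\<in>J - K. q j - q m)" by simp
    have "q j \<noteq> q m" if "m \<in> J - K" for m
      using coll[of j m] that \<open>j \<in> K\<close> unfolding K_def by blast
    then have ne: "(\<Prod>m\<in>J - K. q j - q m) \<noteq> 0" using J by simp
    have "(\<Prod>m\<in>J. q j - p m) = (\<Prod>m\<in>J - K. q j - p m) * (\<Prod>m\<in>K. q j - p m)"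
      by (rule prod.subset_diff[OF K(1) J])
    moreover have "(\<Prod>m\<in>J - {j}. q j - q m) = (\<Prod>m\<in>J - K. q j - q m) * (\<Prod>m\<in>K - {j}. q j - q m)"
    proof -
      have "J - {j} - (K - {j}) = J - K" using that by blast
      then show ?thesis
        using prod.subset_diff[of "K - {j}" "J - {j}" "\<lambda>m. q j - q m"] K J by auto
    qed
    ultimately show ?thesis using eq ne by simp
  qed
  moreover have "(\<Prod>m\<in>J. q j - p m) = 0" if "j \<in> J - K" for j
    using that J by (auto simp: K_def intro!: bexI[of _ j])
  ultimately have "(\<Sum>j\<in>J. (\<Prod>m\<in>J. q j - p m) / (\<Prod>m\<in>J - {j}. q j - q m)) =
      (\<Sum>j\<in>K. (\<Prod>m\<in>K. q j - p m) / (\<Prod>m\<in>K - {j}. q j - q m))"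
    using J K by (intro sum.mono_neutral_cong_right) auto
  also have "\<dots> = (\<Sum>j\<in>K. q j - p j)" by (rule sum_residues_prod_quotient_inj[OF K(2) inj])
  also have "\<dots> = (\<Sum>j\<in>J. q j - p j)"
    using J K by (intro sum.mono_neutral_left) (auto simp: K_def)
  finally show ?thesis .
qed

section \<open>Edge products\<close>

text \<open>Subtracting the index turns weakly decreasing rows into strictly decreasing ones, so
  that coordinates within a row are distinct.\<close>

definition shifted :: "(nat \<Rightarrow> nat \<Rightarrow> int) \<Rightarrow> nat \<Rightarrow> nat \<Rightarrow> real" where
  "shifted p k i = real_of_int (p k i) - real i"

text \<open>The edge products of the Gelfand--Tsetlin basis in the coordinates \<open>l\<^sub>k\<^sub>i = p k i - i\<close>, the
  entries of a row being indexed from 0. The denominator may vanish when row \<open>k\<close> cannot be raised at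
  \<open>i\<close>; the numerator vanishes as well then.\<close>

definition gt_product :: "(nat \<Rightarrow> nat \<Rightarrow> int) \<Rightarrow> nat \<Rightarrow> nat \<Rightarrow> real" where
  "gt_product p k i =
     - ((\<Prod>m<Suc k. shifted p k i - shifted p (Suc k) m) *
        (\<Prod>m<k - 1. shifted p k i + 1 - shifted p (k - 1) m)) /
     (\<Prod>m\<in>{..<k} - {i}. (shifted p k i - shifted p k m) * (shifted p k i + 1 - shifted p k m))"

section \<open>Raising and lowering one entry of a pattern\<close>

definition decrement :: "(nat \<Rightarrow> nat \<Rightarrow> int) \<Rightarrow> nat \<Rightarrow> nat \<Rightarrow> nat \<Rightarrow> nat \<Rightarrow> int" where
  "decrement p k i = p(k := (p k)(i := p k i - 1))"

lemma decrement_apply: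
  "decrement p k i k' i' = p k' i' - (if k' = k \<and> i' = i then 1 else 0)"
  by (simp add: decrement_def)

lemma increment_decrement [simp]: "increment (decrement p k i) k i = p"
  and decrement_increment [simp]: "decrement (increment p k i) k i = p"
  by (simp_all add: increment_def decrement_def)

lemma gt_patternsD:
  assumes "p \<in> gt_patterns n lam"
  shows "p k i \<le> p (Suc k) i" "p (Suc k) (Suc i) \<le> p k i" "k \<le> i \<Longrightarrow> p k i = 0"
    "n \<le> k \<Longrightarrow> p k i = int (lam i)"
  using assms by (simp_all add: gt_patterns_def)

lemma gt_patterns_antimono_index:
  assumes "p \<in> gt_patterns n lam" "i \<le> j"
  shows "p k j \<le> p k i"
  using assms(2)
proof (induction j rule: dec_induct)
  case (step j)
  have "p k (Suc j) \<le> p k j"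
    using gt_patternsD(1)[OF assms(1), of k "Suc j"] gt_patternsD(2)[OF assms(1), of k j] by simp
  with step show ?case by simp
qed simp

text \<open>Only the upper bounds of the entry can be violated. The entry with index 0 is bounded by
  row \<open>k + 1\<close> alone.\<close>

lemma increment_in_gt_patterns_iff:
  assumes p: "p \<in> gt_patterns n lam" and k: "1 \<le> k" "k < n" and i: "i < k"
  shows "increment p k i \<in> gt_patterns n lam \<longleftrightarrow>
    p k i < p (Suc k) i \<and> (0 < i \<longrightarrow> p k i < p (k - 1) (i - 1))"
proof
  assume inc: "increment p k i \<in> gt_patterns n lam"
  have "p k i < p (Suc k) i"
    using gt_patternsD(1)[OF inc, of k i] by (simp add: increment_apply)
  moreover have "p k i < p (k - 1) (i - 1)" if "0 < i"
    using gt_patternsD(2)[OF inc, of "k - 1" "i - 1"] k that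
    by (simp add: increment_apply split: if_splits)
  ultimately show "p k i < p (Suc k) i \<and> (0 < i \<longrightarrow> p k i < p (k - 1) (i - 1))" by blast
next
  assume *: "p k i < p (Suc k) i \<and> (0 < i \<longrightarrow> p k i < p (k - 1) (i - 1))"
  have "increment p k i l j \<le> increment p k i (Suc l) j" for l j
    using gt_patternsD(1)[OF p, of l j] * by (auto simp: increment_apply)
  moreover have "increment p k i (Suc l) (Suc j) \<le> increment p k i l j" for l j
    using gt_patternsD(2)[OF p, of l j] * by (auto simp: increment_apply)
  moreover have "increment p k i l j = 0" if "l \<le> j" for l j
    using gt_patternsD(3)[OF p that] that i by (auto simp: increment_apply)
  moreover have "increment p k i l j = int (lam j)" if "n \<le> l" for l j
    using gt_patternsD(4)[OF p that] that k by (auto simp: increment_apply)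
  ultimately show "increment p k i \<in> gt_patterns n lam" by (simp add: gt_patterns_def)
qed

text \<open>Both lower bounds exist for every entry; for the last one, \<open>Suc i = k\<close>, the
  bound from row \<open>k - 1\<close> is a padding zero.\<close>

lemma decrement_in_gt_patterns_iff:
  assumes p: "p \<in> gt_patterns n lam" and k: "1 \<le> k" "k < n" and i: "i < k"
  shows "decrement p k i \<in> gt_patterns n lam \<longleftrightarrow> p (Suc k) (Suc i) < p k i \<and> p (k - 1) i < p k i"
proof
  assume dec: "decrement p k i \<in> gt_patterns n lam"
  show "p (Suc k) (Suc i) < p k i \<and> p (k - 1) i < p k i"
    using gt_patternsD(2)[OF dec, of k i] gt_patternsD(1)[OF dec, of "k - 1" i] k
    by (simp add: decrement_apply split: if_splits)
next
  assume *: "p (Suc k) (Suc i) < p k i \<and> p (k - 1) i < p k i"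
  have "decrement p k i l j \<le> decrement p k i (Suc l) j" for l j
    using gt_patternsD(1)[OF p, of l j] * by (auto simp: decrement_apply)
  moreover have "decrement p k i (Suc l) (Suc j) \<le> decrement p k i l j" for l j
    using gt_patternsD(2)[OF p, of l j] * by (auto simp: decrement_apply)
  moreover have "decrement p k i l j = 0" if "l \<le> j" for l j
    using gt_patternsD(3)[OF p that] that i by (auto simp: decrement_apply)
  moreover have "decrement p k i l j = int (lam j)" if "n \<le> l" for l j
    using gt_patternsD(4)[OF p that] that k by (auto simp: decrement_apply)
  ultimately show "decrement p k i \<in> gt_patterns n lam" by (simp add: gt_patterns_def)
qed

text \<open>The \<open>2k\<close> poles and zeros of the rational function whose residues are the edge products at row
  \<open>k\<close>. They are paired so that poles can only collide where each of them cancels its own zero.\<close>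

definition pole :: "(nat \<Rightarrow> nat \<Rightarrow> int) \<Rightarrow> nat \<Rightarrow> nat \<times> bool \<Rightarrow> real" where
  "pole p k = (\<lambda>(i, up). if up then shifted p k i else shifted p k i - 1)"

text \<open>Row \<open>k + 1\<close> has one entry more than row \<open>k\<close>, and row
  \<open>k - 1\<close> one fewer. The last lower pole, left without a partner in row
  \<open>k - 1\<close>, takes the surplus entry of row \<open>k + 1\<close>.\<close>

definition pole_mate :: "(nat \<Rightarrow> nat \<Rightarrow> int) \<Rightarrow> nat \<Rightarrow> nat \<times> bool \<Rightarrow> real" where
  "pole_mate p k = (\<lambda>(i, up). if up then shifted p (Suc k) i
     else if Suc i = k then shifted p (Suc k) k else shifted p (k - 1) i - 1)"

section \<open>Sums and products over the poles of one row\<close>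

lemma sum_times_bool:
  "finite A \<Longrightarrow> sum f (A \<times> (UNIV :: bool set)) = sum (\<lambda>i. f (i, True) + f (i, False)) A"
  using sum.cartesian_product[of "\<lambda>i b. f (i, b)" "UNIV :: bool set" A, symmetric]
  by (simp add: UNIV_bool ac_simps)

lemma sum_pole_mates:
  fixes f :: "real \<Rightarrow> real"
  assumes "1 \<le> k"
  shows "(\<Sum>j\<in>{..<k} \<times> UNIV. f (pole_mate p k j)) =
    (\<Sum>m<Suc k. f (shifted p (Suc k) m)) + (\<Sum>m<k - 1. f (shifted p (k - 1) m - 1))"
proof -
  obtain l where k: "k = Suc l" using assms by (cases k) auto
  have "(\<Sum>i<k. f (pole_mate p k (i, False))) =
      (\<Sum>m<l. f (shifted p (k - 1) m - 1)) + f (shifted p (Suc k) k)"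
    by (simp add: k pole_mate_def)
  moreover have "(\<Sum>i<k. f (pole_mate p k (i, True))) = (\<Sum>m<k. f (shifted p (Suc k) m))"
    by (simp add: pole_mate_def)
  ultimately show ?thesis
    by (simp add: sum_times_bool sum.distrib k ac_simps)
qed

lemma prod_times_bool:
  "finite A \<Longrightarrow> prod f (A \<times> (UNIV :: bool set)) = prod (\<lambda>i. f (i, True) * f (i, False)) A"
  using prod.cartesian_product[of "\<lambda>i b. f (i, b)" "UNIV :: bool set" A, symmetric]
  by (simp add: UNIV_bool ac_simps)

lemma prod_pole_mates:
  fixes f :: "real \<Rightarrow> real"
  assumes "1 \<le> k"
  shows "(\<Prod>j\<in>{..<k} \<times> UNIV. f (pole_mate p k j)) =
    (\<Prod>m<Suc k. f (shifted p (Suc k) m)) * (\<Prod>m<k - 1. f (shifted p (k - 1) m - 1))"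
proof -
  obtain l where k: "k = Suc l" using assms by (cases k) auto
  have "(\<Prod>i<k. f (pole_mate p k (i, False))) =
      (\<Prod>m<l. f (shifted p (k - 1) m - 1)) * f (shifted p (Suc k) k)"
    by (simp add: k pole_mate_def)
  moreover have "(\<Prod>i<k. f (pole_mate p k (i, True))) = (\<Prod>m<k. f (shifted p (Suc k) m))"
    by (simp add: pole_mate_def)
  ultimately show ?thesis
    by (simp add: prod_times_bool prod.distrib k ac_simps)
qed

lemma prod_poles_remove:
  fixes i k :: nat
  assumes "i < k"
  shows "(\<Prod>j\<in>{..<k} \<times> UNIV - {(i, b)}. f j) =
    f (i, \<not> b) * (\<Prod>m\<in>{..<k} - {i}. f (m, True) * f (m, False) :: real)"
proof -
  have "{..<k} \<times> UNIV - {(i, b)} = insert (i, \<not> b) (({..<k} - {i}) \<times> UNIV)"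
    using assms by auto
  then show ?thesis by (simp add: prod_times_bool)
qed

text \<open>The two poles of index \<open>i\<close> are at distance 1, so each contributes a factor
  1 or -1 to the denominator at the other. This accounts for the opposite signs here and in
  \<open>residue_down\<close>.\<close>

lemma residue_up:
  assumes "1 \<le> k" "i < k"
  shows "(\<Prod>m\<in>{..<k} \<times> UNIV. pole p k (i, True) - pole_mate p k m) /
      (\<Prod>m\<in>{..<k} \<times> UNIV - {(i, True)}. pole p k (i, True) - pole p k m) = - gt_product p k i"
  using assms prod_pole_mates[OF assms(1), of "\<lambda>x. pole p k (i, True) - x" p]
  by (simp add: prod_poles_remove pole_def gt_product_def algebra_simps del: prod.lessThan_Suc)

lemma residue_down:
  assumes "1 \<le> k" "i < k"
  shows "(\<Prod>m\<in>{..<k} \<times> UNIV. pole p k (i, False) - pole_mate p k m) /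
      (\<Prod>m\<in>{..<k} \<times> UNIV - {(i, False)}. pole p k (i, False) - pole p k m) =
      gt_product (decrement p k i) k i"
proof -
  have sh: "shifted (decrement p k i) l j = (if l = k \<and> j = i then shifted p k i - 1 else shifted p l j)" for l j
    by (simp add: shifted_def decrement_apply)
  have "k - 1 \<noteq> k" using assms by simp
  then show ?thesis
    using assms prod_pole_mates[OF assms(1), of "\<lambda>x. pole p k (i, False) - x" p]
    by (simp add: prod_poles_remove pole_def gt_product_def sh algebra_simps del: prod.lessThan_Suc)
qed

text \<open>Matching each pole with its mate allows positivity to be checked ratio by ratio.\<close>

lemma gt_product_eq_prod_ratios:
  assumes "1 \<le> k" "i < k"
  shows "gt_product p k i = (shifted p (Suc k) i - shifted p k i) *
    (\<Prod>m\<in>{..<k} \<times> UNIV - {(i, True)}.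
       (pole p k (i, True) - pole_mate p k m) / (pole p k (i, True) - pole p k m))"
proof -
  have "(\<Prod>m\<in>{..<k} \<times> UNIV. pole p k (i, True) - pole_mate p k m) =
      (pole p k (i, True) - pole_mate p k (i, True)) *
      (\<Prod>m\<in>{..<k} \<times> UNIV - {(i, True)}. pole p k (i, True) - pole_mate p k m)"
    by (rule prod.remove) (use assms in auto)
  then have "gt_product p k i = (pole_mate p k (i, True) - pole p k (i, True)) *
    (\<Prod>m\<in>{..<k} \<times> UNIV - {(i, True)}.
       (pole p k (i, True) - pole_mate p k m) / (pole p k (i, True) - pole p k m))"
    using residue_up[OF assms, of p] unfolding prod_dividef
    by (metis minus_diff_eq minus_equation_iff minus_mult_left times_divide_eq_right)
  then show ?thesis by (simp add: pole_def pole_mate_def)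
qed

lemma shifted_less:
  assumes "p \<in> gt_patterns n lam" "i < j"
  shows "shifted p k j < shifted p k i"
  using gt_patterns_antimono_index[OF assms(1), of i j k] assms(2) by (simp add: shifted_def)

text \<open>If the entry can be raised, interlacing places its coordinate strictly on the same side
  of every other pole and of the mate of that pole, so each ratio is positive.\<close>

lemma gt_product_pos:
  assumes p: "p \<in> gt_patterns n lam" and k: "1 \<le> k" "k < n" and i: "i < k"
    and inc: "increment p k i \<in> gt_patterns n lam"
  shows "0 < gt_product p k i"
proof -
  have up: "p k i < p (Suc k) i" "0 < i \<Longrightarrow> p k i < p (k - 1) (i - 1)"
    using inc unfolding increment_in_gt_patterns_iff[OF p k i] by auto
  have "0 < (pole p k (i, True) - pole_mate p k m) / (pole p k (i, True) - pole p k m)"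
    if m: "m \<in> {..<k} \<times> UNIV - {(i, True)}" for m
  proof -
    obtain j b where mj: "m = (j, b)" "j < k" "(j, b) \<noteq> (i, True)" using m by auto
    consider "b" "j < i" | "b" "i < j" | "\<not> b" "j < i" | "\<not> b" "i \<le> j" "Suc j = k"
      | "\<not> b" "i \<le> j" "Suc j < k"
      using mj by (metis (full_types) linorder_neqE_nat Suc_lessI linorder_not_less)
    then show ?thesis
    proof cases
      case 1
      have "p k i \<le> p k j" "p k j \<le> p (Suc k) j"
        using 1 gt_patterns_antimono_index[OF p, of j i k] gt_patternsD(1)[OF p, of k j] by auto
      then show ?thesis using 1 mj
        by (intro divide_neg_neg) (auto simp: pole_def pole_mate_def shifted_def)
    next
      case 2
      have "p (Suc k) j \<le> p k (j - 1)" "p k (j - 1) \<le> p k i" "p k j \<le> p k i"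
        using 2 gt_patterns_antimono_index[OF p, of i "j - 1" k] gt_patternsD(2)[OF p, of k "j - 1"]
          gt_patterns_antimono_index[OF p, of i j k] by auto
      then show ?thesis using 2 mj
        by (intro divide_pos_pos) (auto simp: pole_def pole_mate_def shifted_def)
    next
      case 3
      have "p k i < p (k - 1) (i - 1)" "p (k - 1) (i - 1) \<le> p (k - 1) j" "p (k - 1) j \<le> p k j"
        using 3 up gt_patterns_antimono_index[OF p, of j "i - 1" "k - 1"]
          gt_patternsD(1)[OF p, of "k - 1" j] k by auto
      then show ?thesis using 3 mj i
        by (intro divide_neg_neg) (auto simp: pole_def pole_mate_def shifted_def)
    next
      case 4
      have "p (Suc k) k \<le> p k j" "p k j \<le> p k i"
        using 4 gt_patternsD(2)[OF p, of k j] gt_patterns_antimono_index[OF p, of i j k] by auto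
      then show ?thesis using 4 mj
        by (intro divide_pos_pos) (auto simp: pole_def pole_mate_def shifted_def)
    next
      case 5
      have "p (k - 1) j \<le> p k j" "p k j \<le> p k i"
        using 5 gt_patternsD(1)[OF p, of "k - 1" j] gt_patterns_antimono_index[OF p, of i j k] k by auto
      then show ?thesis using 5 mj
        by (intro divide_pos_pos) (auto simp: pole_def pole_mate_def shifted_def)
    qed
  qed
  moreover have "0 < shifted p (Suc k) i - shifted p k i" using up by (simp add: shifted_def)
  ultimately show ?thesis
    unfolding gt_product_eq_prod_ratios[OF k(1) i] by (intro mult_pos_pos prod_pos) auto
qed

section \<open>Weights of patterns and the crossing condition\<close>

definition row_sum :: "(nat \<Rightarrow> nat \<Rightarrow> int) \<Rightarrow> nat \<Rightarrow> int" where
  "row_sum p k = (\<Sum>i<k. p k i)"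

text \<open>The second difference of the row sums: for the pattern of a tableau, the number of
  entries \<open>k\<close> minus the number of entries \<open>k + 1\<close>.\<close>

definition pattern_weight :: "(nat \<Rightarrow> nat \<Rightarrow> int) \<Rightarrow> nat \<Rightarrow> int" where
  "pattern_weight p k = 2 * row_sum p k - row_sum p (Suc k) - row_sum p (k - 1)"

lemma sum_shifted: "(\<Sum>m<k. shifted p l m) = real_of_int (\<Sum>m<k. p l m) - real k * (real k - 1) / 2"
  by (induction k) (simp_all add: shifted_def field_simps)

lemma gt_product_crossing:
  assumes p: "p \<in> gt_patterns n lam" and k: "1 \<le> k" "k < n"
  shows "(\<Sum>i | i < k \<and> decrement p k i \<in> gt_patterns n lam. gt_product (decrement p k i) k i) -
    (\<Sum>i | i < k \<and> increment p k i \<in> gt_patterns n lam. gt_product p k i) =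
    real_of_int (pattern_weight p k)"
proof -
  let ?J = "{..<k} \<times> (UNIV :: bool set)"
  have coll: "pole_mate p k j = pole p k j"
    if "j \<in> ?J" "j' \<in> ?J" "j \<noteq> j'" "pole p k j = pole p k j'" for j j'
  proof -
    \<comment> \<open>An upper and a lower pole can meet only for neighbouring indices
      \<open>i = Suc i'\<close> with equal entries. Interlacing then squeezes both mates onto the
      same value.\<close>
    have key: "pole_mate p k (i, True) = pole p k (i, True) \<and> pole_mate p k (i', False) = pole p k (i', False)"
      if "i < k" "i' < k" "shifted p k i = shifted p k i' - 1" for i i'
    proof -
      have "real_of_int (p k i) - real i = real_of_int (p k i') - real i' - 1"
        using that(3) by (simp add: shifted_def)
      then have "real_of_int (p k i - int i) = real_of_int (p k i' - int i' - 1)" by simp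
      then have eq: "p k i - int i = p k i' - int i' - 1" using of_int_eq_iff by blast
      have "i' < i"
      proof (rule ccontr)
        assume "\<not> i' < i"
        then show False using gt_patterns_antimono_index[OF p, of i i' k] eq by simp
      qed
      then have i: "i = Suc i'" and "p k i = p k i'"
        using gt_patterns_antimono_index[OF p, of i' i k] eq by simp_all
      then have "p (Suc k) i = p k i" "p (k - 1) i' = p k i'"
        using gt_patternsD(1)[OF p, of k i] gt_patternsD(2)[OF p, of k i']
          gt_patternsD(1)[OF p, of "k - 1" i'] gt_patternsD(2)[OF p, of "k - 1" i'] k by auto
      then show ?thesis using i that by (simp add: pole_def pole_mate_def shifted_def)
    qed
    from that(1) obtain i b where j: "j = (i, b)" "i < k" by auto
    from that(2) obtain i' b' where j': "j' = (i', b')" "i' < k" by auto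
    have "i \<noteq> i' \<Longrightarrow> shifted p k i \<noteq> shifted p k i'"
      using shifted_less[OF p, of i i' k] shifted_less[OF p, of i' i k] by (cases "i < i'") auto
    then have "b \<noteq> b'" using that j j' by (auto simp: pole_def split: if_splits)
    then show ?thesis using key[of i i'] key[of i' i] that(4) j j'
      by (cases b) (auto simp: pole_def)
  qed
  have down: "gt_product (decrement p k i) k i = 0"
    if "i < k" "decrement p k i \<notin> gt_patterns n lam" for i
  proof -
    have "p k i = p (Suc k) (Suc i) \<or> p k i = p (k - 1) i"
      using that decrement_in_gt_patterns_iff[OF p k that(1)] gt_patternsD(2)[OF p, of k i]
        gt_patternsD(1)[OF p, of "k - 1" i] k by auto
    \<comment> \<open>The last lower pole has no mate in row \<open>k - 1\<close>. An entry equal to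
      the padding zero there is, however, also blocked by row \<open>k + 1\<close>.\<close>
    moreover have "p k i = p (Suc k) (Suc i)" if "Suc i = k" "p k i = p (k - 1) i"
      using that gt_patternsD(3)[OF p, of "k - 1" i] gt_patternsD(2)[OF p, of k i]
        gt_patterns_nonneg[OF p, of "Suc k" "Suc i"] by simp
    ultimately consider "p k i = p (Suc k) (Suc i)" "Suc i = k"
      | "p k i = p (Suc k) (Suc i)" "Suc i < k" | "p k i = p (k - 1) i" "Suc i < k"
      using \<open>i < k\<close> by (metis Suc_lessI)
    then have "\<exists>m\<in>?J. pole p k (i, False) - pole_mate p k m = 0"
    proof cases
      case 1
      then show ?thesis using \<open>i < k\<close>
        by (intro bexI[of _ "(i, False)"]) (auto simp: pole_def pole_mate_def shifted_def)
    next
      case 2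
      then show ?thesis
        by (intro bexI[of _ "(Suc i, True)"]) (auto simp: pole_def pole_mate_def shifted_def)
    next
      case 3
      then show ?thesis
        by (intro bexI[of _ "(i, False)"]) (auto simp: pole_def pole_mate_def shifted_def)
    qed
    then have "(\<Prod>m\<in>?J. pole p k (i, False) - pole_mate p k m) = 0" by simp
    then show ?thesis using residue_down[OF k(1) that(1), of p] by (metis div_0)
  qed
  have up: "gt_product p k i = 0"
    if "i < k" "increment p k i \<notin> gt_patterns n lam" for i
  proof -
    consider "p k i = p (Suc k) i" | "0 < i" "p k i = p (k - 1) (i - 1)"
      using \<open>increment p k i \<notin> gt_patterns n lam\<close> increment_in_gt_patterns_iff[OF p k \<open>i < k\<close>]
        gt_patternsD(1)[OF p, of k i]
        gt_patternsD(2)[OF p, of "k - 1" "i - 1"] k by fastforce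
    then have "\<exists>m\<in>?J. pole p k (i, True) - pole_mate p k m = 0"
    proof cases
      case 1
      then show ?thesis using \<open>i < k\<close>
        by (intro bexI[of _ "(i, True)"]) (auto simp: pole_def pole_mate_def shifted_def)
    next
      case 2
      then show ?thesis using \<open>i < k\<close>
        by (intro bexI[of _ "(i - 1, False)"]) (auto simp: pole_def pole_mate_def shifted_def)
    qed
    then have "(\<Prod>m\<in>?J. pole p k (i, True) - pole_mate p k m) = 0" by simp
    then show ?thesis using residue_up[OF k(1) that(1), of p] by (metis div_0 neg_equal_0_iff_equal)
  qed
  \<comment> \<open>A forbidden move meets a zero of the numerator, so both sums may run over all
    \<open>i < k\<close>; together they form the sum of all residues.\<close>
  have "(\<Sum>i | i < k \<and> decrement p k i \<in> gt_patterns n lam. gt_product (decrement p k i) k i) -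
    (\<Sum>i | i < k \<and> increment p k i \<in> gt_patterns n lam. gt_product p k i) =
    (\<Sum>i<k. gt_product (decrement p k i) k i) - (\<Sum>i<k. gt_product p k i)"
    using down up by (intro arg_cong2[where f = minus] sum.mono_neutral_left) auto
  also have "\<dots> = (\<Sum>j\<in>?J. (\<Prod>m\<in>?J. pole p k j - pole_mate p k m) / (\<Prod>m\<in>?J - {j}. pole p k j - pole p k m))"
    using k by (simp add: sum_times_bool residue_up residue_down sum.distrib sum_negf sum_subtractf)
  also have "\<dots> = (\<Sum>j\<in>?J. pole p k j - pole_mate p k j)"
    by (rule sum_residues_prod_quotient) (use coll in auto)
  also have "\<dots> = (\<Sum>j\<in>?J. pole p k j) - (\<Sum>j\<in>?J. pole_mate p k j)" by (rule sum_subtractf)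
  also have "(\<Sum>j\<in>?J. pole p k j) = 2 * (\<Sum>m<k. shifted p k m) - real k"
    by (simp add: sum_times_bool pole_def sum.distrib sum_subtractf sum_distrib_left)
  also have "(\<Sum>j\<in>?J. pole_mate p k j) =
      (\<Sum>m<Suc k. shifted p (Suc k) m) + (\<Sum>m<k - 1. shifted p (k - 1) m) - real (k - 1)"
    using sum_pole_mates[OF k(1), of "\<lambda>x. x" p] by (simp add: sum_subtractf)
  \<comment> \<open>The contributions of the index shifts cancel: \<open>- k * (k - 1) - k + k * (k
    + 1) / 2 + (k - 1) * (k - 2) / 2 + (k - 1) = 0\<close>.\<close>
  finally show ?thesis
    using k unfolding sum_shifted by (simp add: pattern_weight_def row_sum_def of_nat_diff field_simps)
qed

section \<open>Edge products around a diamond\<close>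

lemma prod_change_one:
  fixes f g :: "'i \<Rightarrow> 'f::field"
  assumes "finite A" "j \<in> A" "\<And>m. m \<in> A \<Longrightarrow> m \<noteq> j \<Longrightarrow> g m = f m"
  shows "(\<Prod>m\<in>A. g m) * f j = (\<Prod>m\<in>A. f m) * g j"
proof -
  have "(\<Prod>m\<in>A - {j}. g m) = (\<Prod>m\<in>A - {j}. f m)" using assms(3) by (intro prod.cong) auto
  then show ?thesis using prod.remove[OF assms(1,2), of f] prod.remove[OF assms(1,2), of g] by simp
qed

lemma shifted_increment:
  "shifted (increment p l j) k m = shifted p k m + (if k = l \<and> m = j then 1 else 0)"
  by (simp add: shifted_def increment_apply)

text \<open>A move in one row affects the product of a move in another only if the rows are equal or
  adjacent, and then through a single changed index in one product on each side. The changes cancel;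
  nonzero products exclude the vanishing denominators that would spoil the cancellation.\<close>

lemma gt_product_diamond_aux:
  assumes kl: "1 \<le> k" "k \<le> l" and ij: "i < k" "j < l" "(k, i) \<noteq> (l, j)"
    and nz: "gt_product p k i \<noteq> 0" "gt_product p l j \<noteq> 0"
      "gt_product (increment p l j) k i \<noteq> 0" "gt_product (increment p k i) l j \<noteq> 0"
  shows "gt_product (increment p l j) k i * gt_product (increment p k i) l j =
    gt_product p k i * gt_product p l j"
proof -
  define N1 where "N1 = (\<lambda>p k i. \<Prod>m<Suc k. shifted p k i - shifted p (Suc k) m)"
  define N2 where "N2 = (\<lambda>p k i. \<Prod>m<k - 1. shifted p k i + 1 - shifted p (k - 1) m)"
  define D where "D = (\<lambda>p k i. \<Prod>m\<in>{..<k} - {i}.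
    (shifted p k i - shifted p k m) * (shifted p k i + 1 - shifted p k m))"
  have gp: "gt_product p k i = - (N1 p k i * N2 p k i) / D p k i" for p k i
    by (simp add: gt_product_def N1_def N2_def D_def)
  define a where "a = shifted p k i"
  define b where "b = shifted p l j"
  have ne: "N1 p k i \<noteq> 0" "N2 p k i \<noteq> 0" "D p k i \<noteq> 0" "N1 p l j \<noteq> 0" "N2 p l j \<noteq> 0" "D p l j \<noteq> 0"
    "D (increment p l j) k i \<noteq> 0" "D (increment p k i) l j \<noteq> 0"
    using nz unfolding gp by auto
  have k1: "k - Suc 0 \<noteq> k" "k - Suc 0 \<noteq> Suc k" using kl by auto
  consider "l = k" | "l = Suc k" | "Suc k < l" using kl by linarith
  then show ?thesis
  proof cases
    case 1
    then have neq: "i \<noteq> j" using ij by simp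
    have N: "N1 (increment p l j) k i = N1 p k i" "N2 (increment p l j) k i = N2 p k i"
      "N1 (increment p k i) l j = N1 p l j" "N2 (increment p k i) l j = N2 p l j"
      using 1 neq k1 by (auto simp: N1_def N2_def shifted_increment)
    \<comment> \<open>In the same row the denominators change, and the two changes compensate
      because \<open>(a - b - 1) * (b - a - 1) = (b + 1 - a) * (a + 1 - b)\<close>.\<close>
    have d1: "D (increment p l j) k i * ((a - b) * (a + 1 - b)) = D p k i * ((a - b - 1) * (a - b))"
      using prod_change_one[of "{..<k} - {i}" j
          "\<lambda>m. (shifted (increment p l j) k i - shifted (increment p l j) k m) *
            (shifted (increment p l j) k i + 1 - shifted (increment p l j) k m)"
          "\<lambda>m. (shifted p k i - shifted p k m) * (shifted p k i + 1 - shifted p k m)"] 1 neq ij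
      by (simp add: D_def shifted_increment a_def b_def algebra_simps)
    have d2: "D (increment p k i) l j * ((b - a) * (b + 1 - a)) = D p l j * ((b - a - 1) * (b - a))"
      using prod_change_one[of "{..<l} - {j}" i
          "\<lambda>m. (shifted (increment p k i) l j - shifted (increment p k i) l m) *
            (shifted (increment p k i) l j + 1 - shifted (increment p k i) l m)"
          "\<lambda>m. (shifted p l j - shifted p l m) * (shifted p l j + 1 - shifted p l m)"] 1 neq ij
      by (simp add: D_def shifted_increment a_def b_def algebra_simps)
    have "(a - b) * (a + 1 - b) \<noteq> 0"
      using ne(3) 1 neq ij by (auto simp: D_def a_def b_def)
    moreover have "(b - a) * (b + 1 - a) \<noteq> 0"
      using ne(6) 1 neq ij by (auto simp: D_def a_def b_def)
    ultimately have nz': "(a - b) * (a + 1 - b) * ((b - a) * (b + 1 - a)) \<noteq> 0" by simp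
    have "D (increment p l j) k i * D (increment p k i) l j * ((a - b) * (a + 1 - b) * ((b - a) * (b + 1 - a)))
      = (D (increment p l j) k i * ((a - b) * (a + 1 - b))) * (D (increment p k i) l j * ((b - a) * (b + 1 - a)))"
      by (simp only: ac_simps)
    also have "\<dots> = D p k i * ((a - b - 1) * (a - b)) * (D p l j * ((b - a - 1) * (b - a)))"
      by (simp only: d1 d2)
    also have "\<dots> = D p k i * D p l j * ((a - b) * (a + 1 - b) * ((b - a) * (b + 1 - a)))"
      by (simp add: algebra_simps)
    finally have "D (increment p l j) k i * D (increment p k i) l j = D p k i * D p l j"
      using nz' by simp
    then show ?thesis unfolding gp N by simp
  next
    case 2
    have same: "N2 (increment p l j) k i = N2 p k i" "D (increment p l j) k i = D p k i"
      "N1 (increment p k i) l j = N1 p l j" "D (increment p k i) l j = D p l j"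
      using 2 k1 by (auto simp: N1_def N2_def D_def shifted_increment)
    \<comment> \<open>In adjacent rows one numerator factor changes on each side, and
      \<open>(a - b - 1) * (b - a) = (a - b) * (b + 1 - a)\<close>.\<close>
    have n1: "N1 (increment p l j) k i * (a - b) = N1 p k i * (a - b - 1)"
      using prod_change_one[of "{..<Suc k}" j
          "\<lambda>m. shifted (increment p l j) k i - shifted (increment p l j) (Suc k) m"
          "\<lambda>m. shifted p k i - shifted p (Suc k) m"] 2 ij
      by (simp add: N1_def shifted_increment a_def b_def algebra_simps del: prod.lessThan_Suc)
    have n2: "N2 (increment p k i) l j * (b + 1 - a) = N2 p l j * (b - a)"
      using prod_change_one[of "{..<l - 1}" i
          "\<lambda>m. shifted (increment p k i) l j + 1 - shifted (increment p k i) (l - 1) m"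
          "\<lambda>m. shifted p l j + 1 - shifted p (l - 1) m"] 2 ij
      by (simp add: N2_def shifted_increment a_def b_def algebra_simps)
    have "a - b \<noteq> 0"
      using ne(1) 2 ij prod_zero[of "{..<Suc k}" "\<lambda>m. shifted p k i - shifted p (Suc k) m"]
      unfolding N1_def a_def b_def by blast
    moreover have "b + 1 - a \<noteq> 0" using ne(5) 2 ij by (auto simp: N2_def a_def b_def)
    ultimately have nz': "(a - b) * (b + 1 - a) \<noteq> 0" by simp
    have "N1 (increment p l j) k i * N2 (increment p k i) l j * ((a - b) * (b + 1 - a))
      = (N1 (increment p l j) k i * (a - b)) * (N2 (increment p k i) l j * (b + 1 - a))"
      by (simp only: ac_simps)
    also have "\<dots> = N1 p k i * (a - b - 1) * (N2 p l j * (b - a))" by (simp only: n1 n2)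
    also have "\<dots> = N1 p k i * N2 p l j * ((a - b) * (b + 1 - a))"
      by (simp add: algebra_simps)
    finally have "N1 (increment p l j) k i * N2 (increment p k i) l j = N1 p k i * N2 p l j"
      using nz' by simp
    then have "N1 (increment p l j) k i * N2 p k i * (N1 p l j * N2 (increment p k i) l j) =
      N1 p k i * N2 p k i * (N1 p l j * N2 p l j)"
      by (simp add: ac_simps)
    then show ?thesis unfolding gp same by simp
  next
    case 3
    then have "k - Suc 0 \<noteq> l" "l - Suc 0 \<noteq> k" by auto
    with 3 have "gt_product (increment p l j) k i = gt_product p k i"
      "gt_product (increment p k i) l j = gt_product p l j"
      by (auto simp: gt_product_def shifted_increment)
    then show ?thesis by simp
  qed
qed

lemma gt_product_diamond:
  assumes kl: "1 \<le> k" "1 \<le> l" and ij: "i < k" "j < l" "(k, i) \<noteq> (l, j)"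
    and nz: "gt_product p k i \<noteq> 0" "gt_product p l j \<noteq> 0"
      "gt_product (increment p l j) k i \<noteq> 0" "gt_product (increment p k i) l j \<noteq> 0"
  shows "gt_product (increment p l j) k i * gt_product (increment p k i) l j =
    gt_product p k i * gt_product p l j"
proof (cases "k \<le> l")
  case True
  then show ?thesis using gt_product_diamond_aux assms by blast
next
  case False
  then show ?thesis using gt_product_diamond_aux[of l k j i p] assms by (simp add: mult.commute)
qed

section \<open>Irreducible representations\<close>

definition cartan :: "nat \<Rightarrow> nat \<Rightarrow> int" where
  "cartan i j = (if i = j then 2 else if i = Suc j \<or> j = Suc i then - 1 else 0)"

section \<open>Generators of sl_n and their brackets\<close>

lemma matrix_unit_carrier [simp]: "matrix_unit n i j \<in> carrier_mat n n"
  by (simp add: matrix_unit_def)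

lemma gen_carrier [simp]:
  "gen_X n k \<in> carrier_mat n n" "gen_Y n k \<in> carrier_mat n n" "gen_H n k \<in> carrier_mat n n"
  by (simp_all add: gen_X_def gen_Y_def gen_H_def minus_carrier_mat)

lemma matrix_unit_mult:
  assumes "1 \<le> j" "j \<le> n"
  shows "matrix_unit n i j * matrix_unit n k l = (if j = k then matrix_unit n i l else 0\<^sub>m n n)"
proof (rule eq_matI)
  fix a b
  assume "a < dim_row (if j = k then matrix_unit n i l else 0\<^sub>m n n)"
    and "b < dim_col (if j = k then matrix_unit n i l else 0\<^sub>m n n)"
  then have ab: "a < n" "b < n" by (auto simp: matrix_unit_def split: if_splits)
  have "(matrix_unit n i j * matrix_unit n k l) $$ (a, b) =
      (\<Sum>c\<in>{0..<n}. (if Suc a = i \<and> Suc c = j then 1 else 0) * (if Suc c = k \<and> Suc b = l then 1 else 0))"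
    using ab by (simp add: matrix_unit_def scalar_prod_def)
  also have "\<dots> = (\<Sum>c\<in>{0..<n}. if c = j - 1 then (if Suc a = i \<and> j = k \<and> Suc b = l then 1 else 0) else 0)"
    using assms by (intro sum.cong) auto
  also have "\<dots> = (if j = k then matrix_unit n i l else 0\<^sub>m n n) $$ (a, b)"
    using assms ab by (auto simp: matrix_unit_def)
  finally show "(matrix_unit n i j * matrix_unit n k l) $$ (a, b) =
      (if j = k then matrix_unit n i l else 0\<^sub>m n n) $$ (a, b)" .
qed (auto simp: matrix_unit_def)

lemma matrix_unit_off_diagonal_in_sl: "i \<noteq> j \<Longrightarrow> matrix_unit n i j \<in> sl n"
  by (auto simp: sl_def matrix_unit_def intro!: sum.neutral)

lemma gen_in_sl:
  assumes "k \<in> {1..<n}"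
  shows "gen_X n k \<in> sl n" "gen_Y n k \<in> sl n" "gen_H n k \<in> sl n"
proof -
  show "gen_X n k \<in> sl n" "gen_Y n k \<in> sl n"
    by (simp_all add: gen_X_def gen_Y_def matrix_unit_off_diagonal_in_sl)
  have "(\<Sum>i<n. gen_H n k $$ (i, i)) = (\<Sum>i<n. (if i = k - 1 then 1 else 0) - (if i = k then 1 else 0))"
    using assms by (intro sum.cong) (auto simp: gen_H_def matrix_unit_def)
  also have "\<dots> = 0" using assms by (simp add: sum_subtractf) linarith
  finally show "gen_H n k \<in> sl n" by (simp add: sl_def)
qed

lemma bracket_X_Y:
  assumes "i \<in> {1..<n}" "j \<in> {1..<n}"
  shows "gen_X n i * gen_Y n j - gen_Y n j * gen_X n i = (if i = j then gen_H n i else 0\<^sub>m n n)"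
  using assms by (auto simp: gen_X_def gen_Y_def gen_H_def matrix_unit_mult)

lemma bracket_H_X:
  assumes "i \<in> {1..<n}" "j \<in> {1..<n}"
  shows "gen_H n j * gen_X n i - gen_X n i * gen_H n j = of_int (cartan j i) \<cdot>\<^sub>m gen_X n i"
  using assms
  by (intro eq_matI)
     (auto simp: gen_X_def gen_H_def minus_mult_distrib_mat[of _ n n _ _ n]
       mult_minus_distrib_mat[of _ n n _ n] matrix_unit_mult cartan_def, auto simp: matrix_unit_def)

lemma bracket_H_Y:
  assumes "i \<in> {1..<n}" "j \<in> {1..<n}"
  shows "gen_H n j * gen_Y n i - gen_Y n i * gen_H n j = (- of_int (cartan j i)) \<cdot>\<^sub>m gen_Y n i"
  using assms
  by (intro eq_matI)
     (auto simp: gen_Y_def gen_H_def minus_mult_distrib_mat[of _ n n _ _ n]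
       mult_minus_distrib_mat[of _ n n _ n] matrix_unit_mult cartan_def, auto simp: matrix_unit_def)

text \<open>Off-diagonal matrix units are iterated brackets of the \<open>gen_X\<close> or of the
  \<open>gen_Y\<close>, each \<open>gen_H\<close> is a bracket of the two, and a traceless diagonal
  matrix telescopes into multiples of the \<open>gen_H\<close>.\<close>

lemma sl_generated_induct:
  assumes A: "A \<in> sl n"
    and gens: "\<And>k. k \<in> {1..<n} \<Longrightarrow> gen_X n k \<in> S" "\<And>k. k \<in> {1..<n} \<Longrightarrow> gen_Y n k \<in> S"
    and add: "\<And>B C. B \<in> S \<Longrightarrow> C \<in> S \<Longrightarrow> B \<in> sl n \<Longrightarrow> C \<in> sl n \<Longrightarrow> B + C \<in> S"
    and smult: "\<And>a B. B \<in> S \<Longrightarrow> B \<in> sl n \<Longrightarrow> a \<cdot>\<^sub>m B \<in> S"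
    and bracket: "\<And>B C. B \<in> S \<Longrightarrow> C \<in> S \<Longrightarrow> B \<in> sl n \<Longrightarrow> C \<in> sl n \<Longrightarrow> B * C - C * B \<in> S"
    and zero: "0\<^sub>m n n \<in> S"
  shows "A \<in> S"
proof -
  have upper: "matrix_unit n i (i + Suc m) \<in> S" if "1 \<le> i" "i + Suc m \<le> n" for i m
    using that
  proof (induction m)
    case 0
    then show ?case using gens(1)[of i] by (simp add: gen_X_def)
  next
    case (Suc m)
    have "matrix_unit n i (i + Suc m) * gen_X n (i + Suc m) - gen_X n (i + Suc m) * matrix_unit n i (i + Suc m)
      = matrix_unit n i (i + Suc (Suc m))"
      using Suc.prems by (simp add: gen_X_def matrix_unit_mult) (auto simp: matrix_unit_def)
    then show ?case
      using bracket[OF Suc.IH gens(1)[of "i + Suc m"] matrix_unit_off_diagonal_in_sl gen_in_sl(1)] Suc.prems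
      by simp
  qed
  have lower: "matrix_unit n (i + Suc m) i \<in> S" if "1 \<le> i" "i + Suc m \<le> n" for i m
    using that
  proof (induction m)
    case 0
    then show ?case using gens(2)[of i] by (simp add: gen_Y_def)
  next
    case (Suc m)
    have "gen_Y n (i + Suc m) * matrix_unit n (i + Suc m) i - matrix_unit n (i + Suc m) i * gen_Y n (i + Suc m)
      = matrix_unit n (i + Suc (Suc m)) i"
      using Suc.prems by (simp add: gen_Y_def matrix_unit_mult) (auto simp: matrix_unit_def)
    then show ?case
      using bracket[OF gens(2)[of "i + Suc m"] Suc.IH gen_in_sl(2) matrix_unit_off_diagonal_in_sl] Suc.prems
      by simp
  qed
  have off: "matrix_unit n (Suc i) (Suc j) \<in> S" if "i < n" "j < n" "i \<noteq> j" for i j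
  proof (cases "i < j")
    case True
    then show ?thesis using upper[of "Suc i" "j - i - 1"] that by simp
  next
    case False
    then show ?thesis using lower[of "Suc j" "i - j - 1"] that by simp
  qed
  have H: "gen_H n k \<in> S" if "k \<in> {1..<n}" for k
    using bracket[OF gens(1)[OF that] gens(2)[OF that] gen_in_sl(1)[OF that] gen_in_sl(2)[OF that]]
      bracket_X_Y[OF that that] by simp
  define Off where "Off = (\<lambda>F. mat n n (\<lambda>(i, j). if (i, j) \<in> F then A $$ (i, j) else 0))"
  have Off: "Off F \<in> S \<and> Off F \<in> sl n" if "finite F" "F \<subseteq> {(i, j). i < n \<and> j < n \<and> i \<noteq> j}" for F
    using that
  proof (induction F rule: finite_induct)
    case empty
    have "Off {} = 0\<^sub>m n n" by (auto simp: Off_def)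
    then show ?case using zero by (simp add: sl_def)
  next
    case (insert x F)
    obtain i j where x: "x = (i, j)" "i < n" "j < n" "i \<noteq> j" using insert.prems by auto
    have sl: "A $$ x \<cdot>\<^sub>m matrix_unit n (Suc i) (Suc j) \<in> sl n"
      using x by (auto simp: sl_def matrix_unit_def intro!: sum.neutral)
    have "Off (insert x F) = A $$ x \<cdot>\<^sub>m matrix_unit n (Suc i) (Suc j) + Off F"
      using x insert.hyps by (intro eq_matI) (auto simp: Off_def matrix_unit_def)
    moreover have "Off (insert x F) \<in> sl n"
      using insert.prems by (auto simp: sl_def Off_def intro!: sum.neutral)
    ultimately show ?case
      using add[OF smult[OF off[of i j]] _ sl] insert x by (auto simp: matrix_unit_off_diagonal_in_sl)
  qed
  \<comment> \<open>\<open>D m\<close> keeps the first \<open>m\<close> diagonal entries and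
    restores trace zero at index \<open>m\<close>. Consecutive ones differ by a multiple of
    \<open>gen_H n (Suc m)\<close>, whose coefficient is a partial trace of
    \<open>A\<close>.\<close>
  define D where "D = (\<lambda>m. mat n n (\<lambda>(i, j). if i = j then
    (if i < m then A $$ (i, i) else if i = m then - (\<Sum>l<m. A $$ (l, l)) else 0) else 0))"
  have D: "D m \<in> S \<and> D m \<in> sl n" if "m < n" for m
    using that
  proof (induction m)
    case 0
    have "D 0 = 0\<^sub>m n n" by (auto simp: D_def)
    then show ?case using zero by (simp add: sl_def)
  next
    case (Suc m)
    let ?a = "\<Sum>l<Suc m. A $$ (l, l)"
    have m: "Suc m \<in> {1..<n}" using Suc.prems by simp
    have sl: "?a \<cdot>\<^sub>m gen_H n (Suc m) \<in> sl n"
      using gen_in_sl(3)[OF m] by (auto simp: sl_def carrier_matD[OF gen_carrier(3)] sum_distrib_left[symmetric]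
          simp del: sum.lessThan_Suc)
    have eq: "D (Suc m) = ?a \<cdot>\<^sub>m gen_H n (Suc m) + D m"
      using Suc.prems by (intro eq_matI) (auto simp: D_def gen_H_def matrix_unit_def less_Suc_eq)
    have "D (Suc m) \<in> S" using add[OF smult[OF H[OF m] gen_in_sl(3)[OF m]] _ sl] Suc eq by simp
    moreover have "D (Suc m) \<in> sl n"
      using sl Suc unfolding eq
      by (auto simp: sl_def sum.distrib carrier_matD[OF gen_carrier(3)] D_def simp del: sum.lessThan_Suc)
    ultimately show ?case by blast
  qed
  show ?thesis
  proof (cases n)
    case 0
    then have "A = 0\<^sub>m n n" using A by (auto simp: sl_def)
    then show ?thesis using zero by simp
  next
    case (Suc m)
    let ?F = "{(i, j). i < n \<and> j < n \<and> i \<noteq> j}"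
    have "finite ?F" by (rule finite_subset[of _ "{..<n} \<times> {..<n}"]) auto
    then have OffF: "Off ?F \<in> S \<and> Off ?F \<in> sl n" using Off by simp
    have "(\<Sum>l<Suc m. A $$ (l, l)) = 0" using A Suc by (simp add: sl_def)
    then have "A $$ (m, m) = - (\<Sum>l<m. A $$ (l, l))" by (simp add: add_eq_0_iff)
    then have "A = Off ?F + D m"
      using A Suc by (intro eq_matI) (auto simp: sl_def Off_def D_def less_Suc_eq)
    then show ?thesis using add[of "Off ?F" "D m"] OffF D[of m] Suc by simp
  qed
qed

section \<open>Irreducibility tested on the generators\<close>

locale sl_irrep =
  fixes n :: nat and scale :: "complex \<Rightarrow> 'v \<Rightarrow> 'v::ab_group_add"
    and \<phi> :: "complex mat \<Rightarrow> 'v \<Rightarrow> 'v"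
  assumes irreducible: "irreducible_sl_representation n scale \<phi>"
begin

lemma representation: "sl_representation n scale \<phi>"
  using irreducible by (simp add: irreducible_sl_representation_def)

sublocale vector_space scale
  using representation by (simp add: sl_representation_def)

abbreviation X where "X k \<equiv> \<phi> (gen_X n k)"
abbreviation Y where "Y k \<equiv> \<phi> (gen_Y n k)"
abbreviation H where "H k \<equiv> \<phi> (gen_H n k)"

lemma hom: "A \<in> sl n \<Longrightarrow> module_hom scale scale (\<phi> A)"
  using representation by (simp add: sl_representation_def linear_iff_module_hom)

lemma hom_gens:
  assumes "k \<in> {1..<n}"
  shows "module_hom scale scale (X k)" "module_hom scale scale (Y k)" "module_hom scale scale (H k)"
  using hom gen_in_sl[OF assms] by auto

lemma action_zero_mat: "\<phi> (0\<^sub>m n n) v = 0"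
proof -
  have z: "0\<^sub>m n n \<in> sl n" by (simp add: sl_def)
  have "\<phi> (0 \<cdot>\<^sub>m 0\<^sub>m n n) v = scale 0 (\<phi> (0\<^sub>m n n) v)"
    using representation z unfolding sl_representation_def by blast
  moreover have "0 \<cdot>\<^sub>m 0\<^sub>m n n = (0\<^sub>m n n :: complex mat)" by auto
  ultimately show ?thesis by simp
qed

lemma action_bracket:
  "A \<in> sl n \<Longrightarrow> B \<in> sl n \<Longrightarrow> \<phi> A (\<phi> B v) - \<phi> B (\<phi> A v) = \<phi> (A * B - B * A) v"
  using representation by (simp add: sl_representation_def)

lemma X_Y:
  assumes "i \<in> {1..<n}" "j \<in> {1..<n}"
  shows "X i (Y j v) = Y j (X i v) + (if i = j then H i v else 0)"
  using action_bracket[OF gen_in_sl(1)[OF assms(1)] gen_in_sl(2)[OF assms(2)], of v]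
    bracket_X_Y[OF assms] action_zero_mat[of v] by (auto simp: algebra_simps split: if_splits)

lemma H_X:
  assumes "i \<in> {1..<n}" "j \<in> {1..<n}"
  shows "H j (X i v) = X i (H j v) + scale (of_int (cartan j i)) (X i v)"
proof -
  have "\<phi> (of_int (cartan j i) \<cdot>\<^sub>m gen_X n i) v = scale (of_int (cartan j i)) (X i v)"
    using representation gen_in_sl(1)[OF assms(1)] by (simp add: sl_representation_def)
  then show ?thesis
    using action_bracket[OF gen_in_sl(3)[OF assms(2)] gen_in_sl(1)[OF assms(1)], of v]
      bracket_H_X[OF assms] by (simp add: algebra_simps)
qed

lemma H_Y:
  assumes "i \<in> {1..<n}" "j \<in> {1..<n}"
  shows "H j (Y i v) = Y i (H j v) - scale (of_int (cartan j i)) (Y i v)"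
proof -
  have "\<phi> ((- of_int (cartan j i)) \<cdot>\<^sub>m gen_Y n i) v = scale (- of_int (cartan j i)) (Y i v)"
    using representation gen_in_sl(2)[OF assms(1)] by (simp add: sl_representation_def)
  then show ?thesis
    using action_bracket[OF gen_in_sl(3)[OF assms(2)] gen_in_sl(2)[OF assms(1)], of v]
      bracket_H_Y[OF assms] by (simp add: algebra_simps)
qed

text \<open>The matrices preserving \<open>U\<close> are closed under brackets, so the generators
  decide. The arguments by irreducibility and Schur's lemma below go through this form.\<close>

lemma invariant_subspace_trivial:
  assumes U: "subspace U"
    and X: "\<And>k u. k \<in> {1..<n} \<Longrightarrow> u \<in> U \<Longrightarrow> X k u \<in> U"
    and Y: "\<And>k u. k \<in> {1..<n} \<Longrightarrow> u \<in> U \<Longrightarrow> Y k u \<in> U"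
    and nz: "u \<in> U" "u \<noteq> 0"
  shows "w \<in> U"
proof -
  let ?S = "{A. \<forall>u\<in>U. \<phi> A u \<in> U}"
  have "A \<in> ?S" if "A \<in> sl n" for A
  proof (rule sl_generated_induct[OF that])
    fix B C assume "B \<in> ?S" "C \<in> ?S" "B \<in> sl n" "C \<in> sl n"
    then show "B + C \<in> ?S" "B * C - C * B \<in> ?S"
      using representation U by (auto simp: sl_representation_def subspace_add subspace_diff)
  next
    fix a B assume "B \<in> ?S" "B \<in> sl n"
    then show "a \<cdot>\<^sub>m B \<in> ?S"
      using representation U by (auto simp: sl_representation_def subspace_scale)
  next
    show "0\<^sub>m n n \<in> ?S" using action_zero_mat subspace_0[OF U] by simp
  qed (use X Y in auto)
  then have "\<forall>A\<in>sl n. \<phi> A ` U \<subseteq> U" by blast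
  then have "U = {0} \<or> U = UNIV"
    using irreducible U unfolding irreducible_sl_representation_def by blast
  then show ?thesis using nz by blast
qed

end

section \<open>Representation diagrams\<close>

text \<open>Acts on coordinate functions instead of vectors, so that bases with the same graph and
  the functions on the lattice itself share one description.\<close>

definition act_X :: "(nat \<Rightarrow> ('a \<times> 'a) set) \<Rightarrow> ('a \<Rightarrow> 'a \<Rightarrow> complex) \<Rightarrow> nat \<Rightarrow>
    ('a \<Rightarrow> complex) \<Rightarrow> 'a \<Rightarrow> complex" where
  "act_X E c k f t = (\<Sum>s | (s, t) \<in> E k. c t s * f s)"

definition act_Y :: "(nat \<Rightarrow> ('a \<times> 'a) set) \<Rightarrow> ('a \<Rightarrow> 'a \<Rightarrow> complex) \<Rightarrow> nat \<Rightarrow>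
    ('a \<Rightarrow> complex) \<Rightarrow> 'a \<Rightarrow> complex" where
  "act_Y E d k f r = (\<Sum>t | (r, t) \<in> E k. d r t * f t)"

text \<open>The commutator of \<open>X i\<close> and \<open>Y j\<close> in coordinates; it contains
  the crossing condition (\<open>i = j\<close>, \<open>s = t\<close>) and the diamond condition
  (\<open>s \<noteq> t\<close>). The weights are a parameter, so that labels coming from a subgraph
  can be tested against the weights of the whole graph.\<close>

definition bracket_condition :: "nat set \<Rightarrow> 'a set \<Rightarrow> (nat \<Rightarrow> ('a \<times> 'a) set) \<Rightarrow>
    ('a \<Rightarrow> 'a \<Rightarrow> complex) \<Rightarrow> ('a \<Rightarrow> 'a \<Rightarrow> complex) \<Rightarrow> (nat \<Rightarrow> 'a \<Rightarrow> int) \<Rightarrow> bool" where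
  "bracket_condition I P E c d m \<longleftrightarrow> (\<forall>i\<in>I. \<forall>j\<in>I. \<forall>s\<in>P. \<forall>t\<in>P.
     (\<Sum>r | (r, t) \<in> E i \<and> (r, s) \<in> E j. c t r * d r s) -
     (\<Sum>u | (t, u) \<in> E j \<and> (s, u) \<in> E i. d t u * c u s) =
     (if i = j \<and> s = t then of_int (m i s) else 0))"

lemma bracket_conditionD:
  assumes "bracket_condition I P E c d m" "i \<in> I" "j \<in> I" "s \<in> P" "t \<in> P"
  shows "(\<Sum>r | (r, t) \<in> E i \<and> (r, s) \<in> E j. c t r * d r s) -
     (\<Sum>u | (t, u) \<in> E j \<and> (s, u) \<in> E i. d t u * c u s) =
     (if i = j \<and> s = t then of_int (m i s) else 0)"
  using assms unfolding bracket_condition_def by blast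

lemma bracket_condition_crossing:
  assumes "bracket_condition I P E c d m" "i \<in> I" "s \<in> P"
  shows "(\<Sum>r | (r, s) \<in> E i. edge_product c d r s) - (\<Sum>u | (s, u) \<in> E i. edge_product c d s u) =
    of_int (m i s)"
  using bracket_conditionD[OF assms(1,2,2,3,3)] by (simp add: edge_product_def mult.commute)

definition point :: "'a \<Rightarrow> 'a \<Rightarrow> complex" where
  "point s = (\<lambda>t. if t = s then 1 else 0)"

lemma sum_edges_swap:
  assumes "finite P" "R \<subseteq> P \<times> P"
  shows "(\<Sum>s\<in>P. \<Sum>t | (s, t) \<in> R. g s t) = (\<Sum>t\<in>P. \<Sum>s | (s, t) \<in> R. g s t)"
proof -
  have "{t. (s, t) \<in> R} = {t. t \<in> P \<and> (s, t) \<in> R}" "{s. (s, t) \<in> R} = {s. s \<in> P \<and> (s, t) \<in> R}" for s t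
    using assms(2) by auto
  then show ?thesis using sum.swap_restrict[OF assms(1,1), of g "\<lambda>s t. (s, t) \<in> R"] by simp
qed

lemma sum_nested_edges:
  fixes f :: "'a \<Rightarrow> 'b::comm_semiring_0"
  assumes "finite P" "finite {r. R r}" "\<And>r s. Q r s \<Longrightarrow> s \<in> P"
  shows "(\<Sum>r | R r. a r * (\<Sum>s | Q r s. b r s * f s)) =
    (\<Sum>s\<in>P. (\<Sum>r | R r \<and> Q r s. a r * b r s) * f s)"
proof -
  have "{s. Q r s} = {s. s \<in> P \<and> Q r s}" for r using assms(3) by auto
  then have "(\<Sum>r | R r. a r * (\<Sum>s | Q r s. b r s * f s)) =
      (\<Sum>r\<in>{r. R r}. \<Sum>s\<in>{s. s \<in> P \<and> Q r s}. a r * (b r s * f s))"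
    by (simp add: sum_distrib_left)
  also have "\<dots> = (\<Sum>s\<in>P. \<Sum>r\<in>{r. r \<in> {r. R r} \<and> Q r s}. a r * (b r s * f s))"
    by (rule sum.swap_restrict) (use assms in auto)
  finally show ?thesis by (simp add: sum_distrib_right mult.assoc)
qed

lemma finite_neighbours:
  assumes "finite P" "R \<subseteq> P \<times> P"
  shows "finite {s. (s, t) \<in> R}" "finite {t. (s, t) \<in> R}"
  by (rule finite_subset[OF _ assms(1)], use assms(2) in auto)+

lemma act_X_act_Y:
  assumes P: "finite P" and E: "\<And>i. i \<in> I \<Longrightarrow> E i \<subseteq> P \<times> P"
    and br: "bracket_condition I P E c d m" and ij: "i \<in> I" "j \<in> I"
    and f: "\<And>s. s \<notin> P \<Longrightarrow> f s = 0"
  shows "act_X E c i (act_Y E d j f) t =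
    act_Y E d j (act_X E c i f) t + (if i = j then of_int (m i t) * f t else 0)"
proof (cases "t \<in> P")
  case False
  have empty: "{r. (r, t) \<in> E i} = {}" "{u. (t, u) \<in> E j} = {}" using E ij False by auto
  show ?thesis using f[OF False] by (simp add: act_X_def act_Y_def empty)
next
  case True
  have "act_X E c i (act_Y E d j f) t =
      (\<Sum>s\<in>P. (\<Sum>r | (r, t) \<in> E i \<and> (r, s) \<in> E j. c t r * d r s) * f s)"
    unfolding act_X_def act_Y_def
    by (rule sum_nested_edges[OF P finite_neighbours(1)[OF P E[OF ij(1)]]]) (use E ij in auto)
  moreover have "act_Y E d j (act_X E c i f) t =
      (\<Sum>s\<in>P. (\<Sum>u | (t, u) \<in> E j \<and> (s, u) \<in> E i. d t u * c u s) * f s)"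
    unfolding act_X_def act_Y_def
    by (rule sum_nested_edges[OF P finite_neighbours(2)[OF P E[OF ij(2)]]]) (use E ij in auto)
  ultimately have "act_X E c i (act_Y E d j f) t - act_Y E d j (act_X E c i f) t =
      (\<Sum>s\<in>P. (if i = j \<and> s = t then of_int (m i s) else 0) * f s)"
    using bracket_conditionD[OF br ij _ True]
    by (simp add: sum_subtractf[symmetric] left_diff_distrib[symmetric])
  also have "\<dots> = (\<Sum>s\<in>P. if s = t then (if i = j then of_int (m i t) * f t else 0) else 0)"
    by (intro sum.cong) auto
  also have "\<dots> = (if i = j then of_int (m i t) * f t else 0)" using P True by simp
  finally show ?thesis by (simp add: algebra_simps)
qed

lemma act_X_point: "act_X E c i (point s) t = (if (s, t) \<in> E i then c t s else 0)"
  if "finite {r. (r, t) \<in> E i}"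
  using that by (simp add: act_X_def point_def if_distrib sum.delta cong: if_cong)

lemma act_Y_point: "act_Y E d i (point s) t = (if (t, s) \<in> E i then d t s else 0)"
  if "finite {u. (t, u) \<in> E i}"
  using that by (simp add: act_Y_def point_def if_distrib sum.delta cong: if_cong)

text \<open>A commutator has trace zero: every edge product is counted once with each sign.\<close>

lemma sum_bracket_weights:
  assumes P: "finite P" and E: "E i \<subseteq> P \<times> P" and i: "i \<in> I"
    and br: "bracket_condition I P E c d m"
  shows "(\<Sum>s\<in>P. m i s) = 0"
proof -
  have "(\<Sum>s\<in>P. of_int (m i s)) = (\<Sum>s\<in>P. (\<Sum>r | (r, s) \<in> E i. edge_product c d r s) -
      (\<Sum>u | (s, u) \<in> E i. edge_product c d s u))"
    using bracket_condition_crossing[OF br i] by simp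
  also have "\<dots> = 0"
    using sum_edges_swap[OF P E, of "edge_product c d"] by (simp add: sum_subtractf)
  finally have "of_int (\<Sum>s\<in>P. m i s) = (0 :: complex)" by simp
  then show ?thesis by (simp only: of_int_eq_0_iff)
qed

section \<open>Coordinates in an indexed basis\<close>

definition lin_comb :: "('f \<Rightarrow> 'v \<Rightarrow> 'v::ab_group_add) \<Rightarrow> 'i set \<Rightarrow> ('i \<Rightarrow> 'v) \<Rightarrow> ('i \<Rightarrow> 'f) \<Rightarrow> 'v" where
  "lin_comb scale P v f = (\<Sum>s\<in>P. scale (f s) (v s))"

context vector_space
begin

lemma lin_comb_add: "lin_comb scale P v (\<lambda>s. f s + g s) = lin_comb scale P v f + lin_comb scale P v g"
  by (simp add: lin_comb_def scale_left_distrib sum.distrib)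

lemma lin_comb_diff: "lin_comb scale P v (\<lambda>s. f s - g s) = lin_comb scale P v f - lin_comb scale P v g"
  by (simp add: lin_comb_def scale_left_diff_distrib sum_subtractf)

lemma lin_comb_scale:
  fixes a :: 'a
  shows "lin_comb scale P v (\<lambda>s. a * f s) = scale a (lin_comb scale P v f)"
  by (simp add: lin_comb_def scale_sum_right)

lemma lin_comb_zero: "lin_comb scale P v (\<lambda>s. 0) = 0"
  by (simp add: lin_comb_def)

lemma basis_iff_lin_comb:
  assumes "finite P"
  shows "inj_on v P \<and> independent (v ` P) \<longleftrightarrow> (\<forall>f. lin_comb scale P v f = 0 \<longrightarrow> (\<forall>s\<in>P. f s = 0))"
proof
  assume v: "inj_on v P \<and> independent (v ` P)"
  show "\<forall>f. lin_comb scale P v f = 0 \<longrightarrow> (\<forall>s\<in>P. f s = 0)"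
  proof (intro allI impI ballI)
    fix f s assume f: "lin_comb scale P v f = 0" and s: "s \<in> P"
    have "(\<Sum>x\<in>v ` P. scale (f (inv_into P v x)) x) = 0"
      using f v by (simp add: sum.reindex lin_comb_def)
    then have "f (inv_into P v (v s)) = 0"
      using independentD[of "v ` P" "v ` P" "\<lambda>x. f (inv_into P v x)" "v s"] v assms s by simp
    then show "f s = 0" using v s by simp
  qed
next
  assume *: "\<forall>f. lin_comb scale P v f = 0 \<longrightarrow> (\<forall>s\<in>P. f s = 0)"
  have inj: "inj_on v P"
  proof (rule inj_onI, rule ccontr)
    fix s t assume st: "s \<in> P" "t \<in> P" "v s = v t" "s \<noteq> t"
    have delta: "lin_comb scale P v (\<lambda>r. if r = x then 1 else 0) = v x" if "x \<in> P" for x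
      using assms that by (simp add: lin_comb_def if_distrib[of "\<lambda>a. scale a _"] cong: if_cong)
    have "lin_comb scale P v (\<lambda>r. (if r = s then 1 else 0) - (if r = t then 1 else 0)) = 0"
      unfolding lin_comb_diff using st by (simp add: delta)
    then have "(if s = s then 1 else 0) - (if s = t then 1 else 0) = (0 :: 'a)"
      using *[rule_format, of "\<lambda>r. (if r = s then 1 else 0) - (if r = t then 1 else 0)" s] st by simp
    then show False using st by simp
  qed
  moreover have "independent (v ` P)"
  proof
    assume "dependent (v ` P)"
    then obtain u x where x: "x \<in> v ` P" "u x \<noteq> 0" and u: "(\<Sum>x\<in>v ` P. scale (u x) x) = 0"
      using dependent_finite[of "v ` P"] assms by blast
    have "lin_comb scale P v (\<lambda>s. u (v s)) = 0" using u inj by (simp add: sum.reindex lin_comb_def)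
    then show False using * x by blast
  qed
  ultimately show "inj_on v P \<and> independent (v ` P)" ..
qed

end

context sl_irrep
begin

lemma lin_comb_point: "finite P \<Longrightarrow> s \<in> P \<Longrightarrow> lin_comb scale P v (point s) = v s"
  by (simp add: lin_comb_def point_def if_distrib[of "\<lambda>a. scale a _"] cong: if_cong)

lemma lin_comb_inject:
  assumes "finite P" "indexed_basis scale P v" "lin_comb scale P v f = lin_comb scale P v g" "s \<in> P"
  shows "f s = g s"
proof -
  have "lin_comb scale P v (\<lambda>s. f s - g s) = 0" using assms(3) by (simp add: lin_comb_diff)
  then have "f s - g s = 0"
    using basis_iff_lin_comb[OF assms(1), of v] assms(2,4) unfolding indexed_basis_def by blast
  then show ?thesis by simp
qed

lemma lin_comb_exhaust:
  assumes "finite P" "indexed_basis scale P v"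
  obtains f where "w = lin_comb scale P v f" "\<And>s. s \<notin> P \<Longrightarrow> f s = 0"
proof -
  have "w \<in> span (v ` P)" using assms(2) by (simp add: indexed_basis_def)
  then obtain u where "w = (\<Sum>x\<in>v ` P. scale (u x) x)" using assms(1) by (auto simp: span_finite)
  moreover have "\<dots> = lin_comb scale P v (\<lambda>s. if s \<in> P then u (v s) else 0)"
    using assms(2) by (simp add: sum.reindex indexed_basis_def lin_comb_def)
  ultimately show thesis using that[of "\<lambda>s. if s \<in> P then u (v s) else 0"] by simp
qed

lemma basis_nonzero:
  assumes "finite P" "indexed_basis scale P v" "s \<in> P"
  shows "v s \<noteq> 0"
proof
  assume "v s = 0"
  then have "lin_comb scale P v (point s) = lin_comb scale P v (\<lambda>s. 0)"
    using assms by (simp add: lin_comb_point lin_comb_zero)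
  then have "point s s = 0" by (rule lin_comb_inject[OF assms(1,2) _ assms(3)])
  then show False by (simp add: point_def)
qed

section \<open>The operators of a representation diagram in coordinates\<close>

context
  fixes P :: "'a set" and E c d v
  assumes diagram: "representation_diagram n scale \<phi> P E c d v"
begin

lemma diagram_finite: "finite P"
  and diagram_edges: "i \<in> {1..<n} \<Longrightarrow> E i \<subseteq> P \<times> P"
  and diagram_basis: "indexed_basis scale P v"
  using diagram by (simp_all add: representation_diagram_def colored_ranked_poset_def)

lemma diagram_X:
  assumes k: "k \<in> {1..<n}"
  shows "X k (lin_comb scale P v f) = lin_comb scale P v (act_X E c k f)"
proof -
  interpret Xk: module_hom scale scale "X k" by (rule hom_gens(1)[OF k])
  have "X k (lin_comb scale P v f) = (\<Sum>s\<in>P. \<Sum>t | (s, t) \<in> E k. scale (f s) (scale (c t s) (v t)))"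
    unfolding lin_comb_def Xk.sum Xk.scale scale_sum_right[symmetric]
    by (intro sum.cong refl) (use diagram k in \<open>simp add: representation_diagram_def\<close>)
  also have "\<dots> = (\<Sum>t\<in>P. \<Sum>s | (s, t) \<in> E k. scale (f s) (scale (c t s) (v t)))"
    by (rule sum_edges_swap[OF diagram_finite diagram_edges[OF k]])
  also have "\<dots> = lin_comb scale P v (act_X E c k f)"
    by (simp add: lin_comb_def act_X_def scale_sum_left mult.commute)
  finally show ?thesis .
qed

lemma diagram_Y:
  assumes k: "k \<in> {1..<n}"
  shows "Y k (lin_comb scale P v f) = lin_comb scale P v (act_Y E d k f)"
proof -
  interpret Yk: module_hom scale scale "Y k" by (rule hom_gens(2)[OF k])
  have "Y k (lin_comb scale P v f) = (\<Sum>s\<in>P. \<Sum>r | (r, s) \<in> E k. scale (f s) (scale (d r s) (v r)))"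
    unfolding lin_comb_def Yk.sum Yk.scale scale_sum_right[symmetric]
    by (intro sum.cong refl) (use diagram k in \<open>simp add: representation_diagram_def\<close>)
  also have "\<dots> = (\<Sum>r\<in>P. \<Sum>s | (r, s) \<in> E k. scale (f s) (scale (d r s) (v r)))"
    by (rule sum_edges_swap[OF diagram_finite diagram_edges[OF k], symmetric])
  also have "\<dots> = lin_comb scale P v (act_Y E d k f)"
    by (simp add: lin_comb_def act_Y_def scale_sum_left mult.commute)
  finally show ?thesis .
qed

lemma diagram_H:
  assumes k: "k \<in> {1..<n}"
  shows "H k (lin_comb scale P v f) = lin_comb scale P v (\<lambda>s. of_int (vertex_value E k s) * f s)"
proof -
  interpret Hk: module_hom scale scale "H k" by (rule hom_gens(3)[OF k])
  show ?thesis
    unfolding lin_comb_def Hk.sum Hk.scale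
    by (intro sum.cong refl) (use diagram k in \<open>simp add: representation_diagram_def mult.commute\<close>)
qed

text \<open>The coordinate at \<open>v t\<close> of \<open>X_Y\<close> applied to
  \<open>v s\<close>.\<close>

lemma diagram_bracket: "bracket_condition {1..<n} P E c d (vertex_value E)"
  unfolding bracket_condition_def
proof (intro ballI)
  fix i j s t assume ij: "i \<in> {1..<n}" "j \<in> {1..<n}" and st: "s \<in> P" "t \<in> P"
  note fin = finite_neighbours[OF diagram_finite diagram_edges]
  have "lin_comb scale P v (act_X E c i (act_Y E d j (point s))) = X i (Y j (lin_comb scale P v (point s)))"
    by (simp add: diagram_X[OF ij(1)] diagram_Y[OF ij(2)])
  also have "\<dots> = lin_comb scale P v (\<lambda>t. act_Y E d j (act_X E c i (point s)) t +
      (if i = j then of_int (vertex_value E i t) * point s t else 0))"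
    unfolding X_Y[OF ij] lin_comb_add using ij
    by (simp add: diagram_X diagram_Y diagram_H lin_comb_zero)
  finally have "act_X E c i (act_Y E d j (point s)) t = act_Y E d j (act_X E c i (point s)) t +
      (if i = j then of_int (vertex_value E i t) * point s t else 0)"
    using lin_comb_inject[OF diagram_finite diagram_basis _ st(2)] by blast
  moreover have "act_X E c i (act_Y E d j (point s)) t = (\<Sum>r | (r, t) \<in> E i \<and> (r, s) \<in> E j. c t r * d r s)"
  proof -
    have "act_X E c i (act_Y E d j (point s)) t =
        (\<Sum>r | (r, t) \<in> E i. c t r * (if (r, s) \<in> E j then d r s else 0))"
      unfolding act_X_def using fin(2)[OF ij(2)] by (simp add: act_Y_point)
    also have "\<dots> = (\<Sum>r | (r, t) \<in> E i \<and> (r, s) \<in> E j. c t r * d r s)"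
      using fin(1)[OF ij(1)] by (intro sum.mono_neutral_cong_right) auto
    finally show ?thesis .
  qed
  moreover have "act_Y E d j (act_X E c i (point s)) t = (\<Sum>u | (t, u) \<in> E j \<and> (s, u) \<in> E i. d t u * c u s)"
  proof -
    have "act_Y E d j (act_X E c i (point s)) t =
        (\<Sum>u | (t, u) \<in> E j. d t u * (if (s, u) \<in> E i then c u s else 0))"
      unfolding act_Y_def using fin(1)[OF ij(1)] by (simp add: act_X_point)
    also have "\<dots> = (\<Sum>u | (t, u) \<in> E j \<and> (s, u) \<in> E i. d t u * c u s)"
      using fin(2)[OF ij(2)] by (intro sum.mono_neutral_cong_right) auto
    finally show ?thesis .
  qed
  ultimately show "(\<Sum>r | (r, t) \<in> E i \<and> (r, s) \<in> E j. c t r * d r s) -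
     (\<Sum>u | (t, u) \<in> E j \<and> (s, u) \<in> E i. d t u * c u s) =
     (if i = j \<and> s = t then of_int (vertex_value E i s) else 0)"
    by (simp only:) (auto simp: point_def)
qed

text \<open>If \<open>c t s\<close> is nonzero, the weight shift is read off from
  \<open>X i\<close>, and if \<open>d s t\<close> is nonzero, from \<open>Y i\<close>; an edge has
  at least one nonzero label.\<close>

lemma diagram_structure:
  assumes ij: "i \<in> {1..<n}" "j \<in> {1..<n}" and st: "(s, t) \<in> E i"
  shows "vertex_value E j t = vertex_value E j s + cartan j i"
proof -
  note fin = finite_neighbours[OF diagram_finite diagram_edges[OF ij(1)]]
  have P: "s \<in> P" "t \<in> P" using diagram_edges[OF ij(1)] st by auto
  have "lin_comb scale P v (\<lambda>t. of_int (vertex_value E j t) * act_X E c i (point s) t) =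
      H j (X i (lin_comb scale P v (point s)))"
    by (simp add: diagram_X[OF ij(1)] diagram_H[OF ij(2)])
  also have "\<dots> = lin_comb scale P v (\<lambda>t. act_X E c i (\<lambda>r. of_int (vertex_value E j r) * point s r) t +
      of_int (cartan j i) * act_X E c i (point s) t)"
    unfolding H_X[OF ij] lin_comb_add lin_comb_scale
    by (simp add: diagram_X[OF ij(1)] diagram_H[OF ij(2)])
  finally have "of_int (vertex_value E j t) * act_X E c i (point s) t =
      act_X E c i (\<lambda>r. of_int (vertex_value E j r) * point s r) t +
      of_int (cartan j i) * act_X E c i (point s) t"
    by (rule lin_comb_inject[OF diagram_finite diagram_basis _ P(2)])
  moreover have "act_X E c i (\<lambda>r. of_int (vertex_value E j r) * point s r) t =
      of_int (vertex_value E j s) * act_X E c i (point s) t"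
    unfolding act_X_def sum_distrib_left by (intro sum.cong) (auto simp: point_def)
  ultimately have c: "c t s * (of_int (vertex_value E j t) - of_int (vertex_value E j s) - of_int (cartan j i)) = 0"
    using st act_X_point[of t E i c s] fin(1)[of t] by (simp add: algebra_simps)
  have "lin_comb scale P v (\<lambda>r. of_int (vertex_value E j r) * act_Y E d i (point t) r) =
      H j (Y i (lin_comb scale P v (point t)))"
    by (simp add: diagram_Y[OF ij(1)] diagram_H[OF ij(2)])
  also have "\<dots> = lin_comb scale P v (\<lambda>r. act_Y E d i (\<lambda>r. of_int (vertex_value E j r) * point t r) r -
      of_int (cartan j i) * act_Y E d i (point t) r)"
    unfolding H_Y[OF ij] lin_comb_diff lin_comb_scale
    by (simp add: diagram_Y[OF ij(1)] diagram_H[OF ij(2)])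
  finally have "of_int (vertex_value E j s) * act_Y E d i (point t) s =
      act_Y E d i (\<lambda>r. of_int (vertex_value E j r) * point t r) s -
      of_int (cartan j i) * act_Y E d i (point t) s"
    by (rule lin_comb_inject[OF diagram_finite diagram_basis _ P(1)])
  moreover have "act_Y E d i (\<lambda>r. of_int (vertex_value E j r) * point t r) s =
      of_int (vertex_value E j t) * act_Y E d i (point t) s"
    unfolding act_Y_def sum_distrib_left by (intro sum.cong) (auto simp: point_def)
  ultimately have d: "d s t * (of_int (vertex_value E j t) - of_int (vertex_value E j s) - of_int (cartan j i)) = 0"
    using st act_Y_point[of s E i d t] fin(2)[of s] by (simp add: algebra_simps)
  have "c t s \<noteq> 0 \<or> d s t \<noteq> 0"
    using diagram ij st unfolding representation_diagram_def edge_labels_def by blast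
  then have "of_int (vertex_value E j t) - of_int (vertex_value E j s) - of_int (cartan j i) = (0 :: complex)"
    using c d by auto
  then have "of_int (vertex_value E j t - vertex_value E j s - cartan j i) = (0 :: complex)" by simp
  then have "vertex_value E j t - vertex_value E j s - cartan j i = 0" by (simp only: of_int_eq_0_iff)
  then show ?thesis by simp
qed

end

end

section \<open>Uniqueness of edge products\<close>

text \<open>Collects what the later arguments use about the lattice, with tableaux hidden.
  \<open>x\<close> is one known positive solution; \<open>lower_unique\<close> and
  \<open>upper_unique\<close> say that colour \<open>k\<close> leaves no choice once edges of
  smaller colour are excluded.\<close>

locale diamond_graph =
  fixes n :: nat and P :: "'a set" and E :: "nat \<Rightarrow> ('a \<times> 'a) set" and top :: 'a
    and x :: "'a \<Rightarrow> 'a \<Rightarrow> real"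
  assumes poset: "colored_ranked_poset {1..<n} P E"
    and diamond: "\<lbrakk>i \<in> {1..<n}; j \<in> {1..<n}; s \<in> P; t \<in> P; s \<noteq> t\<rbrakk> \<Longrightarrow>
      (\<exists>u r. {u. (s, u) \<in> E j \<and> (t, u) \<in> E i} = {u} \<and> {r. (r, s) \<in> E i \<and> (r, t) \<in> E j} = {r}) \<or>
      ({u. (s, u) \<in> E j \<and> (t, u) \<in> E i} = {} \<and> {r. (r, s) \<in> E i \<and> (r, t) \<in> E j} = {})"
    and lower_unique: "\<lbrakk>(s, t) \<in> E k; (s', t) \<in> E k;
      \<And>j u. j < k \<Longrightarrow> (s, u) \<notin> E j; \<And>j u. j < k \<Longrightarrow> (s', u) \<notin> E j\<rbrakk> \<Longrightarrow> s = s'"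
    and upper_unique: "\<lbrakk>(s, t) \<in> E k; (s, t') \<in> E k;
      \<And>j r. j < k \<Longrightarrow> (r, t) \<notin> E j; \<And>j r. j < k \<Longrightarrow> (r, t') \<notin> E j\<rbrakk> \<Longrightarrow> t = t'"
    and top_in: "top \<in> P" and top_max: "(top, t) \<notin> E k"
    and top_unique: "s \<in> P \<Longrightarrow> (\<And>k t. (s, t) \<notin> E k) \<Longrightarrow> s = top"
    and x_pos: "(s, t) \<in> E k \<Longrightarrow> 0 < x s t"
    and x_crossing: "k \<in> {1..<n} \<Longrightarrow> s \<in> P \<Longrightarrow>
      (\<Sum>r | (r, s) \<in> E k. x r s) - (\<Sum>t | (s, t) \<in> E k. x s t) = of_int (vertex_value E k s)"
    and x_diamond: "\<lbrakk>s \<noteq> t; (s, u) \<in> E j; (t, u) \<in> E i; (r, s) \<in> E i; (r, t) \<in> E j\<rbrakk> \<Longrightarrow>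
      x s u * x t u = x r s * x r t"
    and weight_structure: "\<lbrakk>i \<in> {1..<n}; j \<in> {1..<n}; (s, t) \<in> E i\<rbrakk> \<Longrightarrow>
      vertex_value E j t = vertex_value E j s + cartan j i"
begin

lemma finite_P: "finite P"
  using poset by (simp add: colored_ranked_poset_def)

lemma edges_subset: "E k \<subseteq> P \<times> P"
  using poset by (cases "k \<in> {1..<n}") (auto simp: colored_ranked_poset_def)

lemma edge_color: "(s, t) \<in> E k \<Longrightarrow> k \<in> {1..<n}"
  using poset unfolding colored_ranked_poset_def by blast

lemma edge_color_unique: "(s, t) \<in> E k \<Longrightarrow> (s, t) \<in> E j \<Longrightarrow> j = k"
  using poset edge_color unfolding colored_ranked_poset_def by blast

lemma edge_in: "(s, t) \<in> E k \<Longrightarrow> s \<in> P" "(s, t) \<in> E k \<Longrightarrow> t \<in> P"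
  using edges_subset by blast+

lemmas finite_edges = finite_neighbours[OF finite_P edges_subset]

definition rank :: "'a \<Rightarrow> nat" where
  "rank = (SOME f. is_rank_function P (\<Union>i\<in>{1..<n}. E i) f)"

lemma rank_edge:
  assumes "(s, t) \<in> E k"
  shows "rank t = Suc (rank s)"
proof -
  have "\<exists>f. is_rank_function P (\<Union>i\<in>{1..<n}. E i) f"
    using poset unfolding colored_ranked_poset_def by blast
  then have "is_rank_function P (\<Union>i\<in>{1..<n}. E i) rank" unfolding rank_def by (rule someI_ex)
  then show ?thesis using assms edge_color[OF assms] edge_in[OF assms]
    unfolding is_rank_function_def by blast
qed

lemma diamond_down:
  assumes "s \<noteq> t" "(s, u) \<in> E j" "(t, u) \<in> E i"
  obtains r where "(r, s) \<in> E i" "(r, t) \<in> E j"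
proof -
  have "{u. (s, u) \<in> E j \<and> (t, u) \<in> E i} \<noteq> {}" using assms by blast
  then show thesis
    using diamond[of i j s t] assms edge_color edge_in that by blast
qed

lemma diamond_up:
  assumes "s \<noteq> t" "(r, s) \<in> E i" "(r, t) \<in> E j"
  obtains u where "(s, u) \<in> E j" "(t, u) \<in> E i"
proof -
  have "{r. (r, s) \<in> E i \<and> (r, t) \<in> E j} \<noteq> {}" using assms by blast
  then show thesis
    using diamond[of i j s t] assms edge_color edge_in that by blast
qed

lemma diamond_unique:
  assumes "s \<noteq> t" "(s, u) \<in> E j" "(t, u) \<in> E i" "(r, s) \<in> E i" "(r, t) \<in> E j"
  shows "{u. (s, u) \<in> E j \<and> (t, u) \<in> E i} = {u}" "{r. (r, s) \<in> E i \<and> (r, t) \<in> E j} = {r}"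
proof -
  have u: "u \<in> {u. (s, u) \<in> E j \<and> (t, u) \<in> E i}" and r: "r \<in> {r. (r, s) \<in> E i \<and> (r, t) \<in> E j}"
    using assms by auto
  have "(\<exists>u r. {u. (s, u) \<in> E j \<and> (t, u) \<in> E i} = {u} \<and> {r. (r, s) \<in> E i \<and> (r, t) \<in> E j} = {r})"
    using diamond[OF edge_color[OF assms(3)] edge_color[OF assms(2)] edge_in(1)[OF assms(2)]
        edge_in(1)[OF assms(3)] assms(1)]
  proof (elim disjE conjE)
    assume "{u. (s, u) \<in> E j \<and> (t, u) \<in> E i} = {}"
    then have False using u by (simp only: empty_iff)
    then show ?thesis ..
  qed
  then show "{u. (s, u) \<in> E j \<and> (t, u) \<in> E i} = {u}" "{r. (r, s) \<in> E i \<and> (r, t) \<in> E j} = {r}"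
    using u r by (elim exE conjE, simp only: singleton_iff)+
qed

text \<open>An edge into \<open>u\<close> shares a diamond with any edge of smaller colour into \<open>u\<close>. By
  \<open>upper_unique\<close> at most one edge of a given colour leaving \<open>s\<close> has no such partner, and that
  one is determined by the crossing condition.\<close>

lemma edge_products_unique:
  fixes y :: "'a \<Rightarrow> 'a \<Rightarrow> complex"
  assumes crossing: "\<And>k s. k \<in> {1..<n} \<Longrightarrow> s \<in> P \<Longrightarrow>
      (\<Sum>r | (r, s) \<in> E k. y r s) - (\<Sum>t | (s, t) \<in> E k. y s t) = of_int (vertex_value E k s)"
    and diamonds: "\<And>r s t u i j. \<lbrakk>s \<noteq> t; (s, u) \<in> E j; (t, u) \<in> E i; (r, s) \<in> E i; (r, t) \<in> E j\<rbrakk> \<Longrightarrow>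
      y s u * y t u = y r s * y r t"
    and edge: "(s, u) \<in> E k"
  shows "y s u = of_real (x s u)"
proof -
  have "\<forall>k s u. rank s = m \<longrightarrow> (s, u) \<in> E k \<longrightarrow> y s u = of_real (x s u)" for m
  proof (induction m rule: less_induct)
    case (less m)
    have lower: "y r s = of_real (x r s)" if "(r, s) \<in> E k" "rank s \<le> m" for r s k
      using less that rank_edge[OF that(1)] by (metis less_eq_Suc_le)
    have "\<forall>s u. rank s = m \<longrightarrow> (s, u) \<in> E k \<longrightarrow> y s u = of_real (x s u)" for k
    proof (induction k rule: less_induct)
      case (less k)
      have partner: "y s u = of_real (x s u)"
        if s: "rank s = m" and su: "(s, u) \<in> E k" and j: "j < k" and tu: "(t, u) \<in> E j" for s u t j
      proof -
        have neq: "s \<noteq> t" using edge_color_unique su tu j by blast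
        obtain r where r: "(r, s) \<in> E j" "(r, t) \<in> E k"
          by (rule diamond_down[OF neq su tu])
        have rt: "rank t = m" using rank_edge[OF su] rank_edge[OF tu] s by simp
        \<comment> \<open>Three sides of the diamond are known, \<open>(t, u)\<close> by its smaller
          colour and the two lower ones by rank. Since \<open>x t u\<close> is nonzero, the fourth
          follows.\<close>
        have "y t u = of_real (x t u)" using less j rt tu by blast
        then have "y s u * of_real (x t u) = y s u * y t u" by simp
        also have "\<dots> = y r s * y r t" by (rule diamonds[OF neq su tu r])
        also have "\<dots> = of_real (x r s * x r t)" using lower[OF r(1)] lower[OF r(2)] s rt by simp
        also have "\<dots> = of_real (x s u) * of_real (x t u)"
          using x_diamond[OF neq su tu r] by (simp flip: of_real_mult)
        finally show ?thesis using x_pos[OF tu] by simp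
      qed
      show ?case
      proof (intro allI impI)
        fix s u assume s: "rank s = m" and su: "(s, u) \<in> E k"
        show "y s u = of_real (x s u)"
        proof (cases "\<exists>j t. j < k \<and> (t, u) \<in> E j")
          case True
          then show ?thesis using partner s su by blast
        next
          case False
          have others: "y s t = of_real (x s t)" if t: "t \<in> {t. (s, t) \<in> E k} - {u}" for t
          proof -
            have "\<exists>j r. j < k \<and> (r, t) \<in> E j"
            proof (rule ccontr)
              assume no: "\<nexists>j r. j < k \<and> (r, t) \<in> E j"
              have "t = u" by (rule upper_unique[of s t k u]) (use False no t su in auto)
              then show False using t by simp
            qed
            then show ?thesis using partner s t by blast
          qed
          have k: "k \<in> {1..<n}" and sP: "s \<in> P" using su edge_color edge_in by auto
          \<comment> \<open>All edges into \<open>s\<close> are known by rank and all edges of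
            colour \<open>k\<close> out of \<open>s\<close> except \<open>(s, u)\<close> by their
            partners, so one unknown remains in the crossing condition.\<close>
          have "(\<Sum>r | (r, s) \<in> E k. y r s) = of_real (\<Sum>r | (r, s) \<in> E k. x r s)"
            using lower s by simp
          moreover have "of_real (\<Sum>r | (r, s) \<in> E k. x r s) - of_real (\<Sum>t | (s, t) \<in> E k. x s t) =
              (of_int (vertex_value E k s) :: complex)"
            using arg_cong[OF x_crossing[OF k sP], of complex_of_real]
            by (simp only: of_real_diff of_real_of_int_eq)
          ultimately have "(\<Sum>t | (s, t) \<in> E k. y s t) = of_real (\<Sum>t | (s, t) \<in> E k. x s t)"
            using crossing[OF k sP] by (simp add: algebra_simps)
          moreover have "u \<in> {t. (s, t) \<in> E k}" using su by simp
          ultimately show ?thesis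
            using others sum.remove[OF finite_edges(2), of u s k "y s"]
              sum.remove[OF finite_edges(2), of u s k "\<lambda>t. complex_of_real (x s t)"] by simp
        qed
      qed
    qed
    then show ?case by blast
  qed
  then show ?thesis using edge by blast
qed

lemma labels_diamond:
  assumes br: "bracket_condition {1..<n} P E c d m"
    and st: "s \<noteq> t" and e: "(s, u) \<in> E j" "(t, u) \<in> E i" "(r, s) \<in> E i" "(r, t) \<in> E j"
  shows "c t r * d r s = d t u * c u s"
proof -
  have "{r. (r, t) \<in> E j \<and> (r, s) \<in> E i} = {r}" "{u. (t, u) \<in> E i \<and> (s, u) \<in> E j} = {u}"
    using diamond_unique[OF st e] by blast+
  then show ?thesis
    using bracket_conditionD[OF br, of j i s t] e edge_color edge_in st by auto
qed

lemma edge_products_of_labels: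
  assumes "bracket_condition {1..<n} P E c d (vertex_value E)" and "(s, u) \<in> E k"
  shows "edge_product c d s u = of_real (x s u)"
proof (rule edge_products_unique[OF _ _ assms(2)])
  fix k s assume "k \<in> {1..<n}" "s \<in> P"
  then show "(\<Sum>r | (r, s) \<in> E k. edge_product c d r s) - (\<Sum>t | (s, t) \<in> E k. edge_product c d s t) =
      of_int (vertex_value E k s)"
    by (rule bracket_condition_crossing[OF assms(1)])
next
  fix r s t u i j
  assume st: "s \<noteq> t" and e: "(s, u) \<in> E j" "(t, u) \<in> E i" "(r, s) \<in> E i" "(r, t) \<in> E j"
  have "c t r * d r s = d t u * c u s" "c s r * d r t = d s u * c u t"
    using labels_diamond[OF assms(1) st e] labels_diamond[OF assms(1) not_sym[OF st] e(2,1,4,3)] by auto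
  then show "edge_product c d s u * edge_product c d t u = edge_product c d r s * edge_product c d r t"
    unfolding edge_product_def by (metis (no_types, lifting) mult.commute mult.left_commute)
qed

text \<open>The coefficients of a vector killed by all \<open>X\<^sub>k\<close> vanish outside \<open>top\<close>: by induction on the
  colour, its support avoids sources of edges of smaller colour, and then \<open>lower_unique\<close> leaves a
  single summand in each coefficient of the image under \<open>X\<^sub>k\<close>.\<close>

lemma primitive_supported_at_top:
  assumes c: "\<And>k s t. (s, t) \<in> E k \<Longrightarrow> c t s \<noteq> 0"
    and prim: "\<And>k t. k \<in> {1..<n} \<Longrightarrow> act_X E c k f t = 0"
    and f: "\<And>s. s \<notin> P \<Longrightarrow> f s = 0" and s: "s \<noteq> top"
  shows "f s = 0"
proof (rule ccontr)
  assume fs: "f s \<noteq> 0"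
  have "\<forall>s t. f s \<noteq> 0 \<longrightarrow> (s, t) \<notin> E k" for k
  proof (induction k rule: less_induct)
    case (less k)
    show ?case
    proof (intro allI impI notI)
      fix s t assume fs: "f s \<noteq> 0" and st: "(s, t) \<in> E k"
      have "f s' = 0" if "s' \<in> {s'. (s', t) \<in> E k} - {s}" for s'
      proof (rule ccontr)
        assume fs': "f s' \<noteq> 0"
        have "s' = s" by (rule lower_unique[of s' t k s]) (use that st less fs fs' in auto)
        then show False using that by simp
      qed
      then have "act_X E c k f t = c t s * f s"
        using sum.remove[OF finite_edges(1), of s t k "\<lambda>s. c t s * f s"] st by (simp add: act_X_def)
      then show False using prim[OF edge_color[OF st]] c[OF st] fs by simp
    qed
  qed
  then have "s = top" using top_unique[of s] f fs by blast
  then show False using s by simp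
qed

text \<open>Each \<open>act_X\<close> raises the rank of the support, so applying them to a nonzero
  member of \<open>K\<close> must end at a nonzero function killed by all of them, and that is a
  multiple of \<open>point top\<close>.\<close>

lemma point_top_in_X_invariant:
  assumes c: "\<And>k s t. (s, t) \<in> E k \<Longrightarrow> c t s \<noteq> 0"
    and X: "\<And>k f. k \<in> {1..<n} \<Longrightarrow> f \<in> K \<Longrightarrow> act_X E c k f \<in> K"
    and scale: "\<And>a f. f \<in> K \<Longrightarrow> (\<lambda>s. a * f s) \<in> K"
    and supp: "\<And>f s. f \<in> K \<Longrightarrow> s \<notin> P \<Longrightarrow> f s = 0"
    and f: "f \<in> K" "f s \<noteq> 0"
  shows "point top \<in> K"
proof -
  define R where "R = Suc (Max (rank ` P))"
  have R: "rank s < R" if "s \<in> P" for s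
    using finite_P that by (simp add: R_def le_imp_less_Suc)
  \<comment> \<open>\<open>R\<close> exceeds all ranks, so \<open>m = 0\<close> admits no nonzero
    function, while \<open>m = R\<close> admits every function.\<close>
  have "\<forall>f\<in>K. (\<exists>s. f s \<noteq> 0) \<longrightarrow> (\<forall>s. f s \<noteq> 0 \<longrightarrow> R \<le> rank s + m) \<longrightarrow> point top \<in> K" for m
  proof (induction m)
    case 0
    then show ?case using R supp by (metis add.right_neutral linorder_not_less)
  next
    case (Suc m)
    show ?case
    proof (intro ballI impI)
      fix f assume f: "f \<in> K" and ex: "\<exists>s. f s \<noteq> 0" and rk: "\<forall>s. f s \<noteq> 0 \<longrightarrow> R \<le> rank s + Suc m"
      show "point top \<in> K"
      proof (cases "\<exists>k\<in>{1..<n}. \<exists>t. act_X E c k f t \<noteq> 0")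
        case True
        then obtain k where k: "k \<in> {1..<n}" "\<exists>t. act_X E c k f t \<noteq> 0" by blast
        have "R \<le> rank t + m" if "act_X E c k f t \<noteq> 0" for t
        proof -
          have "\<exists>s. (s, t) \<in> E k \<and> f s \<noteq> 0"
            using that unfolding act_X_def by (metis (mono_tags, lifting) mem_Collect_eq mult_zero_right sum.neutral)
          then show ?thesis using rk rank_edge by fastforce
        qed
        then show ?thesis using Suc X[OF k(1) f] k(2) by blast
      next
        case False
        have zero: "f s = 0" if "s \<noteq> top" for s
          by (rule primitive_supported_at_top[of c]) (use c False supp[OF f] that in auto)
        then have "f top \<noteq> 0" using ex by metis
        then have "(\<lambda>s. (1 / f top) * f s) = point top" using zero by (auto simp: point_def)
        then show ?thesis using scale[OF f, of "1 / f top"] by simp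
      qed
    qed
  qed
  then have "(\<forall>s. f s \<noteq> 0 \<longrightarrow> R \<le> rank s + R) \<longrightarrow> point top \<in> K" using f by blast
  then show ?thesis by simp
qed

text \<open>The function \<open>a\<close> is built from the highest rank downwards, at
  \<open>s\<close> through an arbitrary edge out of \<open>s\<close>. Any other edge out of
  \<open>s\<close> gives the same value: the two close up to a diamond, and \<open>path\<close>
  compares its two sides.\<close>

lemma gauge_exists:
  fixes \<rho> :: "'a \<Rightarrow> 'a \<Rightarrow> complex"
  assumes nz: "\<And>k s t. (s, t) \<in> E k \<Longrightarrow> \<rho> s t \<noteq> 0"
    and path: "\<And>r s t u i j. \<lbrakk>s \<noteq> t; (s, u) \<in> E j; (t, u) \<in> E i; (r, s) \<in> E i; (r, t) \<in> E j\<rbrakk> \<Longrightarrow>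
      \<rho> r s * \<rho> s u = \<rho> r t * \<rho> t u"
  obtains a where "\<And>s. a s \<noteq> 0" "\<And>k s t. (s, t) \<in> E k \<Longrightarrow> a s = \<rho> s t * a t"
proof -
  define R where "R = Max (rank ` P)"
  have R: "rank s \<le> R" if "s \<in> P" for s using finite_P that by (simp add: R_def)
  have "\<exists>a. (\<forall>s. a s \<noteq> 0) \<and> (\<forall>k s t. (s, t) \<in> E k \<longrightarrow> R \<le> rank s + m \<longrightarrow> a s = \<rho> s t * a t)" for m
  proof (induction m)
    case 0
    have "\<not> R \<le> rank s" if "(s, t) \<in> E k" for s t k
      using R[OF edge_in(2)[OF that]] rank_edge[OF that] by simp
    then show ?case by (intro exI[of _ "\<lambda>_. 1"]) simp
  next
    case (Suc m)
    then obtain a where a: "\<And>s. a s \<noteq> 0"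
      and a_edge: "\<And>k s t. (s, t) \<in> E k \<Longrightarrow> R \<le> rank s + m \<Longrightarrow> a s = \<rho> s t * a t" by blast
    define up where "up = (\<lambda>s. SOME t. \<exists>k. (s, t) \<in> E k)"
    define b where "b = (\<lambda>s. if rank s + Suc m = R \<and> (\<exists>k t. (s, t) \<in> E k) then \<rho> s (up s) * a (up s) else a s)"
    have up: "\<exists>k. (s, up s) \<in> E k" if "(s, t) \<in> E k" for s t k
      unfolding up_def by (rule someI_ex) (use that in blast)
    have "b s \<noteq> 0" for s
    proof (cases "\<exists>k t. (s, t) \<in> E k")
      case True
      then obtain k where "(s, up s) \<in> E k" using up by blast
      then show ?thesis using a nz by (simp add: b_def)
    qed (use a in \<open>simp add: b_def\<close>)
    moreover have "b s = \<rho> s t * b t" if st: "(s, t) \<in> E k" and rk: "R \<le> rank s + Suc m" for s t k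
    proof -
      have bt: "b t = a t" using rk rank_edge[OF st] by (simp add: b_def)
      show ?thesis
      proof (cases "R \<le> rank s + m")
        case True
        then show ?thesis using a_edge[OF st True] bt by (simp add: b_def)
      next
        case False
        then have bs: "b s = \<rho> s (up s) * a (up s)" using rk st by (auto simp: b_def)
        obtain l where l: "(s, up s) \<in> E l" using up[OF st] by blast
        show ?thesis
        proof (cases "up s = t")
          case True
          then show ?thesis using bs bt by simp
        next
          case neq: False
          obtain u where u: "(up s, u) \<in> E k" "(t, u) \<in> E l" by (rule diamond_up[OF neq l st])
          have "a (up s) = \<rho> (up s) u * a u" "a t = \<rho> t u * a u"
            by (rule a_edge[OF u(1)] a_edge[OF u(2)], use rank_edge[OF l] rank_edge[OF st] rk in simp)+
          then show ?thesis using bs bt path[OF neq u l st] by (simp flip: mult.assoc)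
        qed
      qed
    qed
    ultimately show ?case by blast
  qed
  from this[of R] show thesis using that by auto
qed

end

section \<open>Existence of the weight basis\<close>

text \<open>Finite-dimensional duality: a proper subspace has a nonzero annihilator. The induction
  splits off a point \<open>a\<close> by means of a member of \<open>M\<close> with value 1
  there.\<close>

lemma function_in_subspace_if_annihilator_trivial:
  fixes M :: "('a \<Rightarrow> complex) set"
  assumes "finite P"
    and "\<And>f g. f \<in> M \<Longrightarrow> g \<in> M \<Longrightarrow> (\<lambda>s. f s + g s) \<in> M" "\<And>a f. f \<in> M \<Longrightarrow> (\<lambda>s. a * f s) \<in> M"
    and "(\<lambda>s. 0) \<in> M" "\<And>f s. f \<in> M \<Longrightarrow> s \<notin> P \<Longrightarrow> f s = 0"
    and "\<And>z. (\<And>s. s \<notin> P \<Longrightarrow> z s = 0) \<Longrightarrow> (\<And>f. f \<in> M \<Longrightarrow> (\<Sum>s\<in>P. z s * f s) = 0) \<Longrightarrow> z = (\<lambda>s. 0)"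
    and "\<And>s. s \<notin> P \<Longrightarrow> f s = 0"
  shows "f \<in> M"
  using assms
proof (induction P arbitrary: M f rule: finite_induct)
  case empty
  have "f s = 0" for s by (rule empty.prems(6)) simp
  then have "f = (\<lambda>s. 0)" by (rule ext)
  then show ?case using empty.prems(3) by simp
next
  case (insert a P)
  note add = insert.prems(1) and scale = insert.prems(2) and supp = insert.prems(4)
    and ann = insert.prems(5)
  have "\<exists>h\<in>M. h a \<noteq> 0"
  proof (rule ccontr)
    assume no: "\<not> (\<exists>h\<in>M. h a \<noteq> 0)"
    have "(\<lambda>s. if s = a then 1 else 0) = (\<lambda>s. 0 :: complex)"
    proof (rule ann)
      fix f assume "f \<in> M"
      then have "f a = 0" using no by blast
      then show "(\<Sum>s\<in>insert a P. (if s = a then 1 else 0) * f s) = 0"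
        by (intro sum.neutral) auto
    qed auto
    from fun_cong[OF this, of a] show False by simp
  qed
  then obtain h0 where h0: "h0 \<in> M" "h0 a \<noteq> 0" by blast
  define h where "h = (\<lambda>s. (1 / h0 a) * h0 s)"
  have h: "h \<in> M" "h a = 1" using scale[OF h0(1), of "1 / h0 a"] h0(2) by (simp_all add: h_def)
  have reduce: "(\<lambda>s. g s + (- g a) * h s) \<in> {f \<in> M. f a = 0}" if "g \<in> M" for g
    using add[OF that scale[OF h(1), of "- g a"]] h(2) by simp
  have all: "g \<in> {f \<in> M. f a = 0}" if g: "\<And>s. s \<notin> P \<Longrightarrow> g s = 0" for g
  proof (rule insert.IH)
    fix z assume z: "\<And>s. s \<notin> P \<Longrightarrow> z s = 0"
      and orth: "\<And>f. f \<in> {f \<in> M. f a = 0} \<Longrightarrow> (\<Sum>s\<in>P. z s * f s) = 0"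
    \<comment> \<open>The value at \<open>a\<close> is chosen so that \<open>z'\<close> annihilates
      \<open>h\<close>, and with it all of \<open>M\<close>.\<close>
    define z' where "z' = (\<lambda>s. if s = a then - (\<Sum>s\<in>P. z s * h s) else z s)"
    have "z' = (\<lambda>s. 0)"
    proof (rule ann)
      fix s assume "s \<notin> insert a P"
      then show "z' s = 0" using z by (simp add: z'_def)
    next
      fix f assume f: "f \<in> M"
      have "0 = (\<Sum>s\<in>P. z s * (f s + (- f a) * h s))" using orth[OF reduce[OF f]] by simp
      also have "\<dots> = (\<Sum>s\<in>P. z s * f s) - f a * (\<Sum>s\<in>P. z s * h s)"
        by (simp add: sum_subtractf sum_distrib_left algebra_simps)
      also have "\<dots> = (\<Sum>s\<in>insert a P. z' s * f s)"
      proof -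
        have "(\<Sum>s\<in>P. z' s * f s) = (\<Sum>s\<in>P. z s * f s)"
          using insert.hyps by (intro sum.cong) (auto simp: z'_def)
        then show ?thesis using insert.hyps by (simp add: z'_def)
      qed
      finally show "(\<Sum>s\<in>insert a P. z' s * f s) = 0" by simp
    qed
    then have "z s = 0" if "s \<noteq> a" for s using that by (metis z'_def)
    then show "z = (\<lambda>s. 0)" using z insert.hyps(2) by (intro ext) metis
  next
    fix f s assume "f \<in> {f \<in> M. f a = 0}" "s \<notin> P"
    then show "f s = 0" using supp[of f s] by (cases "s = a") auto
  qed (use add scale insert.prems(3) g in auto)
  have "(\<lambda>s. f s + (- f a) * h s) \<in> {f \<in> M. f a = 0}"
  proof (rule all)
    fix s assume "s \<notin> P"
    then show "f s + (- f a) * h s = 0"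
      using insert.prems(6)[of s] supp[OF h(1), of s] h(2) by (cases "s = a") auto
  qed
  then have "(\<lambda>s. f s + (- f a) * h s) \<in> M" by simp
  from add[OF this scale[OF h(1), of "f a"]] show ?case by simp
qed

text \<open>The numbers \<open>k * (n - k) / 2\<close> are the coefficients of half the sum of the
  positive coroots in the simple coroots. The second difference of \<open>k * (n - k)\<close> is -2,
  and its zeros at 0 and \<open>n\<close> let the sum be extended to the boundary.\<close>

lemma sum_cartan:
  assumes "j \<in> {1..<n}"
  shows "(\<Sum>k\<in>{1..<n}. of_nat (k * (n - k)) / 2 * of_int (cartan k j)) = (1 :: complex)"
proof -
  define g where "g = (\<lambda>k. int k * (int n - int k))"
  have "(\<Sum>k\<in>{1..<n}. int (k * (n - k)) * cartan k j) = (\<Sum>k\<in>{0..n}. g k * cartan k j)"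
    by (rule sum.mono_neutral_cong_left) (auto simp: g_def of_nat_diff)
  also have "\<dots> = (\<Sum>k\<in>{0..n}. (if k = j then 2 * g j else 0) - (if k = Suc j then g (Suc j) else 0) -
      (if k = j - 1 then g (j - 1) else 0))"
    using assms by (intro sum.cong) (auto simp: cartan_def)
  also have "\<dots> = 2 * g j - g (Suc j) - g (j - 1)"
    using assms by (auto simp: sum_subtractf)
  also have "\<dots> = 2"
    using assms by (auto simp: g_def of_nat_diff algebra_simps)
  finally have *: "(\<Sum>k\<in>{1..<n}. int (k * (n - k)) * cartan k j) = 2" .
  have "(\<Sum>k\<in>{1..<n}. of_nat (k * (n - k)) / 2 * of_int (cartan k j)) =
      of_int (\<Sum>k\<in>{1..<n}. int (k * (n - k)) * cartan k j) / (2 :: complex)"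
    by (simp add: sum_divide_distrib)
  then show ?thesis unfolding * by simp
qed

context sl_irrep
begin

text \<open>A combination involves finitely many eigenvectors, so some polynomial in
  \<open>D\<close> kills all of them, but it acts on \<open>v\<close> as a nonzero scalar.\<close>

lemma eigenvector_not_in_span_lower:
  assumes D: "module_hom scale scale D" and v: "D v = scale \<mu> v" "v \<noteq> 0"
  shows "v \<notin> span {u. \<exists>m\<ge>1. D u = scale (\<mu> - of_nat m) u}"
proof
  interpret D: module_hom scale scale D by (rule D)
  assume "v \<in> span {u. \<exists>m\<ge>1. D u = scale (\<mu> - of_nat m) u}"
  then obtain F a where F: "finite F" "F \<subseteq> {u. \<exists>m\<ge>1. D u = scale (\<mu> - of_nat m) u}"
    and sum: "v = (\<Sum>u\<in>F. scale (a u) u)"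
    unfolding span_explicit by blast
  have "\<forall>u\<in>F. \<exists>m\<ge>1. D u = scale (\<mu> - of_nat m) u" using F(2) by blast
  then obtain m where "\<forall>u\<in>F. 1 \<le> m u \<and> D u = scale (\<mu> - of_nat (m u)) u"
    using bchoice[of F "\<lambda>u m. 1 \<le> m \<and> D u = scale (\<mu> - of_nat m) u"] by blast
  then have m: "1 \<le> m u \<and> D u = scale (\<mu> - of_nat (m u)) u" if "u \<in> F" for u using that by blast
  \<comment> \<open>\<open>q N\<close> is the product of \<open>D - (\<mu> - j)\<close> over
    \<open>j\<close> from 1 to \<open>N\<close>.\<close>
  define q where "q = (\<lambda>N w. rec_nat w (\<lambda>j w'. D w' - scale (\<mu> - of_nat (Suc j)) w') N)"
  have q0: "q 0 w = w" and qS: "q (Suc N) w = D (q N w) - scale (\<mu> - of_nat (Suc N)) (q N w)" for N w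
    by (simp_all add: q_def)
  have q_add: "q N (w + w') = q N w + q N w'" for N w w'
    by (induction N) (simp_all add: q0 qS D.add scale_right_distrib)
  have q_scale: "q N (scale b w) = scale b (q N w)" for N b w
    by (induction N) (simp_all add: q0 qS D.scale scale_right_diff_distrib mult.commute)
  have q_zero: "q N 0 = 0" for N
    by (induction N) (simp_all add: q0 qS)
  have q_sum: "q N (\<Sum>u\<in>F. h u) = (\<Sum>u\<in>F. q N (h u))" if "finite F" for N F h
    using that by (induction F rule: finite_induct) (simp_all add: q_zero q_add)
  have q_eigen: "q N u = scale (\<Prod>j<N. e - (\<mu> - of_nat (Suc j))) u" if "D u = scale e u" for N u e
    by (induction N) (simp_all add: q0 qS D.scale that scale_left_diff_distrib[symmetric] algebra_simps)
  define N where "N = Max (insert 0 (m ` F))"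
  have "q N u = 0" if "u \<in> F" for u
  proof -
    have "m u \<le> N" using F(1) that by (simp add: N_def)
    then have "\<exists>j\<in>{..<N}. \<mu> - of_nat (m u) - (\<mu> - of_nat (Suc j)) = 0"
      using m[OF that] by (intro bexI[of _ "m u - 1"]) auto
    then have "(\<Prod>j<N. \<mu> - of_nat (m u) - (\<mu> - of_nat (Suc j))) = 0" by (intro prod_zero) auto
    then show ?thesis using q_eigen[of u "\<mu> - of_nat (m u)" N] m[OF that] by simp
  qed
  then have "q N v = 0" unfolding sum q_sum[OF F(1)] q_scale by simp
  moreover have "(\<Prod>j<N. \<mu> - (\<mu> - of_nat (Suc j))) \<noteq> 0"
    unfolding prod_zero_iff[OF finite_lessThan] by (simp add: add.commute[of 1])
      (metis of_nat_Suc of_nat_neq_0 add.commute)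
  ultimately show False using q_eigen[OF v(1), of N] v(2) by simp
qed

end

text \<open>The submodule of \<open>V \<oplus> \<complex>\<^sup>P\<close> generated by a pair of highest weight vectors.\<close>

inductive cyclic_pair :: "(complex \<Rightarrow> 'v \<Rightarrow> 'v::ab_group_add) \<Rightarrow> (nat \<Rightarrow> 'v \<Rightarrow> 'v) \<Rightarrow>
    (nat \<Rightarrow> ('a \<Rightarrow> complex) \<Rightarrow> 'a \<Rightarrow> complex) \<Rightarrow> nat set \<Rightarrow> 'v \<Rightarrow> ('a \<Rightarrow> complex) \<Rightarrow>
    'v \<Rightarrow> ('a \<Rightarrow> complex) \<Rightarrow> bool"
  for scale Yv Yf I v0 f0 where
  start: "cyclic_pair scale Yv Yf I v0 f0 v0 f0"
| step: "cyclic_pair scale Yv Yf I v0 f0 v f \<Longrightarrow> k \<in> I \<Longrightarrow> cyclic_pair scale Yv Yf I v0 f0 (Yv k v) (Yf k f)"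
| add: "cyclic_pair scale Yv Yf I v0 f0 v f \<Longrightarrow> cyclic_pair scale Yv Yf I v0 f0 w g \<Longrightarrow>
    cyclic_pair scale Yv Yf I v0 f0 (v + w) (\<lambda>s. f s + g s)"
| smult: "cyclic_pair scale Yv Yf I v0 f0 v f \<Longrightarrow> cyclic_pair scale Yv Yf I v0 f0 (scale a v) (\<lambda>s. a * f s)"

lemma act_add:
  "act_X E c k (\<lambda>s. f s + g s) = (\<lambda>t. act_X E c k f t + act_X E c k g t)"
  "act_Y E d k (\<lambda>s. f s + g s) = (\<lambda>t. act_Y E d k f t + act_Y E d k g t)"
  by (auto simp: act_X_def act_Y_def distrib_left sum.distrib)

lemma act_smult:
  "act_X E c k (\<lambda>s. a * f s) = (\<lambda>t. a * act_X E c k f t)"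
  "act_Y E d k (\<lambda>s. a * f s) = (\<lambda>t. a * act_Y E d k f t)"
  by (auto simp: act_X_def act_Y_def sum_distrib_left mult.left_commute)

lemma act_zero: "act_X E c k (\<lambda>s. 0) = (\<lambda>t. 0)" "act_Y E d k (\<lambda>s. 0) = (\<lambda>t. 0)"
  by (auto simp: act_X_def act_Y_def)

locale diamond_graph_module = sl_irrep n scale \<phi> + diamond_graph n P E top x
  for n :: nat and scale :: "complex \<Rightarrow> 'v \<Rightarrow> 'v::ab_group_add" and \<phi> :: "complex mat \<Rightarrow> 'v \<Rightarrow> 'v"
    and P :: "'a set" and E :: "nat \<Rightarrow> ('a \<times> 'a) set" and top :: 'a and x :: "'a \<Rightarrow> 'a \<Rightarrow> real" +
  fixes v0 :: 'v
  assumes v0_nonzero: "v0 \<noteq> 0"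
    and X_v0: "k \<in> {1..<n} \<Longrightarrow> X k v0 = 0"
    and H_v0: "k \<in> {1..<n} \<Longrightarrow> H k v0 = scale (of_int (vertex_value E k top)) v0"
begin

text \<open>With both labels of an edge equal, \<open>XX k\<close> and \<open>YY k\<close> are
  transposes for the pairing \<open>\<Sum>s\<in>P. f s * g s\<close>; \<open>related_exists\<close>
  relies on this.\<close>

definition label :: "'a \<Rightarrow> 'a \<Rightarrow> complex" where
  "label s t = of_real (sqrt (x s t))"

abbreviation XX where "XX \<equiv> act_X E (\<lambda>t s. label s t)"
abbreviation YY where "YY \<equiv> act_Y E label"
abbreviation m where "m \<equiv> vertex_value E"

lemma label_nonzero: "(s, t) \<in> E k \<Longrightarrow> label s t \<noteq> 0"
  using x_pos by (force simp: label_def)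

text \<open>For distinct vertices this is the square root of \<open>x_diamond\<close>, and on the
  diagonal it is \<open>x_crossing\<close>; for distinct colours on the diagonal both sums are
  empty, as an edge has one colour.\<close>

lemma label_bracket: "bracket_condition {1..<n} P E (\<lambda>t s. label s t) label m"
  unfolding bracket_condition_def
proof (intro ballI)
  fix i j s t assume ij: "i \<in> {1..<n}" "j \<in> {1..<n}" and st: "s \<in> P" "t \<in> P"
  let ?R = "{r. (r, t) \<in> E i \<and> (r, s) \<in> E j}" and ?U = "{u. (t, u) \<in> E j \<and> (s, u) \<in> E i}"
  consider "s \<noteq> t" | "s = t" "i \<noteq> j" | "s = t" "i = j" by blast
  then show "(\<Sum>r\<in>?R. label r t * label r s) - (\<Sum>u\<in>?U. label t u * label s u) =
      (if i = j \<and> s = t then of_int (m i s) else 0)"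
  proof cases
    case 1
    have sets: "?R = {r. (r, s) \<in> E j \<and> (r, t) \<in> E i}" "?U = {u. (s, u) \<in> E i \<and> (t, u) \<in> E j}" by auto
    from diamond[OF ij(2,1) st 1] show ?thesis
    proof (elim disjE exE conjE)
      fix u r assume U: "{u. (s, u) \<in> E i \<and> (t, u) \<in> E j} = {u}" and R: "{r. (r, s) \<in> E j \<and> (r, t) \<in> E i} = {r}"
      have "x s u * x t u = x r s * x r t"
        by (rule x_diamond[OF 1]) (use U R in blast)+
      then have "sqrt (x r t) * sqrt (x r s) = sqrt (x t u) * sqrt (x s u)"
        by (simp add: mult.commute flip: real_sqrt_mult)
      then have "label r t * label r s = label t u * label s u"
        unfolding label_def by (simp flip: of_real_mult)
      then show ?thesis unfolding sets U R using 1 by simp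
    next
      assume U: "{u. (s, u) \<in> E i \<and> (t, u) \<in> E j} = {}" and R: "{r. (r, s) \<in> E j \<and> (r, t) \<in> E i} = {}"
      show ?thesis unfolding sets U R using 1 by simp
    qed
  next
    case 2
    then have R: "?R = {}" and U: "?U = {}" using edge_color_unique by blast+
    show ?thesis unfolding R U using 2 by simp
  next
    case 3
    have sq: "label r u * label r u = of_real (x r u)" if "(r, u) \<in> E i" for r u
      using x_pos[OF that] unfolding label_def of_real_mult[symmetric] by simp
    have "?R = {r. (r, s) \<in> E i}" "?U = {u. (s, u) \<in> E i}" using 3 by auto
    then have "(\<Sum>r\<in>?R. label r t * label r s) - (\<Sum>u\<in>?U. label t u * label s u) =
        of_real ((\<Sum>r | (r, s) \<in> E i. x r s) - (\<Sum>u | (s, u) \<in> E i. x s u))"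
      using 3 sq by simp
    then show ?thesis unfolding x_crossing[OF ij(1) st(1)] using 3 by simp
  qed
qed

section \<open>The relation generated by the two highest weight vectors\<close>

abbreviation related :: "'v \<Rightarrow> ('a \<Rightarrow> complex) \<Rightarrow> bool" where
  "related \<equiv> cyclic_pair scale Y YY {1..<n} v0 (point top)"

lemma related_supp: "related v f \<Longrightarrow> s \<notin> P \<Longrightarrow> f s = 0"
proof (induction rule: cyclic_pair.induct)
  case (step v f k)
  have "{t. (s, t) \<in> E k} = {}" using step edge_in by blast
  then show ?case by (simp add: act_Y_def)
qed (use top_in in \<open>auto simp: point_def\<close>)

lemma related_zero: "related 0 (\<lambda>s. 0)"
  using cyclic_pair.smult[OF cyclic_pair.start, of scale Y YY "{1..<n}" v0 "point top" 0] by simp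

lemma related_diff:
  assumes "related v f" "related w g"
  shows "related (v - w) (\<lambda>s. f s - g s)"
  using cyclic_pair.add[OF assms(1) cyclic_pair.smult[OF assms(2), of "- 1"]] by simp

lemma related_H:
  assumes "related v f" and k: "k \<in> {1..<n}"
  shows "related (H k v) (\<lambda>s. of_int (m k s) * f s)"
  using assms(1)
proof (induction rule: cyclic_pair.induct)
  case start
  have "(\<lambda>s. of_int (m k s) * point top s) = (\<lambda>s. of_int (m k top) * point top s)"
    by (auto simp: point_def)
  then show ?case using cyclic_pair.smult[OF cyclic_pair.start] H_v0[OF k] by metis
next
  case (step v f j)
  have "(\<lambda>r. of_int (m k r) * YY j f r) =
      (\<lambda>r. YY j (\<lambda>s. of_int (m k s) * f s) r - of_int (cartan k j) * YY j f r)"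
  proof
    fix r
    have "of_int (m k r) * label r t * f t =
        label r t * (of_int (m k t) * f t) - of_int (cartan k j) * (label r t * f t)" if "(r, t) \<in> E j" for t
      using weight_structure[OF step(2) k that] by (simp add: algebra_simps)
    then show "of_int (m k r) * YY j f r =
        YY j (\<lambda>s. of_int (m k s) * f s) r - of_int (cartan k j) * YY j f r"
      by (simp add: act_Y_def sum_distrib_left sum_subtractf[symmetric] mult.assoc)
  qed
  then show ?case
    using related_diff[OF cyclic_pair.step[OF step(3,2)] cyclic_pair.smult[OF cyclic_pair.step[OF step(1,2)]],
        of "of_int (cartan k j)"] H_Y[OF step(2) k] by simp
next
  case (add v f w g)
  then show ?case using cyclic_pair.add[OF add(3,4)] module_hom.add[OF hom_gens(3)[OF k]]
    by (simp add: distrib_left)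
next
  case (smult v f a)
  then show ?case using cyclic_pair.smult[OF smult(2), of a] module_hom.scale[OF hom_gens(3)[OF k]]
    by (simp add: mult.left_commute)
qed

text \<open>The pairs are generated by \<open>Y\<close> alone. An \<open>X\<close> is moved past
  each \<open>Y\<close> at the cost of an \<open>H\<close> until it reaches the starting pair, which
  it kills.\<close>

lemma related_X:
  assumes "related v f" and k: "k \<in> {1..<n}"
  shows "related (X k v) (XX k f)"
  using assms(1)
proof (induction rule: cyclic_pair.induct)
  case start
  have "XX k (point top) = (\<lambda>s. 0)"
    using top_max finite_edges(1) by (auto simp: act_X_point)
  then show ?case using related_zero X_v0[OF k] by simp
next
  case (step v f j)
  have "XX k (YY j f) = (\<lambda>t. YY j (XX k f) t + (if k = j then of_int (m k t) * f t else 0))"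
    by (intro ext act_X_act_Y[OF finite_P edges_subset label_bracket k step(2)] related_supp[OF step(1)])
  moreover have "related (Y j (X k v) + (if k = j then H k v else 0))
      (\<lambda>t. YY j (XX k f) t + (if k = j then of_int (m k t) * f t else 0))"
    using cyclic_pair.add[OF cyclic_pair.step[OF step(3,2)] related_H[OF step(1) k]]
      cyclic_pair.step[OF step(3,2)] by (cases "k = j") simp_all
  ultimately show ?case by (simp only: X_Y[OF k step(2)])
next
  case (add v f w g)
  then show ?case using cyclic_pair.add[OF add(3,4)] module_hom.add[OF hom_gens(1)[OF k]]
    by (simp add: act_add)
next
  case (smult v f a)
  then show ?case using cyclic_pair.smult[OF smult(2), of a] module_hom.scale[OF hom_gens(1)[OF k]]
    by (simp add: act_smult)
qed

text \<open>The element \<open>\<rho>\<^sup>\<or>\<close> of the Cartan subalgebra, on which every simple root takes the value 1.\<close>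

definition grading :: "'v \<Rightarrow> 'v" where
  "grading u = (\<Sum>k\<in>{1..<n}. scale (of_nat (k * (n - k)) / 2) (H k u))"

lemma grading_hom: "module_hom scale scale grading"
  unfolding module_hom_iff
proof (intro conjI allI module_axioms)
  fix u w
  show "grading (u + w) = grading u + grading w"
    unfolding grading_def using module_hom.add[OF hom_gens(3)]
    by (simp add: scale_right_distrib sum.distrib)
next
  fix a u
  show "grading (scale a u) = scale a (grading u)"
    unfolding grading_def scale_sum_right using module_hom.scale[OF hom_gens(3)]
    by (intro sum.cong) (auto simp: mult.commute)
qed

lemma grading_Y:
  assumes j: "j \<in> {1..<n}"
  shows "grading (Y j u) = Y j (grading u) - Y j u"
proof -
  interpret Yj: module_hom scale scale "Y j" by (rule hom_gens(2)[OF j])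
  have "grading (Y j u) = (\<Sum>k\<in>{1..<n}. scale (of_nat (k * (n - k)) / 2) (Y j (H k u)) -
      scale (of_nat (k * (n - k)) / 2 * of_int (cartan k j)) (Y j u))"
    unfolding grading_def using H_Y[OF j] by (intro sum.cong) (auto simp: scale_right_diff_distrib)
  also have "\<dots> = Y j (grading u) - scale (\<Sum>k\<in>{1..<n}. of_nat (k * (n - k)) / 2 * of_int (cartan k j)) (Y j u)"
    by (simp only: sum_subtractf grading_def Yj.sum Yj.scale scale_sum_left)
  finally show ?thesis unfolding sum_cartan[OF j] by simp
qed

definition top_degree :: complex where
  "top_degree = (\<Sum>k\<in>{1..<n}. of_nat (k * (n - k)) / 2 * of_int (m k top))"

lemma grading_v0: "grading v0 = scale top_degree v0"
  unfolding grading_def top_degree_def scale_sum_left by (intro sum.cong) (auto simp: H_v0)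

definition lower :: "'v set" where
  "lower = {u. \<exists>m\<ge>1. grading u = scale (top_degree - of_nat m) u}"

lemma Y_span_lower:
  assumes k: "k \<in> {1..<n}" and u: "u \<in> span lower"
  shows "Y k u \<in> span lower"
proof -
  interpret Yk: module_hom scale scale "Y k" by (rule hom_gens(2)[OF k])
  have "Y k ` lower \<subseteq> lower"
  proof
    fix w assume "w \<in> Y k ` lower"
    then obtain u m where w: "w = Y k u" and m: "1 \<le> m" "grading u = scale (top_degree - of_nat m) u"
      by (auto simp: lower_def)
    have "grading w = scale (top_degree - of_nat (Suc m)) w"
      unfolding w grading_Y[OF k] m(2) Yk.scale by (simp add: algebra_simps)
    then show "w \<in> lower" unfolding lower_def using m(1) by (intro CollectI exI[of _ "Suc m"]) simp
  qed
  then have "span (Y k ` lower) \<subseteq> span lower" by (rule span_mono)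
  then show ?thesis using u Yk.span_image by blast
qed

lemma Y_v0_lower: "k \<in> {1..<n} \<Longrightarrow> Y k v0 \<in> lower"
  unfolding lower_def using grading_Y[of k v0] grading_v0 module_hom.scale[OF hom_gens(2), of k]
  by (auto intro!: exI[of _ 1] simp: scale_left_diff_distrib)

text \<open>\<open>Y\<close> lowers the degree on the left, and on the right its values at
  \<open>top\<close> are zero since no edge leaves \<open>top\<close>. So the coefficient of
  \<open>v0\<close> and the value at \<open>top\<close> always agree.\<close>

lemma related_leading_term: "related v f \<Longrightarrow> v - scale (f top) v0 \<in> span lower"
proof (induction rule: cyclic_pair.induct)
  case start
  then show ?case by (simp add: point_def span_zero)
next
  case (step v f k)
  interpret Yk: module_hom scale scale "Y k" by (rule hom_gens(2)[OF step(2)])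
  have "YY k f top = 0" using top_max by (simp add: act_Y_def)
  moreover have "Y k v = Y k (v - scale (f top) v0) + scale (f top) (Y k v0)"
    by (simp add: Yk.diff Yk.scale)
  moreover have "\<dots> \<in> span lower"
    by (rule span_add[OF Y_span_lower[OF step(2,3)] span_scale[OF span_base[OF Y_v0_lower[OF step(2)]]]])
  ultimately show ?case by simp
next
  case (add v f w g)
  have "v + w - scale (f top + g top) v0 = (v - scale (f top) v0) + (w - scale (g top) v0)"
    by (simp add: scale_left_distrib)
  then show ?case using span_add[OF add(3,4)] by (simp only:)
next
  case (smult v f a)
  have "scale a v - scale (a * f top) v0 = scale a (v - scale (f top) v0)"
    by (simp add: scale_right_diff_distrib)
  then show ?case using span_scale[OF smult(2)] by simp
qed

lemma v0_not_lower: "v0 \<notin> span lower"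
  using eigenvector_not_in_span_lower[OF grading_hom grading_v0 v0_nonzero] by (simp add: lower_def)

text \<open>The functions related to 0 are closed under \<open>XX\<close>, so a nonzero one would
  make \<open>point top\<close> related to 0, and the leading term would put \<open>v0\<close> among
  the vectors of lower degree.\<close>

lemma related_zero_left:
  assumes "related 0 f"
  shows "f s = 0"
proof (rule ccontr)
  assume "f s \<noteq> 0"
  let ?K = "{f. related 0 f}"
  have "point top \<in> ?K"
  proof (rule point_top_in_X_invariant[of "\<lambda>t s. label s t" _ f s])
    fix k f assume "k \<in> {1..<n}" "f \<in> ?K"
    then show "XX k f \<in> ?K"
      using related_X[of 0 f k] module_hom.zero[OF hom_gens(1)] by simp
  next
    fix a f assume "f \<in> ?K"
    then show "(\<lambda>s. a * f s) \<in> ?K"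
      using cyclic_pair.smult[of scale Y YY "{1..<n}" v0 "point top" 0 f a] by simp
  qed (use assms \<open>f s \<noteq> 0\<close> label_nonzero related_supp in auto)
  then have "0 - scale (point top top) v0 \<in> span lower" using related_leading_term by blast
  then have "v0 \<in> span lower" using span_neg by (force simp: point_def)
  then show False using v0_not_lower by blast
qed

text \<open>The vectors related to the zero function form a submodule. If it were nonzero,
  irreducibility would put \<open>v0\<close> into it, with leading coefficient 0.\<close>

lemma related_zero_right:
  assumes "related v (\<lambda>s. 0)"
  shows "v = 0"
proof (rule ccontr)
  assume nz: "v \<noteq> 0"
  let ?K = "{v. related v (\<lambda>s. 0)}"
  have "v0 \<in> ?K"
  proof (rule invariant_subspace_trivial[OF _ _ _ _ nz])
    show "subspace ?K"
      using related_zero cyclic_pair.add[of scale Y YY "{1..<n}" v0 "point top" _ "\<lambda>s. 0" _ "\<lambda>s. 0"]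
        cyclic_pair.smult[of scale Y YY "{1..<n}" v0 "point top" _ "\<lambda>s. 0"]
      by (intro subspaceI) auto
  next
    fix k u assume k: "k \<in> {1..<n}" and u: "u \<in> ?K"
    show "X k u \<in> ?K" using related_X[OF _ k, of u "\<lambda>s. 0"] u by (simp add: act_zero)
    show "Y k u \<in> ?K"
      using cyclic_pair.step[OF _ k, of scale Y YY v0 "point top" u "\<lambda>s. 0"] u by (simp add: act_zero)
  qed (use assms in simp)
  then have "v0 - scale 0 v0 \<in> span lower" using related_leading_term[of v0 "\<lambda>s. 0"] by simp
  then show False using v0_not_lower by simp
qed

text \<open>The annihilator of the functions that occur is closed under \<open>XX\<close>, the
  transpose of \<open>YY\<close>. Were it nonzero, it would contain \<open>point top\<close>, which
  itself occurs and pairs with itself to 1.\<close>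

lemma related_exists:
  assumes "\<And>s. s \<notin> P \<Longrightarrow> f s = 0"
  shows "\<exists>v. related v f"
proof -
  let ?M = "{f. \<exists>v. related v f}"
  have "f \<in> ?M"
  proof (rule function_in_subspace_if_annihilator_trivial[OF finite_P])
    show "(\<lambda>s. f s + g s) \<in> ?M"
      if "f \<in> ?M" "g \<in> ?M" for f g
      using that cyclic_pair.add by blast
    show "(\<lambda>s. a * f s) \<in> ?M" if "f \<in> ?M" for f a
      using that cyclic_pair.smult by blast
    show "(\<lambda>s. 0) \<in> ?M" using related_zero by blast
    show "f s = 0" if "f \<in> ?M" "s \<notin> P" for f s
      using that related_supp by blast
    show "f s = 0" if "s \<notin> P" for s by (rule assms[OF that])
  next
    fix z :: "'a \<Rightarrow> complex"
    assume z: "\<And>s. s \<notin> P \<Longrightarrow> z s = 0"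
      and orth: "\<And>f. f \<in> ?M \<Longrightarrow> (\<Sum>s\<in>P. z s * f s) = 0"
    let ?Z = "{z. (\<forall>s. s \<notin> P \<longrightarrow> z s = 0) \<and> (\<forall>v f. related v f \<longrightarrow> (\<Sum>s\<in>P. z s * f s) = 0)}"
    show "z = (\<lambda>s. 0)"
    proof (rule ccontr)
      assume "z \<noteq> (\<lambda>s. 0)"
      then obtain s where s: "z s \<noteq> 0" by auto
      have "point top \<in> ?Z"
      proof (rule point_top_in_X_invariant[of "\<lambda>t s. label s t" _ z s])
        fix k z assume k: "k \<in> {1..<n}" and "z \<in> ?Z"
        then have z: "z s = 0" if "s \<notin> P" for s using that by blast
        have zo: "(\<Sum>s\<in>P. z s * f s) = 0" if "related v f" for v f using \<open>z \<in> ?Z\<close> that by blast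
        have "XX k z s = 0" if "s \<notin> P" for s
        proof -
          have "{r. (r, s) \<in> E k} = {}" using that edge_in by blast
          then show ?thesis by (simp add: act_X_def)
        qed
        moreover have "(\<Sum>s\<in>P. XX k z s * f s) = 0" if "related v f" for v f
        proof -
          have "(\<Sum>t\<in>P. XX k z t * f t) = (\<Sum>t\<in>P. \<Sum>s | (s, t) \<in> E k. z s * (label s t * f t))"
            unfolding act_X_def sum_distrib_right by (intro sum.cong refl) (simp add: ac_simps)
          also have "\<dots> = (\<Sum>s\<in>P. \<Sum>t | (s, t) \<in> E k. z s * (label s t * f t))"
            by (rule sum_edges_swap[OF finite_P edges_subset, symmetric])
          also have "\<dots> = (\<Sum>s\<in>P. z s * YY k f s)"
            by (simp add: act_Y_def sum_distrib_left)
          also have "\<dots> = 0" using zo cyclic_pair.step[OF that k] by blast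
          finally show ?thesis .
        qed
        ultimately show "XX k z \<in> ?Z" by blast
      next
        fix a z assume "z \<in> ?Z"
        then show "(\<lambda>s. a * z s) \<in> ?Z" by (auto simp: mult.assoc sum_distrib_left[symmetric])
      qed (use z orth s label_nonzero in auto)
      then have "(\<Sum>s\<in>P. point top s * point top s) = 0" using cyclic_pair.start by blast
      then show False using finite_P top_in by (simp add: point_def if_distrib cong: if_cong)
    qed
  qed
  then show ?thesis by simp
qed

section \<open>The basis obtained from the isomorphism\<close>

definition gt_basis :: "'a \<Rightarrow> 'v" where
  "gt_basis s = (SOME v. related v (point s))"

lemma related_gt_basis:
  assumes "s \<in> P"
  shows "related (gt_basis s) (point s)"
  unfolding gt_basis_def by (rule someI_ex, rule related_exists) (use assms in \<open>auto simp: point_def\<close>)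

lemma related_lin_comb:
  assumes f: "\<And>s. s \<notin> P \<Longrightarrow> f s = 0"
  shows "related (lin_comb scale P gt_basis f) f"
proof -
  have "related (\<Sum>s\<in>A. scale (f s) (gt_basis s)) (\<lambda>t. \<Sum>s\<in>A. f s * point s t)" if "A \<subseteq> P" for A
    using finite_subset[OF that finite_P] that
  proof (induction A rule: finite_induct)
    case empty
    then show ?case using related_zero by simp
  next
    case (insert a A)
    then show ?case
      using cyclic_pair.add[OF cyclic_pair.smult[OF related_gt_basis[of a], of "f a"]] by simp
  qed
  from this[OF order_refl] have "related (lin_comb scale P gt_basis f) (\<lambda>t. \<Sum>s\<in>P. f s * point s t)"
    by (simp add: lin_comb_def)
  moreover have "(\<Sum>s\<in>P. f s * point s t) = f t" for t
    using f[of t] finite_P by (cases "t \<in> P") (auto simp: point_def if_distrib cong: if_cong)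
  ultimately show ?thesis by simp
qed

lemma related_unique:
  assumes "related v f" "related w f"
  shows "v = w"
  using related_zero_right[of "v - w"] related_diff[OF assms] by simp

lemma act_supp:
  assumes "s \<notin> P"
  shows "act_X E c k f s = 0" "act_Y E d k f s = 0"
proof -
  have "{r. (r, s) \<in> E k} = {}" "{t. (s, t) \<in> E k} = {}" using assms edge_in by blast+
  then show "act_X E c k f s = 0" "act_Y E d k f s = 0" by (simp_all add: act_X_def act_Y_def)
qed

lemma gt_basis_diagram: "representation_diagram n scale \<phi> P E (\<lambda>t s. label s t) label gt_basis"
  unfolding representation_diagram_def
proof (intro conjI ballI)
  show "colored_ranked_poset {1..<n} P E" by (rule poset)
  show "edge_labels {1..<n} E (\<lambda>t s. label s t) label"
    unfolding edge_labels_def using label_nonzero by blast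
next
  fix i s assume i: "i \<in> {1..<n}" and s: "s \<in> P"
  have "X i (gt_basis s) = lin_comb scale P gt_basis (XX i (point s))"
    by (rule related_unique[OF related_X[OF related_gt_basis[OF s] i]])
       (rule related_lin_comb, simp add: act_supp)
  also have "\<dots> = (\<Sum>t | (s, t) \<in> E i. scale (label s t) (gt_basis t))"
    unfolding lin_comb_def using finite_P edge_in finite_edges(1)
    by (intro sum.mono_neutral_cong_right) (auto simp: act_X_point)
  finally show "X i (gt_basis s) = (\<Sum>t | (s, t) \<in> E i. scale (label s t) (gt_basis t))" .
  have "Y i (gt_basis s) = lin_comb scale P gt_basis (YY i (point s))"
    by (rule related_unique[OF cyclic_pair.step[OF related_gt_basis[OF s] i]])
       (rule related_lin_comb, simp add: act_supp)
  also have "\<dots> = (\<Sum>r | (r, s) \<in> E i. scale (label r s) (gt_basis r))"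
    unfolding lin_comb_def using finite_P edge_in finite_edges(2)
    by (intro sum.mono_neutral_cong_right) (auto simp: act_Y_point)
  finally show "Y i (gt_basis s) = (\<Sum>r | (r, s) \<in> E i. scale (label r s) (gt_basis r))" .
  have "(\<lambda>t. of_int (m i t) * point s t) = (\<lambda>t. of_int (m i s) * point s t)" by (auto simp: point_def)
  then show "H i (gt_basis s) = scale (of_int (m i s)) (gt_basis s)"
    using related_H[OF related_gt_basis[OF s] i] cyclic_pair.smult[OF related_gt_basis[OF s], of "of_int (m i s)"]
    by (intro related_unique) auto
next
  have "f s = 0" if "lin_comb scale P gt_basis f = 0" "s \<in> P" for f s
  proof -
    let ?f = "\<lambda>s. if s \<in> P then f s else 0"
    have "lin_comb scale P gt_basis ?f = 0" using that by (simp add: lin_comb_def)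
    then have "related 0 ?f" using related_lin_comb[of ?f] by simp
    from related_zero_left[OF this, of s] show ?thesis using that by simp
  qed
  then have "inj_on gt_basis P \<and> independent (gt_basis ` P)"
    unfolding basis_iff_lin_comb[OF finite_P] by blast
  moreover have "span (gt_basis ` P) = UNIV"
  proof -
    \<comment> \<open>The vectors occurring on the left form a submodule containing
      \<open>v0\<close>, hence are all vectors; \<open>related_unique\<close> then expresses each of
      them in the basis.\<close>
    let ?S = "{v. \<exists>f. related v f}"
    have "w \<in> ?S" for w
    proof (rule invariant_subspace_trivial[OF _ _ _ _ v0_nonzero])
      show "subspace ?S"
      proof (rule subspaceI)
        show "0 \<in> ?S" using related_zero by blast
        show "u + w \<in> ?S"
          if "u \<in> ?S" "w \<in> ?S" for u w
          using that cyclic_pair.add by blast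
        show "scale a u \<in> ?S" if "u \<in> ?S" for a u
          using that cyclic_pair.smult by blast
      qed
    next
      fix k u assume k: "k \<in> {1..<n}" and u: "u \<in> ?S"
      show "X k u \<in> ?S" using u related_X[OF _ k] by blast
      show "Y k u \<in> ?S" using u cyclic_pair.step[OF _ k] by blast
    next
      show "v0 \<in> ?S" using cyclic_pair.start by blast
    qed
    then have "\<exists>f. w = lin_comb scale P gt_basis f" for w
    proof -
      obtain f where f: "related w f" using \<open>\<And>w. w \<in> ?S\<close> by blast
      have "related (lin_comb scale P gt_basis f) f"
        by (rule related_lin_comb) (rule related_supp[OF f])
      then show ?thesis using related_unique[OF f] by blast
    qed
    moreover have "lin_comb scale P gt_basis f \<in> span (gt_basis ` P)" for f
      unfolding lin_comb_def by (intro span_sum span_scale span_base) simp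
    ultimately have "w \<in> span (gt_basis ` P)" for w by metis
    then show ?thesis by blast
  qed
  ultimately show "indexed_basis scale P gt_basis" by (simp add: indexed_basis_def)
qed

end

section \<open>Solitarity and edge-minimality\<close>

context diamond_graph_module
begin

text \<open>The gauge \<open>a\<close> rescales \<open>v\<close> to a basis with the labels of
  \<open>w\<close>. The map from that basis to \<open>w\<close> commutes with the generators; as
  \<open>w top\<close> must be a multiple of the rescaled top vector, the map has an eigenvector,
  and irreducibility makes it a scalar.\<close>

lemma diagrams_diagonally_equivalent:
  assumes v: "representation_diagram n scale \<phi> P E c d v"
    and w: "representation_diagram n scale \<phi> P E c' d' w"
  shows "diagonally_equivalent scale P v w"
proof -
  note br = diagram_bracket[OF v] and br' = diagram_bracket[OF w]
  note basis_v = diagram_basis[OF v] and basis_w = diagram_basis[OF w]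
  have prod: "c t s * d s t = of_real (x s t)" "c' t s * d' s t = of_real (x s t)" if "(s, t) \<in> E k" for s t k
    using edge_products_of_labels[OF br that] edge_products_of_labels[OF br' that]
    by (simp_all add: edge_product_def)
  have nz: "c t s \<noteq> 0" "d s t \<noteq> 0" "c' t s \<noteq> 0" "d' s t \<noteq> 0" if "(s, t) \<in> E k" for s t k
    using prod[OF that] x_pos[OF that] by auto
  define \<rho> where "\<rho> = (\<lambda>s t. c' t s / c t s)"
  obtain a where a: "\<And>s. a s \<noteq> 0" and a_edge: "\<And>k s t. (s, t) \<in> E k \<Longrightarrow> a s = \<rho> s t * a t"
  proof (rule gauge_exists[of \<rho>])
    show "\<rho> s t \<noteq> 0" if "(s, t) \<in> E k" for k s t using nz[OF that] by (simp add: \<rho>_def)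
    show "\<rho> r s * \<rho> s u = \<rho> r t * \<rho> t u"
      if st: "s \<noteq> t" and e: "(s, u) \<in> E j" "(t, u) \<in> E i" "(r, s) \<in> E i" "(r, t) \<in> E j" for r s t u i j
    proof -
      \<comment> \<open>The quotient of the two path products of \<open>c\<close> around a diamond
        depends only on the edge products, so it is the same for \<open>c\<close> and
        \<open>c'\<close>.\<close>
      have ratio: "(c s r * c u s) * of_real (x t u) = (c t r * c u t) * of_real (x r s)"
        if "c t r * d r s = d t u * c u s" "c s r * d r s = of_real (x r s)" "c u t * d t u = of_real (x t u)"
        for c d :: "'a \<Rightarrow> 'a \<Rightarrow> complex"
      proof -
        have "(c s r * c u s) * (c u t * d t u) = c s r * c u t * (d t u * c u s)" by (simp only: ac_simps)
        also have "\<dots> = (c t r * c u t) * (c s r * d r s)" unfolding that(1)[symmetric] by (simp only: ac_simps)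
        finally show ?thesis by (simp only: that(2,3))
      qed
      have 1: "(c s r * c u s) * of_real (x t u) = (c t r * c u t) * of_real (x r s)"
        by (rule ratio[OF labels_diamond[OF br st e] prod(1)[OF e(3)] prod(1)[OF e(2)]])
      have 2: "(c' s r * c' u s) * of_real (x t u) = (c' t r * c' u t) * of_real (x r s)"
        by (rule ratio[OF labels_diamond[OF br' st e] prod(2)[OF e(3)] prod(2)[OF e(2)]])
      have xs: "of_real (x t u) \<noteq> (0 :: complex)" "of_real (x r s) \<noteq> (0 :: complex)"
        using x_pos[OF e(2)] x_pos[OF e(3)] by auto
      have "(c' s r * c' u s) * (c t r * c u t) * (of_real (x t u) * of_real (x r s)) =
          ((c' s r * c' u s) * of_real (x t u)) * ((c t r * c u t) * of_real (x r s))" by (simp only: ac_simps)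
      also have "\<dots> = ((c' t r * c' u t) * of_real (x r s)) * ((c s r * c u s) * of_real (x t u))"
        by (simp only: 1 2)
      finally have "(c' s r * c' u s) * (c t r * c u t) * (of_real (x t u) * of_real (x r s)) =
          (c' t r * c' u t) * (c s r * c u s) * (of_real (x t u) * of_real (x r s))" by (simp only: ac_simps)
      then have "(c' s r * c' u s) * (c t r * c u t) = (c' t r * c' u t) * (c s r * c u s)"
        using xs by simp
      then show ?thesis
        using nz[OF e(1)] nz[OF e(2)] nz[OF e(3)] nz[OF e(4)] by (simp add: \<rho>_def divide_simps)
    qed
  qed blast
  have ac: "c t s * a s = c' t s * a t" and ad: "d s t * a t = d' s t * a s" if "(s, t) \<in> E k" for s t k
  proof -
    show "c t s * a s = c' t s * a t" using a_edge[OF that] nz[OF that] by (simp add: \<rho>_def)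
    then have "c t s * a s * (d s t * d' s t) = c' t s * a t * (d s t * d' s t)" by simp
    then have "(c t s * d s t) * (d' s t * a s) = (c' t s * d' s t) * (d s t * a t)"
      by (simp only: ac_simps)
    then have "of_real (x s t) * (d' s t * a s) = of_real (x s t) * (d s t * a t)"
      by (simp only: prod[OF that])
    then show "d s t * a t = d' s t * a s" using x_pos[OF that] by simp
  qed
  \<comment> \<open>\<open>L\<close> takes coordinates in the rescaled basis
    \<open>scale (a s) (v s)\<close>, on which the generators act with the labels \<open>c'\<close>
    and \<open>d'\<close>.\<close>
  define L where "L = (\<lambda>f. lin_comb scale P v (\<lambda>s. a s * f s))"
  have actX: "act_X E c k (\<lambda>s. a s * f s) = (\<lambda>t. a t * act_X E c' k f t)" for k f
    unfolding act_X_def sum_distrib_left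
    by (intro ext sum.cong refl) (use ac in \<open>metis mem_Collect_eq mult.assoc mult.commute\<close>)
  have actY: "act_Y E d k (\<lambda>s. a s * f s) = (\<lambda>t. a t * act_Y E d' k f t)" for k f
    unfolding act_Y_def sum_distrib_left
    by (intro ext sum.cong refl) (use ad in \<open>metis mem_Collect_eq mult.assoc mult.commute\<close>)
  have LX: "X k (L f) = L (act_X E c' k f)" and LY: "Y k (L f) = L (act_Y E d' k f)" if "k \<in> {1..<n}" for k f
    using that by (simp_all add: L_def diagram_X[OF v] diagram_Y[OF v] actX actY)
  have L_inj: "f s = g s" if "L f = L g" "s \<in> P" for f g s
    using lin_comb_inject[OF finite_P basis_v that(1)[unfolded L_def] that(2)] a[of s] by simp
  have L_add: "L (\<lambda>s. f s + g s) = L f + L g" for f g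
    unfolding L_def by (simp add: distrib_left lin_comb_add)
  have L_scale: "L (\<lambda>s. b * f s) = scale b (L f)" for b f
    unfolding L_def lin_comb_scale[symmetric] by (simp add: mult.left_commute)
  have L_zero: "L (\<lambda>s. 0) = 0" unfolding L_def by (simp add: lin_comb_zero)
  have L_point: "L (point s) = scale (a s) (v s)" if "s \<in> P" for s
  proof -
    have "(\<lambda>t. a t * point s t) = (\<lambda>t. a s * point s t)" by (auto simp: point_def)
    then show ?thesis unfolding L_def using lin_comb_point[OF finite_P that] by (simp add: lin_comb_scale)
  qed
  obtain g where g: "w top = lin_comb scale P v g" "\<And>s. s \<notin> P \<Longrightarrow> g s = 0"
    by (rule lin_comb_exhaust[OF finite_P basis_v, of "w top"]) blast
  define f where "f = (\<lambda>s. g s / a s)"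
  have wf: "w top = L f" using a by (simp add: g(1) L_def f_def)
  have prim: "act_X E c' k f t = 0" if k: "k \<in> {1..<n}" for k t
  proof (cases "t \<in> P")
    case True
    have "act_X E c' k (point top) = (\<lambda>s. 0)"
      using top_max finite_edges(1) by (auto simp: act_X_point)
    then have "X k (w top) = 0"
      using diagram_X[OF w k, of "point top"] lin_comb_point[OF finite_P top_in] by (simp add: lin_comb_zero)
    then have "L (act_X E c' k f) = L (\<lambda>s. 0)" using LX[OF k] wf L_zero by simp
    then show ?thesis using L_inj True by blast
  qed (rule act_supp)
  have "f s = 0" if "s \<noteq> top" for s
    by (rule primitive_supported_at_top[OF _ prim]) (use nz g(2) that in \<open>auto simp: f_def\<close>)
  then have f: "f = (\<lambda>s. f top * point top s)" by (auto simp: point_def)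
  define \<beta> where "\<beta> = f top"
  have w_top: "w top = scale \<beta> (L (point top))"
    unfolding wf \<beta>_def L_scale[symmetric] using f by simp
  \<comment> \<open>The eigenspace for \<open>\<beta>\<close> of the intertwiner that sends
    \<open>L f\<close> to \<open>lin_comb scale P w f\<close>.\<close>
  let ?S = "{u. \<exists>f. u = L f \<and> lin_comb scale P w f = scale \<beta> u}"
  have all: "u \<in> ?S" for u
  proof (rule invariant_subspace_trivial)
    show "subspace ?S"
    proof (rule subspaceI)
      show "0 \<in> ?S" using L_zero by (auto intro!: exI[of _ "\<lambda>s. 0"] simp: lin_comb_zero)
      show "y + z \<in> ?S" if "y \<in> ?S" "z \<in> ?S" for y z
      proof -
        from that obtain f g where "y = L f" "lin_comb scale P w f = scale \<beta> y" "z = L g"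
          "lin_comb scale P w g = scale \<beta> z" by blast
        then show ?thesis
          by (intro CollectI exI[of _ "\<lambda>s. f s + g s"]) (simp add: L_add lin_comb_add scale_right_distrib)
      qed
      show "scale b y \<in> ?S" if "y \<in> ?S" for b y
      proof -
        from that obtain f where "y = L f" "lin_comb scale P w f = scale \<beta> y" by blast
        then show ?thesis
          by (intro CollectI exI[of _ "\<lambda>s. b * f s"]) (simp add: L_scale lin_comb_scale mult.commute)
      qed
    qed
  next
    fix k y assume k: "k \<in> {1..<n}" and "y \<in> ?S"
    then obtain f where f: "y = L f" "lin_comb scale P w f = scale \<beta> y" by blast
    have "lin_comb scale P w (act_X E c' k f) = scale \<beta> (X k y)"
      using diagram_X[OF w k, of f] f(2) module_hom.scale[OF hom_gens(1)[OF k]] by simp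
    then show "X k y \<in> ?S" using LX[OF k] f(1) by blast
    have "lin_comb scale P w (act_Y E d' k f) = scale \<beta> (Y k y)"
      using diagram_Y[OF w k, of f] f(2) module_hom.scale[OF hom_gens(2)[OF k]] by simp
    then show "Y k y \<in> ?S" using LY[OF k] f(1) by blast
  next
    show "L (point top) \<in> ?S" using w_top lin_comb_point[OF finite_P top_in] by auto
    show "L (point top) \<noteq> 0"
      using L_point[OF top_in] a[of top] basis_nonzero[OF finite_P basis_v top_in] by simp
  qed
  have w_eq: "w s = scale (\<beta> * a s) (v s)" if s: "s \<in> P" for s
  proof -
    obtain f where f: "L (point s) = L f" "lin_comb scale P w f = scale \<beta> (L (point s))"
      using all[of "L (point s)"] by blast
    have "lin_comb scale P w f = lin_comb scale P w (point s)"
      unfolding lin_comb_def using L_inj[OF f(1)] by simp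
    then show ?thesis using f(2) L_point[OF s] lin_comb_point[OF finite_P s] by simp
  qed
  have "\<beta> \<noteq> 0"
    using w_eq[OF top_in] basis_nonzero[OF finite_P basis_w top_in] by auto
  then show ?thesis
    unfolding diagonally_equivalent_def using w_eq a by (intro exI[of _ "\<lambda>s. \<beta> * a s"]) simp
qed

lemma graph_solitary: "solitary n scale \<phi> P E"
  unfolding solitary_def supporting_graph_def weight_basis_supported_by_def
  using gt_basis_diagram diagrams_diagonally_equivalent by blast

text \<open>Irreducibility makes the subgraph connected, so the two weight functions differ by a constant,
  which vanishes since both have trace zero. Extended by zero, the labels of the subgraph then solve
  the conditions on the whole graph, where all edge products are known to be nonzero.\<close>

lemma supporting_subgraph_eq:
  assumes sub: "P' \<subseteq> P" "\<And>i. E' i \<subseteq> E i"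
    and v: "representation_diagram n scale \<phi> P' E' c d v"
  shows "P' = P" and "E' = E"
proof -
  have card: "dim UNIV = card Q" if "finite Q" "indexed_basis scale Q u" for Q :: "'a set" and u
    using that dim_eq_card[of "u ` Q" UNIV] by (simp add: indexed_basis_def card_image)
  \<comment> \<open>Both graphs index a basis of the same space.\<close>
  have "card P' = card P"
    using card[OF diagram_finite[OF v] diagram_basis[OF v]]
      card[OF finite_P diagram_basis[OF gt_basis_diagram]] by simp
  then show P': "P' = P" using card_subset_eq[OF finite_P sub(1)] by simp
  note v = v[unfolded P']
  note br = diagram_bracket[OF v] and basis = diagram_basis[OF v]
  let ?m' = "vertex_value E'"
  \<comment> \<open>Along an edge of the subgraph both weight functions change by the same Cartan
    entries, so \<open>?C\<close> is a union of connected components of the subgraph, and the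
    vectors supported on it form a submodule.\<close>
  let ?C = "{t \<in> P. \<forall>i\<in>{1..<n}. ?m' i t - m i t = ?m' i top - m i top}"
  have C_edge: "s \<in> ?C \<longleftrightarrow> t \<in> ?C" if "(s, t) \<in> E' k" for s t k
  proof -
    have st: "(s, t) \<in> E k" using that sub by blast
    have "?m' i t - m i t = ?m' i s - m i s" if i: "i \<in> {1..<n}" for i
      using diagram_structure[OF v edge_color[OF st] i \<open>(s, t) \<in> E' k\<close>]
        weight_structure[OF edge_color[OF st] i st] by simp
    then show ?thesis using edge_in[OF st] by auto
  qed
  let ?S = "{u. \<exists>f. u = lin_comb scale P v f \<and> (\<forall>t. t \<notin> ?C \<longrightarrow> f t = 0)}"
  have all: "u \<in> ?S" for u
  proof (rule invariant_subspace_trivial)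
    show "subspace ?S"
    proof (rule subspaceI)
      show "0 \<in> ?S" by (intro CollectI exI[of _ "\<lambda>s. 0"]) (simp add: lin_comb_zero)
      show "y + z \<in> ?S" if "y \<in> ?S" "z \<in> ?S" for y z
      proof -
        from that obtain f g where "y = lin_comb scale P v f" "\<forall>t. t \<notin> ?C \<longrightarrow> f t = 0"
          "z = lin_comb scale P v g" "\<forall>t. t \<notin> ?C \<longrightarrow> g t = 0" by blast
        then show ?thesis by (intro CollectI exI[of _ "\<lambda>s. f s + g s"]) (simp add: lin_comb_add)
      qed
      show "scale b y \<in> ?S" if "y \<in> ?S" for b y
      proof -
        from that obtain f where "y = lin_comb scale P v f" "\<forall>t. t \<notin> ?C \<longrightarrow> f t = 0" by blast
        then show ?thesis by (intro CollectI exI[of _ "\<lambda>s. b * f s"]) (simp add: lin_comb_scale)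
      qed
    qed
  next
    fix k y assume k: "k \<in> {1..<n}" and "y \<in> ?S"
    then obtain f where f: "y = lin_comb scale P v f" "\<forall>t. t \<notin> ?C \<longrightarrow> f t = 0" by blast
    have "act_X E' c k f t = 0" if "t \<notin> ?C" for t
      unfolding act_X_def
    proof (rule sum.neutral, rule ballI)
      fix s assume "s \<in> {s. (s, t) \<in> E' k}"
      then have "s \<notin> ?C" using C_edge[of s t k] that by blast
      then show "c t s * f s = 0" using f(2) by simp
    qed
    then show "X k y \<in> ?S" unfolding f(1) diagram_X[OF v k] by blast
    have "act_Y E' d k f s = 0" if "s \<notin> ?C" for s
      unfolding act_Y_def
    proof (rule sum.neutral, rule ballI)
      fix t assume "t \<in> {t. (s, t) \<in> E' k}"
      then have "t \<notin> ?C" using C_edge[of s t k] that by blast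
      then show "d s t * f t = 0" using f(2) by simp
    qed
    then show "Y k y \<in> ?S" unfolding f(1) diagram_Y[OF v k] by blast
  next
    have "v top = lin_comb scale P v (point top)" using lin_comb_point[OF finite_P top_in] by simp
    moreover have "\<forall>t. t \<notin> ?C \<longrightarrow> point top t = 0" using top_in by (auto simp: point_def)
    ultimately show "v top \<in> ?S" by blast
    show "v top \<noteq> 0" by (rule basis_nonzero[OF finite_P basis top_in])
  qed
  have const: "?m' i s - m i s = ?m' i top - m i top" if i: "i \<in> {1..<n}" and s: "s \<in> P" for i s
  proof -
    obtain f where f: "v s = lin_comb scale P v f" "\<forall>t. t \<notin> ?C \<longrightarrow> f t = 0" using all[of "v s"] by blast
    then have "point s s = f s"
      using lin_comb_inject[OF finite_P basis _ s, of "point s" f] lin_comb_point[OF finite_P s] by simp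
    then have "f s \<noteq> 0" by (simp add: point_def)
    then have "s \<in> ?C" using f(2) by blast
    then show ?thesis using i by simp
  qed
  have m': "?m' i s = m i s" if i: "i \<in> {1..<n}" and s: "s \<in> P" for i s
  proof -
    have "(\<Sum>s\<in>P. ?m' i s) = 0"
      by (rule sum_bracket_weights[OF finite_P diagram_edges[OF v i] i br])
    moreover have "(\<Sum>s\<in>P. m i s) = 0"
      by (rule sum_bracket_weights[OF finite_P edges_subset i label_bracket])
    ultimately have "(\<Sum>s\<in>P. ?m' i s - m i s) = 0" by (simp add: sum_subtractf)
    then have "int (card P) * (?m' i top - m i top) = 0" using const[OF i] by simp
    then have "?m' i top - m i top = 0" using finite_P top_in by auto
    then show ?thesis using const[OF i s] by simp
  qed
  \<comment> \<open>\<open>bracket_condition\<close> admits zero labels, so the extended labels can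
    be tested on the whole graph, with the weights already identified.\<close>
  define c' where "c' = (\<lambda>t s. if \<exists>i. (s, t) \<in> E' i then c t s else 0)"
  define d' where "d' = (\<lambda>s t. if \<exists>i. (s, t) \<in> E' i then d s t else 0)"
  have color: "(s, t) \<in> E' k" if "(s, t) \<in> E k" "(s, t) \<in> E' i" for s t i k
    using that sub edge_color_unique by blast
  have "bracket_condition {1..<n} P E c' d' m"
    unfolding bracket_condition_def
  proof (intro ballI)
    fix i j s t assume ij: "i \<in> {1..<n}" "j \<in> {1..<n}" and st: "s \<in> P" "t \<in> P"
    have "(\<Sum>r | (r, t) \<in> E i \<and> (r, s) \<in> E j. c' t r * d' r s) =
        (\<Sum>r | (r, t) \<in> E' i \<and> (r, s) \<in> E' j. c t r * d r s)"
    proof (rule sum.mono_neutral_cong_right)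
      show "finite {r. (r, t) \<in> E i \<and> (r, s) \<in> E j}"
        by (rule finite_subset[OF _ finite_edges(1)[of t i]]) auto
      show "\<forall>r\<in>{r. (r, t) \<in> E i \<and> (r, s) \<in> E j} - {r. (r, t) \<in> E' i \<and> (r, s) \<in> E' j}. c' t r * d' r s = 0"
        using color by (auto simp: c'_def d'_def)
    qed (use sub in \<open>auto simp: c'_def d'_def\<close>)
    moreover have "(\<Sum>u | (t, u) \<in> E j \<and> (s, u) \<in> E i. d' t u * c' u s) =
        (\<Sum>u | (t, u) \<in> E' j \<and> (s, u) \<in> E' i. d t u * c u s)"
    proof (rule sum.mono_neutral_cong_right)
      show "finite {u. (t, u) \<in> E j \<and> (s, u) \<in> E i}"
        by (rule finite_subset[OF _ finite_edges(2)[of t j]]) auto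
      show "\<forall>u\<in>{u. (t, u) \<in> E j \<and> (s, u) \<in> E i} - {u. (t, u) \<in> E' j \<and> (s, u) \<in> E' i}. d' t u * c' u s = 0"
        using color by (auto simp: c'_def d'_def)
    qed (use sub in \<open>auto simp: c'_def d'_def\<close>)
    ultimately show "(\<Sum>r | (r, t) \<in> E i \<and> (r, s) \<in> E j. c' t r * d' r s) -
        (\<Sum>u | (t, u) \<in> E j \<and> (s, u) \<in> E i. d' t u * c' u s) =
        (if i = j \<and> s = t then of_int (m i s) else 0)"
      using bracket_conditionD[OF br ij st] by (simp only: m'[OF ij(1) st(1)])
  qed
  then have "edge_product c' d' s t = of_real (x s t)" if "(s, t) \<in> E k" for s t k
    using edge_products_of_labels that by blast
  then have "c' t s \<noteq> 0" if "(s, t) \<in> E k" for s t k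
    using that x_pos[OF that] by (force simp: edge_product_def)
  then have "(s, t) \<in> E' k" if "(s, t) \<in> E k" for s t k
    using that color[OF that] by (metis c'_def)
  then show "E' = E" using sub(2) by (intro ext equalityI) (auto intro: subsetD[OF sub(2)])
qed

lemma graph_edge_minimal: "edge_minimal n scale \<phi> P E"
  unfolding edge_minimal_def
proof (intro conjI notI)
  show "supporting_graph n scale \<phi> P E" using graph_solitary by (simp add: solitary_def)
  assume "\<exists>P' E'. P' \<subseteq> P \<and> (\<forall>i. E' i \<subseteq> E i) \<and> (P', E') \<noteq> (P, E) \<and> supporting_graph n scale \<phi> P' E'"
  then obtain P' E' c d v where "P' \<subseteq> P" "\<And>i. E' i \<subseteq> E i" "(P', E') \<noteq> (P, E)"
    "representation_diagram n scale \<phi> P' E' c d v"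
    unfolding supporting_graph_def weight_basis_supported_by_def by blast
  then show False using supporting_subgraph_eq[of P' E' c d v] by auto
qed

end

section \<open>The Gelfand--Tsetlin lattice\<close>

text \<open>On a connected component two rank functions differ by a constant, and attaining 0 fixes
  it. Any exhibited rank function therefore evaluates both descriptions in
  \<open>vertex_value\<close>.\<close>

lemma vertex_value_eqI:
  fixes f :: "'a \<Rightarrow> nat" and E i s
  defines "C \<equiv> component E i s"
  assumes edge: "\<And>r t. r \<in> C \<Longrightarrow> t \<in> C \<Longrightarrow> (r, t) \<in> E i \<Longrightarrow> f t = Suc (f r)"
    and bot: "z \<in> C" "f z = 0" and max: "y \<in> C" "\<And>t. t \<in> C \<Longrightarrow> f t \<le> f y"
  shows "vertex_value E i s = 2 * int (f s) - int (f y)"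
proof -
  let ?R = "E i \<union> (E i)\<inverse>"
  have C: "C = {t. (s, t) \<in> ?R\<^sup>*}" by (simp add: C_def component_def)
  have rank: "is_rank_function C (E i) f" unfolding is_rank_function_def using edge bot by blast
  have unique: "f' t = f t" if f': "is_rank_function C (E i) f'" and t: "t \<in> C" for f' t
  proof -
    have shift: "int (f' t) - int (f t) = int (f' s) - int (f s)" if "t \<in> C" for t
    proof -
      have "(s, t) \<in> ?R\<^sup>*" using that C by simp
      then show ?thesis
      proof (induction rule: rtrancl_induct)
        case (step r t)
        then have "r \<in> C" "t \<in> C" unfolding C by (auto intro: rtrancl_into_rtrancl)
        moreover have "(r, t) \<in> E i \<or> (t, r) \<in> E i" using step by auto
        ultimately have "int (f' t) - int (f t) = int (f' r) - int (f r)"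
          using f' edge unfolding is_rank_function_def by fastforce
        then show ?case using step by simp
      qed simp
    qed
    obtain z' where z': "z' \<in> C" "f' z' = 0" using f' unfolding is_rank_function_def by blast
    have "int (f' s) - int (f s) = 0" using shift[OF bot(1)] shift[OF z'(1)] bot z' by simp
    then show ?thesis using shift[OF t] by simp
  qed
  have s: "s \<in> C" by (simp add: C)
  have "rank_in C (E i) s = f s"
    unfolding rank_in_def
  proof (rule the_equality)
    show "\<exists>f'. is_rank_function C (E i) f' \<and> f s = f' s" using rank by blast
    show "r = f s" if "\<exists>f'. is_rank_function C (E i) f' \<and> r = f' s" for r
      using that unique[OF _ s] by blast
  qed
  moreover have "poset_rank C (E i) = f y"
    unfolding poset_rank_def
  proof (rule the_equality)
    have "finite (f ` C)" by (rule finite_subset[of _ "{..f y}"]) (use max in auto)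
    then have Max: "Max (f ` C) = f y" using max by (intro Max_eqI) auto
    then show "\<exists>f'. is_rank_function C (E i) f' \<and> f y = Max (f' ` C)" using rank by metis
    show "l = f y" if "\<exists>f'. is_rank_function C (E i) f' \<and> l = Max (f' ` C)" for l
    proof -
      from that obtain f' where f': "is_rank_function C (E i) f'" "l = Max (f' ` C)" by blast
      have "f' ` C = f ` C" using unique[OF f'(1)] by (intro image_cong) auto
      then show ?thesis using f'(2) Max by simp
    qed
  qed
  ultimately show ?thesis by (simp add: vertex_value_def C_def)
qed

text \<open>Multiplying the diamond equations for \<open>(s, t)\<close> and for
  \<open>(t, s)\<close> turns mixed labels into edge products.\<close>

lemma (in diamond_graph) edge_products_of_conditions:
  assumes crossing: "crossing_condition {1..<n} P E c d" and dia: "diamond_condition {1..<n} P E c d"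
    and "(s, u) \<in> E k"
  shows "edge_product c d s u = of_real (x s u)"
proof (rule edge_products_unique[OF _ _ assms(3)])
  fix k s assume "k \<in> {1..<n}" "s \<in> P"
  then show "(\<Sum>r | (r, s) \<in> E k. edge_product c d r s) - (\<Sum>t | (s, t) \<in> E k. edge_product c d s t) =
      of_int (vertex_value E k s)"
    using crossing by (simp add: crossing_condition_def)
next
  fix r s t u i j
  assume st: "s \<noteq> t" and e: "(s, u) \<in> E j" "(t, u) \<in> E i" "(r, s) \<in> E i" "(r, t) \<in> E j"
  have eq: "c u s * d t u = d r s * c t r"
    if st: "s \<noteq> t" and e: "(s, u) \<in> E j" "(t, u) \<in> E i" "(r, s) \<in> E i" "(r, t) \<in> E j" for r s t u i j
  proof -
    let ?R = "\<Union>k\<in>{1..<n}. E k"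
    have su: "(s, u) \<in> ?R" "(t, u) \<in> ?R" using e edge_color by blast+
    have P: "s \<in> P" "t \<in> P" "u \<in> P" using e edge_in by auto
    have "f s = f t" if "is_rank_function P ?R f" for f
    proof -
      have "f u = Suc (f s)" "f u = Suc (f t)" using that su P unfolding is_rank_function_def by blast+
      then show ?thesis by simp
    qed
    \<comment> \<open>The predicates describing the ranks of \<open>s\<close> and \<open>t\<close>
      coincide, which makes the ranks equal without evaluating either of them.\<close>
    then have "(\<lambda>l. \<exists>f. is_rank_function P ?R f \<and> l = f s) = (\<lambda>l. \<exists>f. is_rank_function P ?R f \<and> l = f t)"
      by (intro ext) metis
    then have rank: "rank_in P ?R s = rank_in P ?R t" unfolding rank_in_def by (rule arg_cong)
    have "(\<Sum>u | (s, u) \<in> E j \<and> (t, u) \<in> E i. c u s * d t u) =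
        (\<Sum>r | (r, s) \<in> E i \<and> (r, t) \<in> E j. d r s * c t r)"
      using dia[unfolded diamond_condition_def, rule_format, of i j s t]
        edge_color[OF e(1)] edge_color[OF e(2)] P st rank by blast
    then show ?thesis unfolding diamond_unique[OF st e] by simp
  qed
  have "(c u s * d s u) * (c u t * d t u) = (c u s * d t u) * (c u t * d s u)" by (simp only: ac_simps)
  also have "\<dots> = (d r s * c t r) * (d r t * c s r)"
    by (simp only: eq[OF st e] eq[OF not_sym[OF st] e(2,1,4,3)])
  finally show "edge_product c d s u * edge_product c d t u = edge_product c d r s * edge_product c d r t"
    by (simp only: edge_product_def ac_simps)
qed

section \<open>Lattice operations and blocked rows of patterns\<close>

lemma increment_inject:
  "increment p k i = increment p k' i' \<longleftrightarrow> k = k' \<and> i = i'"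
proof
  assume "increment p k i = increment p k' i'"
  from fun_cong[OF fun_cong[OF this, of k], of i] show "k = k' \<and> i = i'"
    by (simp add: increment_apply split: if_splits)
qed simp

lemma increment_cancel: "increment p k i = increment q k i \<Longrightarrow> p = q"
  by (metis decrement_increment)

text \<open>Interlacing compares single entries and so survives entrywise minima and maxima. These
  supply the missing fourth vertex of a diamond.\<close>

lemma gt_patterns_min:
  assumes "p \<in> gt_patterns n lam" "q \<in> gt_patterns n lam"
  shows "(\<lambda>k i. min (p k i) (q k i)) \<in> gt_patterns n lam"
proof -
  have "min (p k i) (q k i) \<le> min (p (Suc k) i) (q (Suc k) i)"
    "min (p (Suc k) (Suc i)) (q (Suc k) (Suc i)) \<le> min (p k i) (q k i)" for k i
    by (intro min.mono gt_patternsD(1)[OF assms(1)] gt_patternsD(1)[OF assms(2)]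
        gt_patternsD(2)[OF assms(1)] gt_patternsD(2)[OF assms(2)])+
  then show ?thesis
    using gt_patternsD(3,4)[OF assms(1)] gt_patternsD(3,4)[OF assms(2)] by (simp add: gt_patterns_def)
qed

lemma gt_patterns_max:
  assumes "p \<in> gt_patterns n lam" "q \<in> gt_patterns n lam"
  shows "(\<lambda>k i. max (p k i) (q k i)) \<in> gt_patterns n lam"
proof -
  have "max (p k i) (q k i) \<le> max (p (Suc k) i) (q (Suc k) i)"
    "max (p (Suc k) (Suc i)) (q (Suc k) (Suc i)) \<le> max (p k i) (q k i)" for k i
    by (intro max.mono gt_patternsD(1)[OF assms(1)] gt_patternsD(1)[OF assms(2)]
        gt_patternsD(2)[OF assms(1)] gt_patternsD(2)[OF assms(2)])+
  then show ?thesis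
    using gt_patternsD(3,4)[OF assms(1)] gt_patternsD(3,4)[OF assms(2)] by (simp add: gt_patterns_def)
qed

text \<open>An entry blocked by its neighbour in the preceding row is, by induction on the rows,
  also blocked by the following row, so each row is repeated in the next one.\<close>

lemma unraisable_rows:
  assumes p: "p \<in> gt_patterns n lam" and K: "K \<le> n"
    and no: "\<And>j i. 1 \<le> j \<Longrightarrow> j < K \<Longrightarrow> i < j \<Longrightarrow> increment p j i \<notin> gt_patterns n lam"
  shows "j < K \<Longrightarrow> i < j \<Longrightarrow> p j i = p (Suc j) i"
proof (induction j arbitrary: i)
  case (Suc j)
  have "\<not> (p (Suc j) i < p (Suc (Suc j)) i \<and> (0 < i \<longrightarrow> p (Suc j) i < p j (i - 1)))"
    using no[of "Suc j" i] increment_in_gt_patterns_iff[OF p, of "Suc j" i] Suc.prems K by simp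
  moreover have "p (Suc j) i = p (Suc (Suc j)) i" if "0 < i" "p (Suc j) i \<ge> p j (i - 1)"
  proof -
    have "p j (i - 1) = p (Suc j) (i - 1)" using Suc that by simp
    moreover have "p (Suc (Suc j)) i \<le> p (Suc j) (i - 1)"
      using gt_patternsD(2)[OF p, of "Suc j" "i - 1"] that by simp
    ultimately show ?thesis using gt_patternsD(1)[OF p, of "Suc j" i] that by simp
  qed
  ultimately show ?case using gt_patternsD(1)[OF p, of "Suc j" i] by force
qed simp

text \<open>The dual of \<open>unraisable_rows\<close>, with the additional case that the last entry
  of a row is blocked by a padding zero.\<close>

lemma unlowerable_rows:
  assumes p: "p \<in> gt_patterns n lam" and K: "K \<le> n"
    and no: "\<And>j i. 1 \<le> j \<Longrightarrow> j < K \<Longrightarrow> i < j \<Longrightarrow> decrement p j i \<notin> gt_patterns n lam"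
  shows "j < K \<Longrightarrow> i < j \<Longrightarrow> p j i = p (Suc j) (Suc i)"
proof (induction j arbitrary: i)
  case (Suc j)
  have "\<not> (p (Suc (Suc j)) (Suc i) < p (Suc j) i \<and> p j i < p (Suc j) i)"
    using no[of "Suc j" i] decrement_in_gt_patterns_iff[OF p, of "Suc j" i] Suc.prems K by simp
  moreover have "p (Suc j) i = p (Suc (Suc j)) (Suc i)" if "p (Suc j) i \<le> p j i"
  proof (cases "i < j")
    case True
    then have "p j i = p (Suc j) (Suc i)" using Suc by simp
    then show ?thesis
      using gt_patternsD(1)[OF p, of "Suc j" "Suc i"] gt_patternsD(2)[OF p, of "Suc j" i] that by simp
  next
    case False
    then have "p j i = 0" using gt_patternsD(3)[OF p, of j i] by simp
    then show ?thesis
      using gt_patternsD(2)[OF p, of "Suc j" i] gt_patterns_nonneg[OF p, of "Suc (Suc j)" "Suc i"] that by simp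
  qed
  ultimately show ?case using gt_patternsD(2)[OF p, of "Suc j" i] by force
qed simp

lemma row_sum_increment:
  assumes "i < k"
  shows "row_sum (increment p k i) l = row_sum p l + (if l = k then 1 else 0)"
proof (cases "l = k")
  case True
  have "(\<Sum>j<k. if j = i then 1 else 0 :: int) = 1" using assms by simp
  then show ?thesis using True by (simp add: row_sum_def increment_apply sum.distrib)
qed (simp add: row_sum_def increment_apply)

lemma pattern_weight_increment:
  assumes "1 \<le> k" "1 \<le> l" "i < k"
  shows "pattern_weight (increment p k i) l = pattern_weight p l + cartan l k"
  using assms by (auto simp: pattern_weight_def row_sum_increment cartan_def)

section \<open>The lattice of tableaux in pattern coordinates\<close>

locale gt_lattice =
  fixes n :: nat and lam :: "nat \<Rightarrow> nat"
  assumes antimono: "antimono lam" and lam_n: "lam n = 0"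
begin

abbreviation P where "P \<equiv> ssyt n lam"
abbreviation E where "E \<equiv> gt_edges n lam"
abbreviation \<Gamma> where "\<Gamma> \<equiv> gt_patterns n lam"
abbreviation g where "g \<equiv> row_count lam"

definition tableau :: "(nat \<Rightarrow> nat \<Rightarrow> int) \<Rightarrow> nat \<times> nat \<Rightarrow> nat" where
  "tableau p = inv_into P g p"

lemmas bij = bij_betw_row_count[OF antimono, of n]

lemma pattern [simp]: "S \<in> P \<Longrightarrow> g S \<in> \<Gamma>"
  using bij by (auto simp: bij_betw_def)

lemma tableau [simp]: "p \<in> \<Gamma> \<Longrightarrow> tableau p \<in> P" "p \<in> \<Gamma> \<Longrightarrow> g (tableau p) = p"
  unfolding tableau_def
  using bij_betw_inv_into_right[OF bij] bij_betwE[OF bij_betw_inv_into[OF bij]] by auto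

lemma pattern_inject: "S \<in> P \<Longrightarrow> T \<in> P \<Longrightarrow> g S = g T \<Longrightarrow> S = T"
  using bij by (auto simp: bij_betw_def inj_on_def)

lemma edgeE:
  assumes "(S, T) \<in> E k"
  obtains i where "k \<in> {1..<n}" "S \<in> P" "T \<in> P" "i < k" "g T = increment (g S) k i"
  using assms unfolding gt_edges_iff[OF antimono] by blast

lemma edgeI: "k \<in> {1..<n} \<Longrightarrow> S \<in> P \<Longrightarrow> T \<in> P \<Longrightarrow> i < k \<Longrightarrow> g T = increment (g S) k i \<Longrightarrow> (S, T) \<in> E k"
  unfolding gt_edges_iff[OF antimono] by blast

text \<open>The endpoints of an edge determine its colour and the raised index, so the product can
  be a function of two tableaux.\<close>

definition x :: "(nat \<times> nat \<Rightarrow> nat) \<Rightarrow> (nat \<times> nat \<Rightarrow> nat) \<Rightarrow> real" where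
  "x S T = (THE y. \<exists>k i. g T = increment (g S) k i \<and> y = gt_product (g S) k i)"

lemma x_eq: "g T = increment (g S) k i \<Longrightarrow> x S T = gt_product (g S) k i"
  unfolding x_def by (rule the_equality) (auto simp: increment_inject)

lemma bij_upper:
  assumes "k \<in> {1..<n}" "S \<in> P"
  shows "bij_betw (\<lambda>i. tableau (increment (g S) k i)) {i. i < k \<and> increment (g S) k i \<in> \<Gamma>} {T. (S, T) \<in> E k}"
proof (rule bij_betw_byWitness[where f' = "\<lambda>T. THE i. g T = increment (g S) k i"])
  show "\<forall>i\<in>{i. i < k \<and> increment (g S) k i \<in> \<Gamma>}.
      (THE i'. g (tableau (increment (g S) k i)) = increment (g S) k i') = i"
    by (auto simp: increment_inject)
  show "\<forall>T\<in>{T. (S, T) \<in> E k}. tableau (increment (g S) k (THE i. g T = increment (g S) k i)) = T"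
    by (auto elim!: edgeE simp: increment_inject intro!: pattern_inject) (metis pattern tableau)+
  show "(\<lambda>i. tableau (increment (g S) k i)) ` {i. i < k \<and> increment (g S) k i \<in> \<Gamma>} \<subseteq> {T. (S, T) \<in> E k}"
    using assms by (auto intro!: edgeI)
  show "(\<lambda>T. THE i. g T = increment (g S) k i) ` {T. (S, T) \<in> E k} \<subseteq> {i. i < k \<and> increment (g S) k i \<in> \<Gamma>}"
    by (auto elim!: edgeE simp: increment_inject) (metis pattern)
qed

lemma bij_lower:
  assumes "k \<in> {1..<n}" "T \<in> P"
  shows "bij_betw (\<lambda>i. tableau (decrement (g T) k i)) {i. i < k \<and> decrement (g T) k i \<in> \<Gamma>} {S. (S, T) \<in> E k}"
  unfolding bij_betw_def
proof
  have inj: "i = i'" if "decrement p k i = decrement p k i'" for p i i'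
    using fun_cong[OF fun_cong[OF that, of k], of i] by (simp add: decrement_apply split: if_splits)
  show "inj_on (\<lambda>i. tableau (decrement (g T) k i)) {i. i < k \<and> decrement (g T) k i \<in> \<Gamma>}"
    by (rule inj_onI) (metis (mono_tags, lifting) inj mem_Collect_eq tableau(2))
  show "(\<lambda>i. tableau (decrement (g T) k i)) ` {i. i < k \<and> decrement (g T) k i \<in> \<Gamma>} = {S. (S, T) \<in> E k}"
  proof (intro equalityI subsetI)
    fix S assume "S \<in> (\<lambda>i. tableau (decrement (g T) k i)) ` {i. i < k \<and> decrement (g T) k i \<in> \<Gamma>}"
    then show "S \<in> {S. (S, T) \<in> E k}" using assms by (auto intro!: edgeI)
  next
    fix S assume "S \<in> {S. (S, T) \<in> E k}"
    then obtain i where i: "S \<in> P" "i < k" "g T = increment (g S) k i" by (auto elim: edgeE)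
    then have "decrement (g T) k i = g S" by simp
    moreover have "tableau (g S) = S" using i(1) by (intro pattern_inject) auto
    ultimately show "S \<in> (\<lambda>i. tableau (decrement (g T) k i)) ` {i. i < k \<and> decrement (g T) k i \<in> \<Gamma>}"
      using i by (intro image_eqI[of _ _ i]) auto
  qed
qed

lemma component_rows:
  assumes S: "S \<in> P" and T: "T \<in> component E k S"
  shows "T \<in> P \<and> (\<forall>l. l \<noteq> k \<longrightarrow> g T l = g S l)"
proof -
  have "(S, T) \<in> (E k \<union> (E k)\<inverse>)\<^sup>*" using T by (simp add: component_def)
  then show ?thesis
  proof (induction rule: rtrancl_induct)
    case (step T T')
    then have "(T, T') \<in> E k \<or> (T', T) \<in> E k" by auto
    then show ?case
    proof
      assume "(T, T') \<in> E k"
      then show ?thesis using step by (auto elim!: edgeE simp: increment_def)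
    next
      assume "(T', T) \<in> E k"
      then obtain i where i: "T' \<in> P" "g T = increment (g T') k i" by (auto elim: edgeE)
      have "g T' l = g T l" if "l \<noteq> k" for l using i(2) that by (simp add: increment_def)
      then show ?thesis using step i(1) by simp
    qed
  qed (use S in simp)
qed

lemma component_step:
  assumes "T \<in> component E k S" "(T, T') \<in> E k \<or> (T', T) \<in> E k"
  shows "T' \<in> component E k S"
  using assms rtrancl_into_rtrancl[of S T "E k \<union> (E k)\<inverse>" T'] by (auto simp: component_def)

text \<open>A component of colour \<open>k\<close> fixes all other rows, and interlacing confines
  each entry of row \<open>k\<close> to an interval from \<open>lo i\<close> to \<open>hi i\<close>,
  where entry 0 has no upper bound from row \<open>k - 1\<close>. The component is thus a product of
  chains, with rank \<open>F\<close> and length \<open>M\<close>.\<close>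

lemma vertex_value_eq:
  assumes k: "k \<in> {1..<n}" and S: "S \<in> P"
  shows "vertex_value E k S = pattern_weight (g S) k"
proof -
  let ?C = "component E k S"
  have k': "1 \<le> k" "k < n" using k by auto
  define lo where "lo = (\<lambda>i. max (g S (Suc k) (Suc i)) (g S (k - 1) i))"
  define hi where "hi = (\<lambda>i. if i = 0 then g S (Suc k) 0 else min (g S (Suc k) i) (g S (k - 1) (i - 1)))"
  define F where "F = (\<lambda>T. \<Sum>i<k. g T k i - lo i)"
  define M where "M = (\<Sum>i<k. hi i - lo i)"
  have rows: "T \<in> P" "g T (Suc k) = g S (Suc k)" "g T (k - 1) = g S (k - 1)" if "T \<in> ?C" for T
    using component_rows[OF S that] k' by auto
  have lo: "lo i \<le> g T k i" if "T \<in> ?C" "i < k" for T i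
    using gt_patternsD(2)[OF pattern[OF rows(1)[OF that(1)]], of k i]
      gt_patternsD(1)[OF pattern[OF rows(1)[OF that(1)]], of "k - 1" i] k' rows(2,3)[OF that(1)]
    by (simp add: lo_def)
  have hi: "g T k i \<le> hi i" if "T \<in> ?C" "i < k" for T i
    using gt_patternsD(1)[OF pattern[OF rows(1)[OF that(1)]], of k i]
      gt_patternsD(2)[OF pattern[OF rows(1)[OF that(1)]], of "k - 1" "i - 1"] k' rows(2,3)[OF that(1)]
    by (cases i) (simp_all add: hi_def)
  have F0: "0 \<le> F T" if "T \<in> ?C" for T
    unfolding F_def using lo[OF that] by (intro sum_nonneg) simp
  have FM: "F T \<le> M" if "T \<in> ?C" for T
    unfolding F_def M_def using hi[OF that] by (intro sum_mono) simp
  have F_edge: "F T' = F T + 1" if "(T, T') \<in> E k" for T T'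
  proof -
    obtain i where i: "i < k" "g T' = increment (g T) k i" using \<open>(T, T') \<in> E k\<close> by (auto elim: edgeE)
    have "F T' = row_sum (g T') k - (\<Sum>i<k. lo i)" "F T = row_sum (g T) k - (\<Sum>i<k. lo i)"
      by (simp_all add: F_def row_sum_def sum_subtractf)
    then show ?thesis using row_sum_increment[OF i(1), of "g T" k] i(2) by simp
  qed
  have down: "\<exists>T'\<in>?C. F T' = F T - 1" if T: "T \<in> ?C" "0 < F T" for T
  proof -
    have "\<exists>i<k. lo i < g T k i"
      using T(2) lo[OF T(1)] unfolding F_def by (metis (no_types, lifting) diff_gt_0_iff_gt lessThan_iff not_less sum_nonpos)
    then obtain i where i: "i < k" "lo i < g T k i" by blast
    have dec: "decrement (g T) k i \<in> \<Gamma>"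
      using decrement_in_gt_patterns_iff[OF pattern[OF rows(1)[OF T(1)]] k' i(1)] i(2) rows(2,3)[OF T(1)]
      by (simp add: lo_def)
    let ?T' = "tableau (decrement (g T) k i)"
    have e: "(?T', T) \<in> E k" using dec i(1) k rows(1)[OF T(1)] by (intro edgeI[of k _ _ i]) auto
    then show ?thesis using component_step[OF T(1)] F_edge[OF e] by force
  qed
  have up: "\<exists>T'\<in>?C. F T' = F T + 1" if T: "T \<in> ?C" "F T < M" for T
  proof -
    have "\<exists>i<k. g T k i < hi i"
    proof (rule ccontr)
      assume "\<not> (\<exists>i<k. g T k i < hi i)"
      then have "hi i \<le> g T k i" if "i < k" for i using that by (meson not_less)
      then have "M \<le> F T" unfolding F_def M_def by (intro sum_mono) simp
      then show False using T(2) by simp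
    qed
    then obtain i where i: "i < k" "g T k i < hi i" by blast
    have inc: "increment (g T) k i \<in> \<Gamma>"
      using increment_in_gt_patterns_iff[OF pattern[OF rows(1)[OF T(1)]] k' i(1)] i(2) rows(2,3)[OF T(1)]
      by (auto simp: hi_def split: if_splits)
    let ?T' = "tableau (increment (g T) k i)"
    have e: "(T, ?T') \<in> E k" using inc i(1) k rows(1)[OF T(1)] by (intro edgeI[of k _ _ i]) auto
    then show ?thesis using component_step[OF T(1)] F_edge[OF e] by force
  qed
  have SC: "S \<in> ?C" by (simp add: component_def)
  have bot: "\<exists>z\<in>?C. F z = 0"
  proof -
    have "\<exists>z\<in>?C. F z = 0" if "T \<in> ?C" "F T = int j" for T j
      using that
    proof (induction j arbitrary: T)
      case (Suc j)
      then obtain T' where "T' \<in> ?C" "F T' = F T - 1" using down[of T] by auto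
      then show ?case using Suc by simp
    qed auto
    then show ?thesis using SC F0[OF SC] by (metis nat_0_le)
  qed
  have top: "\<exists>y\<in>?C. F y = M"
  proof -
    have "\<exists>y\<in>?C. F y = M" if "T \<in> ?C" "M - F T = int j" for T j
      using that
    proof (induction j arbitrary: T)
      case (Suc j)
      then obtain T' where "T' \<in> ?C" "F T' = F T + 1" using up[of T] by auto
      then show ?case using Suc by simp
    qed auto
    then show ?thesis using SC FM[OF SC] by (metis diff_ge_0_iff_ge nat_0_le)
  qed
  obtain z y where z: "z \<in> ?C" "F z = 0" and y: "y \<in> ?C" "F y = M" using bot top by blast
  have "vertex_value E k S = 2 * int (nat (F S)) - int (nat (F y))"
  proof (rule vertex_value_eqI[where z = z])
    fix r t assume "r \<in> ?C" "t \<in> ?C" "(r, t) \<in> E k"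
    then show "nat (F t) = Suc (nat (F r))" using F_edge[of r t] F0[of r] by simp
  next
    fix t assume "t \<in> ?C"
    then show "nat (F t) \<le> nat (F y)" using FM[of t] y by simp
  qed (use z y in auto)
  also have "\<dots> = 2 * F S - M" using F0[OF SC] F0[OF y(1)] y(2) by simp
  also have "\<dots> = 2 * row_sum (g S) k - ((\<Sum>i<k. lo i) + (\<Sum>i<k. hi i))"
    by (simp add: F_def M_def row_sum_def sum_subtractf)
  also have "(\<Sum>i<k. lo i) + (\<Sum>i<k. hi i) = row_sum (g S) (Suc k) + row_sum (g S) (k - 1)"
  proof -
    obtain l where l: "k = Suc l" using k' by (cases k) auto
    have "g S l l = 0" "0 \<le> g S (Suc k) (Suc l)"
      using gt_patternsD(3)[OF pattern[OF S], of l l] by simp_all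
    then have "(\<Sum>i<k. lo i) = (\<Sum>i<l. max (g S (Suc k) (Suc i)) (g S l i)) + g S (Suc k) (Suc l)"
      by (simp add: lo_def l)
    moreover have "(\<Sum>i<k. hi i) = g S (Suc k) 0 + (\<Sum>i<l. min (g S (Suc k) (Suc i)) (g S l i))"
      unfolding l sum.lessThan_Suc_shift by (simp add: hi_def l)
    \<comment> \<open>\<open>lo i\<close> and \<open>hi (Suc i)\<close> are the maximum and the
      minimum of the same two entries, so together they contribute both; only the two ends of row
      \<open>k + 1\<close> are left over.\<close>
    moreover have "(\<Sum>i<l. max (g S (Suc k) (Suc i)) (g S l i)) + (\<Sum>i<l. min (g S (Suc k) (Suc i)) (g S l i)) =
        (\<Sum>i<l. g S (Suc k) (Suc i)) + (\<Sum>i<l. g S l i)"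
      unfolding sum.distrib[symmetric] by (intro sum.cong) auto
    moreover have "row_sum (g S) (Suc k) = g S (Suc k) 0 + (\<Sum>i<l. g S (Suc k) (Suc i)) + g S (Suc k) (Suc l)"
      unfolding row_sum_def l sum.lessThan_Suc_shift[of _ "Suc l"] by simp
    ultimately show ?thesis by (simp add: row_sum_def l)
  qed
  finally show ?thesis by (simp add: pattern_weight_def)
qed

text \<open>The pattern of the tableau whose row \<open>i\<close> consists of entries
  \<open>i + 1\<close>, the one of highest weight.\<close>

definition top_pattern :: "nat \<Rightarrow> nat \<Rightarrow> int" where
  "top_pattern k i = (if i < k then int (lam i) else 0)"

lemma top_pattern: "top_pattern \<in> \<Gamma>"
proof -
  have "lam i = 0" if "n \<le> i" for i using antimonoD[OF antimono that] lam_n by simp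
  moreover have "lam (Suc i) \<le> lam i" for i using antimonoD[OF antimono, of i "Suc i"] by simp
  ultimately show ?thesis by (auto simp: gt_patterns_def top_pattern_def)
qed

abbreviation top where "top \<equiv> tableau top_pattern"

lemma top_maximal: "(top, T) \<notin> E k"
proof
  assume "(top, T) \<in> E k"
  then obtain i where "T \<in> P" "i < k" "g T = increment top_pattern k i"
    by (auto elim!: edgeE simp: top_pattern)
  then show False
    using gt_patternsD(1)[OF pattern, of T k i] by (simp add: increment_apply top_pattern_def)
qed

lemma not_edge_imp_unraisable:
  assumes "S \<in> P" "\<And>j T. j < K \<Longrightarrow> (S, T) \<notin> E j" "K \<le> n" "1 \<le> j" "j < K" "i < j"
  shows "increment (g S) j i \<notin> \<Gamma>"
  using edgeI[of j S "tableau (increment (g S) j i)" i] assms by auto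

lemma not_edge_imp_unlowerable:
  assumes "S \<in> P" "\<And>j R. j < K \<Longrightarrow> (R, S) \<notin> E j" "K \<le> n" "1 \<le> j" "j < K" "i < j"
  shows "decrement (g S) j i \<notin> \<Gamma>"
  using edgeI[of j "tableau (decrement (g S) j i)" S i] assms by auto

text \<open>If nothing can be raised, every row is repeated in the next one, up to row
  \<open>n\<close>, which is \<open>lam\<close>.\<close>

lemma maximal_imp_top:
  assumes S: "S \<in> P" and no: "\<And>k T. (S, T) \<notin> E k"
  shows "S = top"
proof (rule pattern_inject)
  have rows: "g S j i = g S (Suc j) i" if "j < n" "i < j" for j i
    by (rule unraisable_rows[OF pattern[OF S] order_refl _ that])
       (rule not_edge_imp_unraisable[OF S no order_refl])
  have "g S k i = int (lam i)" if "i < k" for k i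
  proof (cases "k \<le> n")
    case True
    have "g S k i = g S m i" if "k \<le> m" "m \<le> n" for m
      using that
    proof (induction m rule: dec_induct)
      case (step m)
      then show ?case using rows[of m i] \<open>i < k\<close> by simp
    qed simp
    from this[OF True order_refl]
    show ?thesis using gt_patternsD(4)[OF pattern[OF S], of n] by simp
  next
    case False
    then show ?thesis using gt_patternsD(4)[OF pattern[OF S], of k] by simp
  qed
  then show "g S = g top"
    using gt_patternsD(3)[OF pattern[OF S]] top_pattern by (auto simp: top_pattern_def fun_eq_iff)
qed (use S top_pattern in auto)

text \<open>Distinct lower neighbours of \<open>u\<close> arise by lowering different entries.
  Lowering both gives the entrywise minimum, from which the two moves lead back in exchanged order;
  this is how diamonds close downwards.\<close>

lemma increment_pair_eq:
  assumes "u = increment p j a" "u = increment q i b" "p \<noteq> q"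
  shows "u = (\<lambda>k m. max (p k m) (q k m))"
    "p = increment (\<lambda>k m. min (p k m) (q k m)) i b" "q = increment (\<lambda>k m. min (p k m) (q k m)) j a"
proof -
  have neq: "(j, a) \<noteq> (i, b)" using assms increment_cancel by blast
  have p: "p k m = u k m - (if k = j \<and> m = a then 1 else 0)" for k m
    using assms(1) by (simp add: increment_apply)
  have q: "q k m = u k m - (if k = i \<and> m = b then 1 else 0)" for k m
    using assms(2) by (simp add: increment_apply)
  show "u = (\<lambda>k m. max (p k m) (q k m))"
    using neq by (auto simp: fun_eq_iff p q)
  show "p = increment (\<lambda>k m. min (p k m) (q k m)) i b" "q = increment (\<lambda>k m. min (p k m) (q k m)) j a"
    using neq by (auto simp: fun_eq_iff p q increment_apply)
qed

lemma increment_pair_eq':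
  assumes "p = increment r i b" "q = increment r j a" "p \<noteq> q"
  shows "r = (\<lambda>k m. min (p k m) (q k m))"
    "(\<lambda>k m. max (p k m) (q k m)) = increment p j a" "(\<lambda>k m. max (p k m) (q k m)) = increment q i b"
  using assms by (auto simp: fun_eq_iff increment_apply)

lemma common_upper:
  assumes ST: "S \<noteq> T" and e: "(S, U) \<in> E j" "(T, U) \<in> E i"
  shows "g U = (\<lambda>k m. max (g S k m) (g T k m))" "\<exists>R. (R, S) \<in> E i \<and> (R, T) \<in> E j"
proof -
  from e(1) obtain a where j: "j \<in> {1..<n}" "S \<in> P" "U \<in> P" "a < j" "g U = increment (g S) j a" by (rule edgeE)
  from e(2) obtain b where i: "i \<in> {1..<n}" "T \<in> P" "b < i" "g U = increment (g T) i b" by (rule edgeE)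
  have "g S \<noteq> g T" using pattern_inject ST i j by blast
  note eq = increment_pair_eq[OF j(5) i(4) this]
  show "g U = (\<lambda>k m. max (g S k m) (g T k m))" by (rule eq(1))
  let ?p = "\<lambda>k m. min (g S k m) (g T k m)"
  have "?p \<in> \<Gamma>"
    by (rule gt_patterns_min[OF pattern[OF j(2)] pattern[OF i(2)]])
  note tab = tableau[OF this]
  have "(tableau ?p, S) \<in> E i"
    by (rule edgeI[OF i(1) tab(1) j(2) i(3)]) (subst tab(2), rule eq(2))
  moreover have "(tableau ?p, T) \<in> E j"
    by (rule edgeI[OF j(1) tab(1) i(2) j(4)]) (subst tab(2), rule eq(3))
  ultimately show "\<exists>R. (R, S) \<in> E i \<and> (R, T) \<in> E j" by blast
qed

lemma common_lower:
  assumes ST: "S \<noteq> T" and e: "(R, S) \<in> E i" "(R, T) \<in> E j"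
  shows "g R = (\<lambda>k m. min (g S k m) (g T k m))" "\<exists>U. (S, U) \<in> E j \<and> (T, U) \<in> E i"
proof -
  from e(1) obtain b where i: "i \<in> {1..<n}" "R \<in> P" "S \<in> P" "b < i" "g S = increment (g R) i b" by (rule edgeE)
  from e(2) obtain a where j: "j \<in> {1..<n}" "T \<in> P" "a < j" "g T = increment (g R) j a" by (rule edgeE)
  have "g S \<noteq> g T" using pattern_inject ST i j by blast
  note eq = increment_pair_eq'[OF i(5) j(4) this]
  show "g R = (\<lambda>k m. min (g S k m) (g T k m))" by (rule eq(1))
  let ?p = "\<lambda>k m. max (g S k m) (g T k m)"
  have "?p \<in> \<Gamma>"
    by (rule gt_patterns_max[OF pattern[OF i(3)] pattern[OF j(2)]])
  note tab = tableau[OF this]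
  have "(S, tableau ?p) \<in> E j"
    by (rule edgeI[OF j(1) i(3) tab(1) j(3)]) (subst tab(2), rule eq(2))
  moreover have "(T, tableau ?p) \<in> E i"
    by (rule edgeI[OF i(1) j(2) tab(1) i(4)]) (subst tab(2), rule eq(3))
  ultimately show "\<exists>U. (S, U) \<in> E j \<and> (T, U) \<in> E i" by blast
qed

lemma edge_vertices: "(S, T) \<in> E k \<Longrightarrow> S \<in> P" "(S, T) \<in> E k \<Longrightarrow> T \<in> P"
  by (auto elim: edgeE)

lemma ranked: "colored_ranked_poset {1..<n} P E"
proof -
  \<comment> \<open>An edge raises one entry in a row below \<open>n\<close>, so the sum over these
    rows grows by one; subtracting the minimum makes the value 0 occur.\<close>
  define h where "h = (\<lambda>T. nat (\<Sum>k<n. row_sum (g T) k))"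
  define f where "f = (\<lambda>T. h T - Min (h ` P))"
  have fin: "finite P" by (rule finite_ssyt[OF antimono lam_n])
  have ne: "P \<noteq> {}" using tableau(1)[OF top_pattern] by blast
  have h_edge: "h T = Suc (h S)" if "(S, T) \<in> E k" for S T k
  proof -
    obtain i where i: "k \<in> {1..<n}" "S \<in> P" "i < k" "g T = increment (g S) k i"
      using \<open>(S, T) \<in> E k\<close> by (auto elim: edgeE)
    have "(\<Sum>l<n. row_sum (g T) l) = (\<Sum>l<n. row_sum (g S) l) + 1"
      using i by (simp add: row_sum_increment sum.distrib)
    moreover have "0 \<le> (\<Sum>l<n. row_sum (g S) l)" by (simp add: row_sum_def sum_nonneg)
    ultimately show ?thesis by (simp add: h_def)
  qed
  have f_edge: "f T = Suc (f S)" if "(S, T) \<in> E k" for S T k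
  proof -
    have "Min (h ` P) \<le> h S" using fin edge_vertices[OF that] by simp
    then show ?thesis using h_edge[OF that] by (simp add: f_def)
  qed
  have "Min (h ` P) \<in> h ` P" by (rule Min_in) (use fin ne in auto)
  then obtain z where "z \<in> P" "h z = Min (h ` P)" by auto
  then have "is_rank_function P (\<Union>i\<in>{1..<n}. E i) f"
    unfolding is_rank_function_def using f_edge by (intro conjI bexI[of _ z]) (auto simp: f_def)
  moreover have "E i \<inter> E j = {}" if "i \<noteq> j" for i j
    using that by (auto elim!: edgeE simp: increment_inject)
  moreover have "E i = {}" if "i \<notin> {1..<n}" for i
    using that by (auto elim: edgeE)
  moreover have "E i \<subseteq> P \<times> P" for i using edge_vertices by auto
  ultimately show ?thesis
    unfolding colored_ranked_poset_def using fin by blast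
qed

sublocale diamond_graph n P E top x
proof
  show "colored_ranked_poset {1..<n} P E" by (rule ranked)
next
  fix i j :: nat and S T :: "nat \<times> nat \<Rightarrow> nat" assume "S \<noteq> T"
  note up = common_upper[OF this] and low = common_lower[OF this]
  let ?U = "{U. (S, U) \<in> E j \<and> (T, U) \<in> E i}" and ?R = "{R. (R, S) \<in> E i \<and> (R, T) \<in> E j}"
  have U: "U = U'" if "U \<in> ?U" "U' \<in> ?U" for U U'
  proof (rule pattern_inject)
    show "U \<in> P" "U' \<in> P" using that edge_vertices by blast+
    show "g U = g U'" using up(1)[of U j i] up(1)[of U' j i] that by simp
  qed
  have R: "R = R'" if "R \<in> ?R" "R' \<in> ?R" for R R'
  proof (rule pattern_inject)
    show "R \<in> P" "R' \<in> P" using that edge_vertices by blast+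
    show "g R = g R'" using low(1)[of R i j] low(1)[of R' i j] that by simp
  qed
  show "(\<exists>u r. ?U = {u} \<and> ?R = {r}) \<or> (?U = {} \<and> ?R = {})"
  proof (cases "?U = {}")
    case True
    then have "?R = {}" using low(2) by blast
    then show ?thesis using True by (intro disjI2 conjI)
  next
    case False
    then obtain u where u: "u \<in> ?U" by blast
    then obtain r where r: "r \<in> ?R" using up(2) by blast
    have "?U = {u}" using U u by (intro equalityI subsetI) (simp_all only: singleton_iff)
    moreover have "?R = {r}" using R r by (intro equalityI subsetI) (simp_all only: singleton_iff)
    ultimately show ?thesis by blast
  qed
next
  fix S T k S' assume e: "(S, T) \<in> E k" "(S', T) \<in> E k"
    and no: "\<And>j U. j < k \<Longrightarrow> (S, U) \<notin> E j" "\<And>j U. j < k \<Longrightarrow> (S', U) \<notin> E j"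
  from e(1) obtain i where i: "k \<in> {1..<n}" "S \<in> P" "T \<in> P" "i < k" "g T = increment (g S) k i" by (rule edgeE)
  from e(2) obtain i' where i': "S' \<in> P" "i' < k" "g T = increment (g S') k i'" by (rule edgeE)
  have k: "k \<le> n" using i by simp
  \<comment> \<open>Row \<open>k - 1\<close> is shared by \<open>S\<close>, \<open>S'\<close> and
    \<open>T\<close>, and it now determines row \<open>k\<close> of \<open>S\<close> and of
    \<open>S'\<close> except at its last index. Both edges must therefore raise that last entry or
    the same earlier one.\<close>
  have rows: "g S (k - 1) l = g S k l" "g S' (k - 1) l = g S' k l" if "l < k - 1" for l
    using unraisable_rows[OF pattern[OF i(2)] k not_edge_imp_unraisable[OF i(2) no(1) k], of "k - 1" l]
      unraisable_rows[OF pattern[OF i'(1)] k not_edge_imp_unraisable[OF i'(1) no(2) k], of "k - 1" l] that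
    by auto
  have S: "g S l m = g T l m - (if l = k \<and> m = i then 1 else 0)"
    and S': "g S' l m = g T l m - (if l = k \<and> m = i' then 1 else 0)" for l m
    by (subst i(5), simp add: increment_apply) (subst i'(3), simp add: increment_apply)
  have "i = i'"
  proof (rule ccontr)
    assume neq: "i \<noteq> i'"
    then have "i < k - 1 \<or> i' < k - 1" using i(4) i'(2) by linarith
    then show False
    proof
      assume "i < k - 1"
      then show False using rows[of i] neq by (simp add: S S' split: if_splits)
    next
      assume "i' < k - 1"
      then show False using rows[of i'] neq by (simp add: S S' split: if_splits)
    qed
  qed
  then show "S = S'" using pattern_inject i i' increment_cancel by metis
next
  fix S T k T' assume e: "(S, T) \<in> E k" "(S, T') \<in> E k"
    and no: "\<And>j R. j < k \<Longrightarrow> (R, T) \<notin> E j" "\<And>j R. j < k \<Longrightarrow> (R, T') \<notin> E j"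
  from e(1) obtain i where i: "k \<in> {1..<n}" "S \<in> P" "T \<in> P" "i < k" "g T = increment (g S) k i" by (rule edgeE)
  from e(2) obtain i' where i': "T' \<in> P" "i' < k" "g T' = increment (g S) k i'" by (rule edgeE)
  have k: "k \<le> n" using i by simp
  \<comment> \<open>Dually, the shared row \<open>k - 1\<close> determines row \<open>k\<close> of
    \<open>T\<close> and of \<open>T'\<close> except at index 0, so the two raised indices cannot
    differ.\<close>
  have rows: "g T (k - 1) l = g T k (Suc l)" "g T' (k - 1) l = g T' k (Suc l)" if "l < k - 1" for l
    using unlowerable_rows[OF pattern[OF i(3)] k not_edge_imp_unlowerable[OF i(3) no(1) k], of "k - 1" l]
      unlowerable_rows[OF pattern[OF i'(1)] k not_edge_imp_unlowerable[OF i'(1) no(2) k], of "k - 1" l] that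
    by auto
  have "i = i'"
  proof (rule ccontr)
    assume neq: "i \<noteq> i'"
    then have "0 < i \<or> 0 < i'" by linarith
    then show False
    proof
      assume "0 < i"
      then have "i - 1 < k - 1" "k - 1 \<noteq> k" using i(4) by auto
      then show False using rows[of "i - 1"] neq \<open>0 < i\<close> by (simp add: i(5) i'(3) increment_apply)
    next
      assume "0 < i'"
      then have "i' - 1 < k - 1" "k - 1 \<noteq> k" using i'(2) by auto
      then show False using rows[of "i' - 1"] neq \<open>0 < i'\<close> by (simp add: i(5) i'(3) increment_apply)
    qed
  qed
  then show "T = T'" using pattern_inject i i' by metis
next
  show "top \<in> P" by (rule tableau(1)[OF top_pattern])
  show "(top, T) \<notin> E k" for T k by (rule top_maximal)
  show "S = top" if "S \<in> P" "\<And>k T. (S, T) \<notin> E k" for S by (rule maximal_imp_top[OF that])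
next
  fix S T k assume "(S, T) \<in> E k"
  then obtain i where i: "k \<in> {1..<n}" "S \<in> P" "T \<in> P" "i < k" "g T = increment (g S) k i" by (rule edgeE)
  then have "increment (g S) k i \<in> \<Gamma>" using pattern[of T] by simp
  then show "0 < x S T" using gt_product_pos[OF pattern[OF i(2)], of k i] i x_eq[OF i(5)] by simp
next
  fix k S assume k: "k \<in> {1..<n}" and S: "S \<in> P"
  have "(\<Sum>R | (R, S) \<in> E k. x R S) =
      (\<Sum>i | i < k \<and> decrement (g S) k i \<in> \<Gamma>. x (tableau (decrement (g S) k i)) S)"
    by (rule sum.reindex_bij_betw[OF bij_lower[OF k S], symmetric])
  also have "\<dots> = (\<Sum>i | i < k \<and> decrement (g S) k i \<in> \<Gamma>. gt_product (decrement (g S) k i) k i)"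
    using x_eq[of S "tableau (decrement (g S) k i)" k i for i] by (intro sum.cong) auto
  finally have low: "(\<Sum>R | (R, S) \<in> E k. x R S) = \<dots>" .
  have "(\<Sum>T | (S, T) \<in> E k. x S T) =
      (\<Sum>i | i < k \<and> increment (g S) k i \<in> \<Gamma>. x S (tableau (increment (g S) k i)))"
    by (rule sum.reindex_bij_betw[OF bij_upper[OF k S], symmetric])
  also have "\<dots> = (\<Sum>i | i < k \<and> increment (g S) k i \<in> \<Gamma>. gt_product (g S) k i)"
    using x_eq[of "tableau (increment (g S) k i)" S k i for i] by (intro sum.cong) auto
  finally have up: "(\<Sum>T | (S, T) \<in> E k. x S T) = \<dots>" .
  show "(\<Sum>R | (R, S) \<in> E k. x R S) - (\<Sum>T | (S, T) \<in> E k. x S T) = of_int (vertex_value E k S)"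
    unfolding low up vertex_value_eq[OF k S] using gt_product_crossing[OF pattern[OF S], of k] k by simp
next
  fix S T U j i R
  assume ST: "S \<noteq> T" and e: "(S, U) \<in> E j" "(T, U) \<in> E i" "(R, S) \<in> E i" "(R, T) \<in> E j"
  from e(3) obtain b where b: "i \<in> {1..<n}" "R \<in> P" "S \<in> P" "b < i" "g S = increment (g R) i b" by (rule edgeE)
  from e(4) obtain a where a: "j \<in> {1..<n}" "T \<in> P" "a < j" "g T = increment (g R) j a" by (rule edgeE)
  have neq: "g S \<noteq> g T" using pattern_inject ST a b by blast
  have U: "U \<in> P" using edge_vertices[OF e(1)] by simp
  have gU: "g U = increment (g S) j a" "g U = increment (g T) i b"
    using increment_pair_eq'(2,3)[OF b(5) a(4) neq] common_upper(1)[OF ST e(1,2)] by simp_all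
  have ab: "(j, a) \<noteq> (i, b)" using neq a b by auto
  have pos: "0 < gt_product (g R) i b" "0 < gt_product (g R) j a" "0 < gt_product (g S) j a" "0 < gt_product (g T) i b"
    using gt_product_pos[OF pattern[OF b(2)], of i b] gt_product_pos[OF pattern[OF b(2)], of j a]
      gt_product_pos[OF pattern[OF b(3)], of j a] gt_product_pos[OF pattern[OF a(2)], of i b]
      a b gU pattern[OF b(3)] pattern[OF a(2)] pattern[OF U] by simp_all
  have "gt_product (increment (g R) i b) j a * gt_product (increment (g R) j a) i b =
      gt_product (g R) j a * gt_product (g R) i b"
    by (rule gt_product_diamond) (use a b ab pos in auto)
  then show "x S U * x T U = x R S * x R T"
    using x_eq[OF gU(1)] x_eq[OF gU(2)] x_eq[OF b(5)] x_eq[OF a(4)] a(4) b(5) by (simp add: mult.commute)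
next
  fix i j S T assume ij: "i \<in> {1..<n}" "j \<in> {1..<n}" and e: "(S, T) \<in> E i"
  from e obtain a where a: "S \<in> P" "T \<in> P" "a < i" "g T = increment (g S) i a" by (rule edgeE)
  show "vertex_value E j T = vertex_value E j S + cartan j i"
    unfolding vertex_value_eq[OF ij(2) a(1)] vertex_value_eq[OF ij(2) a(2)] a(4)
    using ij a(3) by (intro pattern_weight_increment) auto
qed

lemma vertex_value_top:
  assumes k: "k \<in> {1..<n}"
  shows "vertex_value E k top = int (lam (k - 1)) - int (lam k)"
proof -
  obtain l where l: "k = Suc l" using k by (cases k) auto
  show ?thesis
    unfolding vertex_value_eq[OF k tableau(1)[OF top_pattern]] tableau(2)[OF top_pattern]
    by (simp add: pattern_weight_def row_sum_def top_pattern_def l)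
qed

end

lemma (in gt_lattice) solitary_and_edge_minimal:
  assumes irr: "irreducible_sl_representation n scale \<phi>" and hw: "has_highest_weight n scale \<phi> lam"
  shows "solitary n scale \<phi> P E" "edge_minimal n scale \<phi> P E"
proof -
  obtain v0 where v0: "v0 \<noteq> 0" "\<And>k. k \<in> {1..<n} \<Longrightarrow> \<phi> (gen_X n k) v0 = 0"
    "\<And>k. k \<in> {1..<n} \<Longrightarrow> \<phi> (gen_H n k) v0 = scale (of_nat (lam (k - 1)) - of_nat (lam k)) v0"
    using hw unfolding has_highest_weight_def by blast
  interpret M: diamond_graph_module n scale \<phi> P E top x v0
  proof unfold_locales
    show "\<phi> (gen_H n k) v0 = scale (of_int (vertex_value E k top)) v0" if "k \<in> {1..<n}" for k
      using v0(3)[OF that] vertex_value_top[OF that] by simp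
  qed (use irr v0 in auto)
  show "solitary n scale \<phi> P E" by (rule M.graph_solitary)
  show "edge_minimal n scale \<phi> P E" by (rule M.graph_edge_minimal)
qed

theorem theorem5p5:
  fixes n :: nat and lam :: "nat \<Rightarrow> nat"
    and scale :: "complex \<Rightarrow> 'v \<Rightarrow> 'v::ab_group_add"
    and \<phi> :: "complex mat \<Rightarrow> 'v \<Rightarrow> 'v"
  assumes "n \<ge> 2"
    and "antimono lam" and "lam n = 0"
    and "irreducible_sl_representation n scale \<phi>"
    and "has_highest_weight n scale \<phi> lam"
  shows "(\<forall>c d c' d'.
            edge_labels {1..<n} (gt_edges n lam) c d \<and>
            crossing_condition {1..<n} (ssyt n lam) (gt_edges n lam) c d \<and>
            diamond_condition {1..<n} (ssyt n lam) (gt_edges n lam) c d \<and>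
            edge_labels {1..<n} (gt_edges n lam) c' d' \<and>
            crossing_condition {1..<n} (ssyt n lam) (gt_edges n lam) c' d' \<and>
            diamond_condition {1..<n} (ssyt n lam) (gt_edges n lam) c' d' \<longrightarrow>
            (\<forall>k\<in>{1..<n}. \<forall>s t. (s, t) \<in> gt_edges n lam k \<longrightarrow>
               edge_product c d s t = edge_product c' d' s t)) \<and>
         solitary n scale \<phi> (ssyt n lam) (gt_edges n lam) \<and>
         edge_minimal n scale \<phi> (ssyt n lam) (gt_edges n lam)"
proof (intro conjI allI impI ballI)
  interpret gt_lattice n lam by unfold_locales (use assms in auto)
  fix c d c' d' k s t
  assume *: "edge_labels {1..<n} (gt_edges n lam) c d \<and>
      crossing_condition {1..<n} (ssyt n lam) (gt_edges n lam) c d \<and>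
      diamond_condition {1..<n} (ssyt n lam) (gt_edges n lam) c d \<and>
      edge_labels {1..<n} (gt_edges n lam) c' d' \<and>
      crossing_condition {1..<n} (ssyt n lam) (gt_edges n lam) c' d' \<and>
      diamond_condition {1..<n} (ssyt n lam) (gt_edges n lam) c' d'"
    and e: "(s, t) \<in> gt_edges n lam k"
  then show "edge_product c d s t = edge_product c' d' s t"
    using edge_products_of_conditions[of c d, OF _ _ e] edge_products_of_conditions[of c' d', OF _ _ e] by simp
next
  interpret gt_lattice n lam by unfold_locales (use assms in auto)
  show "solitary n scale \<phi> (ssyt n lam) (gt_edges n lam)" "edge_minimal n scale \<phi> (ssyt n lam) (gt_edges n lam)"
    using solitary_and_edge_minimal assms(4,5) by blast+
qed

end
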